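(* Let $\Lambda\in\mathcal{P}(\mathfrak{C})$ and $\kappa\in(0,\infty)$. Then $$\inf\Big\{\int_{\mathfrak{C}}\mathrm{HK}_\kappa^2(\mu,\nu)\,d\Lambda(\mu)\;\Big|\;\nu\in\mathcal{M}_+(\Omega)\Big\}$$ is equal to $$\sup\Big\{\int_{\mathfrak{C}}\int_\Omega\Psi(\mu,x)\,d\mu(x)\,d\Lambda(\mu)\Big\},$$ where the supremum is over all pairs $\Psi,\Phi\in C(\mathfrak{C}\times\Omega)$ such that $(\Psi(\mu,\cdot),\Phi(\mu,\cdot))\in Q_\kappa$ for all $\mu\in\mathfrak{C}$ and $\int_{\mathfrak{C}}\Phi(\mu,y)\,d\Lambda(\mu)\ge0$ for all $y\in\Omega$.
   Context: $\Omega \subset \mathbb{R}^d$ is a compact convex set with non-empty interior. $C(Y)$ denotes continuous real-valued functions on $Y$. $\mathcal{M}_+(\Omega)$ denotes the non-negative Radon measures on $\Omega$ with the weak* topology (duality with $C(\Omega)$), and $\|\mu\| = \mu(\Omega)$. For $\kappa\in(0,\infty)$ and $\mu,\nu\in\mathcal{M}_+(\Omega)$ the Hellinger--Kantorovich distance is $$\mathrm{HK}_\kappa^2(\mu,\nu) := \inf_{\gamma\in\mathcal{M}_+(\Omega\times\Omega)} \int \hat c_\kappa\,d\gamma + \mathrm{KL}(P_1\gamma|\mu)+\mathrm{KL}(P_2\gamma|\nu),$$ where $P_1\gamma,P_2\gamma$ are the two marginals of $\gamma$, $\hat c_\kappa(x,y) = -2\log\cos(|x-y|/\kappa)$ if $|x-y|\le\kappa\pi/2$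 (with $-\log 0=+\infty$) and $+\infty$ otherwise, and $\mathrm{KL}(\mu|\nu)=\int\varphi(d\mu/d\nu)\,d\nu$ if $\mu\ll\nu$, $\mu\ge0$, and $+\infty$ otherwise, with $\varphi(s)=s\log s-s+1$ for $s>0$, $\varphi(0)=1$. It is known that $\mathrm{HK}_\kappa$ metrizes the weak* topology on $\mathcal{M}_+(\Omega)$. Let $\mathrm{Cos}(s):=\cos(\min\{|s|,\pi/2\})$ and $$Q_\kappa:=\{(\psi,\phi)\in C(\Omega)^2 : \psi(x),\phi(y)\in(-\infty,1],\ (1-\psi(x))(1-\phi(y))\ge\mathrm{Cos}^2(|x-y|/\kappa)\ \text{for all }x,y\in\Omega\}.$$ It is known that $\mathrm{HK}_\kappa^2(\mu,\nu)=\sup_{(\psi,\phi)\in Q_\kappa}\int\psi\,d\mu+\int\phi\,d\nu$. Fix $M\in(0,\infty)$ and let $\mathfrak{C} := \{\mu\in\mathcal{M}_+(\Omega) : \|\mu\|\le M\}$, a compact metrizable space in the weak* topology, equipped with its Borel $\sigma$-algebra; $\mathcal{P}(\mathfrak{C})$ is the set of Borel probability measures on $\mathfrak{C}$. *)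

theory Defs
  imports "HOL-Probability.Probability"
begin

text \<open>
  On a compact subset of a Euclidean space every finite Borel measure is Radon, so the
  non-negative Radon measures are the finite measures on the Borel sets of \<open>X\<close>.
  The same definition serves for \<open>\<Omega>\<close> and for \<open>\<Omega> \<times> \<Omega>\<close>.
\<close>
definition radon_measures :: "'a::euclidean_space set \<Rightarrow> 'a measure set" where
  "radon_measures X = {\<mu>. sets \<mu> = sets (restrict_space borel X) \<and> finite_measure \<mu>}"

text \<open>The coarsest topology making \<open>\<mu> \<mapsto> \<integral> f d\<mu>\<close> continuous for every continuous \<open>f\<close> on \<open>X\<close>.\<close>
definition weak_star :: "'a::euclidean_space set \<Rightarrow> 'a measure topology" where
  "weak_star X = pullback_topology (radon_measures X)
     (\<lambda>\<mu>. \<lambda>f\<in>{f. continuous_on X f}. LINT x|\<mu>. f x)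
     (product_topology (\<lambda>_. euclideanreal) {f. continuous_on X f})"

definition mass_ball :: "'a::euclidean_space set \<Rightarrow> real \<Rightarrow> 'a measure set" where
  "mass_ball X M = {\<mu> \<in> radon_measures X. measure \<mu> X \<le> M}"

definition mass_ball_top :: "'a::euclidean_space set \<Rightarrow> real \<Rightarrow> 'a measure topology" where
  "mass_ball_top X M = subtopology (weak_star X) (mass_ball X M)"

definition borel_of_topology :: "'b topology \<Rightarrow> 'b measure" where
  "borel_of_topology T = sigma (topspace T) {U. openin T U}"

definition borel_prob_measures :: "'b topology \<Rightarrow> 'b measure set" where
  "borel_prob_measures T = {\<Lambda>. sets \<Lambda> = sets (borel_of_topology T) \<and> prob_space \<Lambda>}"

definition kl_entropy :: "real \<Rightarrow> real" where
  "kl_entropy s = (if s = 0 then 1 else s * ln s - s + 1)"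

text \<open>\<open>KL \<mu> \<nu>\<close> is \<open>KL(\<mu>|\<nu>)\<close>; in the library, \<open>absolutely_continuous \<nu> \<mu>\<close> means \<open>\<mu> << \<nu>\<close>.\<close>
definition KL :: "'a measure \<Rightarrow> 'a measure \<Rightarrow> ennreal" where
  "KL \<mu> \<nu> = (if absolutely_continuous \<nu> \<mu>
     then \<integral>\<^sup>+ x. ennreal (kl_entropy (enn2real (RN_deriv \<nu> \<mu> x))) \<partial>\<nu> else \<infinity>)"

text \<open>
  The strict inequality is deliberate: for \<open>norm (x - y) = \<kappa> * pi / 2\<close> the cosine vanishes and the
  cost is \<open>-2 log 0 = \<infinity>\<close>, whereas \<open>ln 0 = 0\<close> here.
\<close>
definition hk_cost :: "real \<Rightarrow> 'a::euclidean_space \<Rightarrow> 'a \<Rightarrow> ennreal" where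
  "hk_cost \<kappa> x y = (if norm (x - y) < \<kappa> * pi / 2
     then ennreal (- 2 * ln (cos (norm (x - y) / \<kappa>))) else \<infinity>)"

text \<open>\<open>HK2\<close> is the square of the Hellinger--Kantorovich distance.\<close>
definition HK2 :: "real \<Rightarrow> 'a::euclidean_space set \<Rightarrow> 'a measure \<Rightarrow> 'a measure \<Rightarrow> ennreal" where
  "HK2 \<kappa> \<Omega> \<mu> \<nu> = (INF \<gamma> \<in> radon_measures (\<Omega> \<times> \<Omega>).
     (\<integral>\<^sup>+ (x, y). hk_cost \<kappa> x y \<partial>\<gamma>)
     + KL (distr \<gamma> (restrict_space borel \<Omega>) fst) \<mu>
     + KL (distr \<gamma> (restrict_space borel \<Omega>) snd) \<nu>)"

definition Cos :: "real \<Rightarrow> real" where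
  "Cos s = cos (min \<bar>s\<bar> (pi / 2))"

definition Q_set ::
  "real \<Rightarrow> 'a::euclidean_space set \<Rightarrow> (('a \<Rightarrow> real) \<times> ('a \<Rightarrow> real)) set" where
  "Q_set \<kappa> \<Omega> = {(\<psi>, \<phi>). continuous_on \<Omega> \<psi> \<and> continuous_on \<Omega> \<phi>
     \<and> (\<forall>x\<in>\<Omega>. \<psi> x \<le> 1) \<and> (\<forall>y\<in>\<Omega>. \<phi> y \<le> 1)
     \<and> (\<forall>x\<in>\<Omega>. \<forall>y\<in>\<Omega>. (1 - \<psi> x) * (1 - \<phi> y) \<ge> (Cos (norm (x - y) / \<kappa>))\<^sup>2)}"

definition dual_admissible ::
  "real \<Rightarrow> 'a::euclidean_space set \<Rightarrow> real \<Rightarrow> 'a measure measure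
     \<Rightarrow> (('a measure \<Rightarrow> 'a \<Rightarrow> real) \<times> ('a measure \<Rightarrow> 'a \<Rightarrow> real)) set" where
  "dual_admissible \<kappa> \<Omega> M \<Lambda> = {(\<Psi>, \<Phi>).
     continuous_map (prod_topology (mass_ball_top \<Omega> M) (top_of_set \<Omega>)) euclideanreal
       (\<lambda>(\<mu>, x). \<Psi> \<mu> x)
     \<and> continuous_map (prod_topology (mass_ball_top \<Omega> M) (top_of_set \<Omega>)) euclideanreal
       (\<lambda>(\<mu>, x). \<Phi> \<mu> x)
     \<and> (\<forall>\<mu> \<in> mass_ball \<Omega> M. (\<Psi> \<mu>, \<Phi> \<mu>) \<in> Q_set \<kappa> \<Omega>)
     \<and> (\<forall>y\<in>\<Omega>. (LINT \<mu>|\<Lambda>. \<Phi> \<mu> y) \<ge> 0)}"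

end

theory Submission
  imports Defs
begin

text \<open>
  Weak duality for \<open>HK2\<close> follows from Young's inequality for the entropy; integrating it over \<open>\<Lambda>\<close> gives
  one inequality, by Fubini's theorem. This needs \<open>\<Phi>\<close> to be bounded, hence the sequential compactness
  of the mass ball: measures on \<open>\<Omega>\<close> are lifted to the real line along a space-filling curve, and
  Helly's selection theorem applies there.

  For the other inequality no minimax theorem is used. The barycentre is sought among the measures
  with weights \<open>v\<close> on a finite net \<open>Y\<close> of \<open>\<Omega>\<close>. For such measures \<open>HK2\<close> is, up to a small error and uniformly
  in \<open>\<mu>\<close>, at most the maximum of finitely many dual values, which are affine in \<open>v\<close>. Replacing the
  maximum by a log-sum-exp gives an objective that is smooth in \<open>v\<close>. At its minimiser over a box, the
  derivative is the \<open>\<Lambda>\<close>-integral of a softmax average of dual potentials. These averages depend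
  continuously on \<open>\<mu>\<close>, and the first-order conditions say precisely that they satisfy the constraint
  on \<open>\<integral>\<Phi> d\<Lambda>\<close>.
\<close>

section \<open>Soft maxima and minimisation over boxes\<close>

text \<open>An optimal dual pair for a given \<open>\<mu>\<close> need be neither unique nor
  continuous in \<open>\<mu>\<close>; it is therefore replaced by an average over a finite family
  \<open>G\<close> fixed in advance. Two smoothings occur. The one with parameter \<open>N\<close>
  acts over \<open>Y\<close> for a single \<open>\<mu>\<close>: it makes the potential
  differentiable in \<open>q\<close>, and its derivatives become the weights of a transport plan.
  The one with parameter \<open>n\<close> acts over \<open>G\<close> and allows differentiation
  under \<open>\<Lambda>\<close>. Each costs the logarithm of a cardinality divided by its
  parameter. Both ends of the box \<open>{\<eta>..R}\<close> for the weights matter. Weights of at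
  least \<open>\<eta>\<close> bound the inner potentials \<open>q\<close> from above, so that a
  finite \<open>G\<close> suffices; the price is \<open>\<eta> * card Y\<close>. The end
  \<open>R\<close> gives compactness and must not be active at the minimiser, as otherwise the sign
  of a derivative is lost. This is circular: \<open>R\<close> has to dominate
  \<open>ln (card G) / n\<close>, while \<open>G\<close> depends on \<open>R\<close>. The circle is
  broken by choosing \<open>n\<close> last, so that this quotient stays below a constant known
  before \<open>G\<close>.\<close>

definition lse :: "real \<Rightarrow> 'i set \<Rightarrow> ('i \<Rightarrow> real) \<Rightarrow> real" where
  "lse N I w = ln (\<Sum>i\<in>I. exp (N * w i)) / N"

text \<open>The gradient of \<open>lse N I\<close> at \<open>w\<close>, by
  \<open>DERIV_lse\<close>.\<close>

definition softmax :: "real \<Rightarrow> 'i set \<Rightarrow> ('i \<Rightarrow> real) \<Rightarrow> 'i \<Rightarrow> real" where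
  "softmax N I w i = exp (N * w i) / (\<Sum>j\<in>I. exp (N * w j))"

lemma sum_exp_pos:
  assumes "finite I" "I \<noteq> {}"
  shows "0 < (\<Sum>i\<in>I. exp (w i :: real))"
  using assms by (intro sum_pos) auto

lemma softmax_nonneg: "0 \<le> softmax N I w i"
  by (simp add: softmax_def sum_nonneg)

lemma softmax_pos: "finite I \<Longrightarrow> I \<noteq> {} \<Longrightarrow> 0 < softmax N I w i"
  using sum_exp_pos[of I "\<lambda>i. N * w i"] by (simp add: softmax_def)

lemma sum_softmax: "finite I \<Longrightarrow> I \<noteq> {} \<Longrightarrow> (\<Sum>i\<in>I. softmax N I w i) = 1"
  using sum_exp_pos[of I "\<lambda>i. N * w i"]
  by (simp add: softmax_def flip: sum_divide_distrib)

lemma softmax_le_1: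
  assumes "finite I" "i \<in> I"
  shows "softmax N I w i \<le> 1"
proof -
  have "softmax N I w i \<le> (\<Sum>i\<in>I. softmax N I w i)"
    using assms by (intro member_le_sum softmax_nonneg) auto
  moreover have "I \<noteq> {}" using assms by auto
  ultimately show ?thesis using assms sum_softmax[of I N w] by simp
qed

lemma lse_ge:
  assumes "0 < N" "finite I" "i \<in> I"
  shows "w i \<le> lse N I w"
proof -
  have "exp (N * w i) \<le> (\<Sum>i\<in>I. exp (N * w i))"
    using assms by (intro member_le_sum) auto
  hence "N * w i \<le> ln (\<Sum>i\<in>I. exp (N * w i))"
    using sum_exp_pos[of I "\<lambda>i. N * w i"] assms by (subst ln_ge_iff) auto
  thus ?thesis using assms by (simp add: lse_def field_simps)
qed

text \<open>\<open>lse\<close> commutes with adding a constant to all arguments. Monotonicity, the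
  Lipschitz bound in the supremum norm and the gap to the maximum all follow from this.\<close>

lemma lse_le_shift:
  assumes "0 < N" "finite I" "I \<noteq> {}" and le: "\<And>i. i \<in> I \<Longrightarrow> w i \<le> v i + c"
  shows "lse N I w \<le> lse N I v + c"
proof -
  have "(\<Sum>i\<in>I. exp (N * w i)) \<le> (\<Sum>i\<in>I. exp (N * v i) * exp (N * c))"
    using assms by (intro sum_mono) (simp add: flip: exp_add distrib_left)
  also have "\<dots> = (\<Sum>i\<in>I. exp (N * v i)) * exp (N * c)"
    by (simp add: sum_distrib_right)
  finally have "ln (\<Sum>i\<in>I. exp (N * w i)) \<le> ln ((\<Sum>i\<in>I. exp (N * v i)) * exp (N * c))"
    using sum_exp_pos[of I "\<lambda>i. N * w i"] assms by (intro ln_mono) auto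
  also have "\<dots> = ln (\<Sum>i\<in>I. exp (N * v i)) + N * c"
    using sum_exp_pos[of I "\<lambda>i. N * v i"] assms by (subst ln_mult_pos) auto
  finally show ?thesis using assms by (simp add: lse_def field_simps)
qed

lemma lse_mono:
  assumes "0 < N" "finite I" "I \<noteq> {}" "\<And>i. i \<in> I \<Longrightarrow> w i \<le> v i"
  shows "lse N I w \<le> lse N I v"
  using lse_le_shift[of N I w v 0] assms by simp

lemma lse_lipschitz:
  assumes "0 < N" "finite I" "I \<noteq> {}" "\<And>i. i \<in> I \<Longrightarrow> \<bar>w i - v i\<bar> \<le> c"
  shows "\<bar>lse N I w - lse N I v\<bar> \<le> c"
proof -
  have "lse N I w \<le> lse N I v + c" "lse N I v \<le> lse N I w + c"
    using assms by (intro lse_le_shift; force simp: abs_le_iff)+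
  thus ?thesis by (simp add: abs_le_iff)
qed

lemma lse_le_bound:
  assumes "0 < N" "finite I" "I \<noteq> {}" "\<And>i. i \<in> I \<Longrightarrow> w i \<le> c"
  shows "lse N I w \<le> c + ln (card I) / N"
proof -
  have "lse N I w \<le> lse N I (\<lambda>_. 0) + c"
    using assms by (intro lse_le_shift) auto
  thus ?thesis by (simp add: lse_def)
qed

text \<open>The gap is the entropy of the weights divided by \<open>N\<close>.\<close>

lemma lse_le_softmax_mean:
  assumes N: "0 < N" and I: "finite I" "I \<noteq> {}"
  shows "lse N I w \<le> (\<Sum>i\<in>I. softmax N I w i * w i) + ln (card I) / N"
proof -
  define Z where "Z = (\<Sum>i\<in>I. exp (N * w i))"
  define n where "n = real (card I)"
  have Z: "Z > 0" unfolding Z_def using I by (rule sum_exp_pos)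
  have n: "n > 0" using I by (auto simp: n_def card_gt_0_iff)
  let ?s = "softmax N I w"
  have s: "?s i > 0" for i using I by (rule softmax_pos)
  \<comment> \<open>Gibbs' inequality against the uniform weights \<open>1 / n\<close>, by
    \<open>ln x \<le> x - 1\<close>. Summed over \<open>I\<close>, the terms
    \<open>1 / n - ?s i\<close> cancel.\<close>
  have "?s i * (ln Z - N * w i) \<le> 1 / n - ?s i + ?s i * ln n" for i
  proof -
    have "ln Z - N * w i = - ln (?s i)"
      using Z by (simp add: softmax_def ln_div flip: Z_def)
    also have "\<dots> = ln (1 / (n * ?s i)) + ln n"
      using n s[of i] by (simp add: ln_div ln_mult_pos)
    also have "\<dots> \<le> 1 / (n * ?s i) - 1 + ln n"
      using n s[of i] by (simp add: ln_le_minus_one)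
    finally have "?s i * (ln Z - N * w i) \<le> ?s i * (1 / (n * ?s i) - 1 + ln n)"
      using s[of i] by (intro mult_left_mono) auto
    also have "\<dots> = 1 / n - ?s i + ?s i * ln n"
      using n s[of i] by (simp add: field_simps)
    finally show ?thesis .
  qed
  hence "(\<Sum>i\<in>I. ?s i * (ln Z - N * w i)) \<le> (\<Sum>i\<in>I. 1 / n - ?s i + ?s i * ln n)"
    by (intro sum_mono)
  also have "\<dots> = ln n"
    using n sum_softmax[OF I, of N w]
    by (simp add: sum.distrib sum_subtractf flip: sum_distrib_right n_def)
  finally have "ln Z - N * (\<Sum>i\<in>I. ?s i * w i) \<le> ln n"
    using sum_softmax[OF I, of N w]
    by (simp add: right_diff_distrib sum_subtractf flip: sum_distrib_right)
       (simp add: sum_distrib_left mult_ac)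
  hence "ln Z / N \<le> ((\<Sum>i\<in>I. ?s i * w i) * N + ln n) / N"
    using N by (intro divide_right_mono) (auto simp: mult_ac)
  also have "\<dots> = (\<Sum>i\<in>I. ?s i * w i) + ln n / N"
    using N by (simp add: add_divide_distrib)
  finally show ?thesis by (simp add: lse_def Z_def n_def)
qed

lemma DERIV_lse:
  assumes N: "N \<noteq> 0" and I: "finite I" "I \<noteq> {}"
    and w: "\<And>i. i \<in> I \<Longrightarrow> ((\<lambda>t. w t i) has_real_derivative w' i) (at t)"
  shows "((\<lambda>t. lse N I (w t)) has_real_derivative (\<Sum>i\<in>I. softmax N I (w t) i * w' i)) (at t)"
proof -
  have "((\<lambda>t. ln (\<Sum>i\<in>I. exp (N * w t i)) / N) has_real_derivative
     ((\<Sum>i\<in>I. exp (N * w t i) * (N * w' i)) / (\<Sum>i\<in>I. exp (N * w t i))) / N) (at t)"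
    using sum_exp_pos[OF I, of "\<lambda>i. N * w t i"] w
    by (auto intro!: derivative_eq_intros simp: N mult_ac)
  also have "((\<Sum>i\<in>I. exp (N * w t i) * (N * w' i)) / (\<Sum>i\<in>I. exp (N * w t i))) / N
     = (\<Sum>i\<in>I. softmax N I (w t) i * w' i)"
    using N by (simp add: softmax_def sum_divide_distrib)
  finally show ?thesis by (simp add: lse_def)
qed

text \<open>Freezing the coordinates off \<open>Y\<close> at \<open>a\<close> makes the box compact
  by Tychonoff. The Lipschitz bound sees only coordinates in \<open>Y\<close>: it gives continuity
  in the product topology and also shows that freezing the other coordinates does not change
  \<open>f\<close>.\<close>

lemma box_minimiser:
  fixes f :: "('a \<Rightarrow> real) \<Rightarrow> real"
  assumes Y: "finite Y" and ab: "a \<le> b"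
    and lip: "\<And>u v. \<forall>y\<in>Y. u y \<in> {a..b} \<Longrightarrow> \<forall>y\<in>Y. v y \<in> {a..b} \<Longrightarrow>
       \<bar>f u - f v\<bar> \<le> L * (\<Sum>y\<in>Y. \<bar>u y - v y\<bar>)"
  obtains u where "\<forall>y\<in>Y. u y \<in> {a..b}" "\<And>v. \<forall>y\<in>Y. v y \<in> {a..b} \<Longrightarrow> f u \<le> f v"
proof -
  define S where "S = (PiE UNIV (\<lambda>y. if y \<in> Y then {a..b} else {a}) :: ('a \<Rightarrow> real) set)"
  have S: "v \<in> S \<Longrightarrow> \<forall>y\<in>Y. v y \<in> {a..b}" for v
  proof
    fix y assume "v \<in> S" "y \<in> Y"
    hence "v y \<in> (if y \<in> Y then {a..b} else {a})" unfolding S_def by (intro PiE_mem[of v UNIV]) auto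
    thus "v y \<in> {a..b}" using \<open>y \<in> Y\<close> by simp
  qed
  have "compactin (product_topology (\<lambda>_. euclidean) UNIV) S"
    unfolding S_def by (subst compactin_PiE) auto
  hence cpt: "compact S"
    by (simp add: euclidean_product_topology)
  have "continuous_on S f"
    unfolding continuous_on_def
  proof
    fix u assume u: "u \<in> S"
    have "((\<lambda>v. L * (\<Sum>y\<in>Y. \<bar>v y - u y\<bar>)) \<longlongrightarrow> L * (\<Sum>y\<in>Y. \<bar>u y - u y\<bar>)) (at u within S)"
    proof (intro tendsto_intros)
      fix y
      have "continuous_on UNIV (\<lambda>v::'a\<Rightarrow>real. v y)"
        by (rule continuous_on_product_coordinates)
      hence "continuous_on S (\<lambda>v. v y)"
        by (rule continuous_on_subset) simp
      thus "((\<lambda>v. v y) \<longlongrightarrow> u y) (at u within S)"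
        using u by (simp add: continuous_on_def)
    qed
    hence "((\<lambda>v. L * (\<Sum>y\<in>Y. \<bar>v y - u y\<bar>)) \<longlongrightarrow> 0) (at u within S)" by simp
    moreover have "eventually (\<lambda>v. norm (f v - f u) \<le> L * (\<Sum>y\<in>Y. \<bar>v y - u y\<bar>)) (at u within S)"
      unfolding eventually_at_filter using lip[OF S S] u by (intro always_eventually) auto
    ultimately have "((\<lambda>v. f v - f u) \<longlongrightarrow> 0) (at u within S)"
      by (rule Lim_null_comparison[rotated])
    thus "(f \<longlongrightarrow> f u) (at u within S)" by (simp add: LIM_zero_iff)
  qed
  moreover have "(\<lambda>_. a) \<in> S" using ab by (auto simp: S_def)
  ultimately obtain u where u: "u \<in> S" "\<And>v. v \<in> S \<Longrightarrow> f u \<le> f v"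
    using continuous_attains_inf[OF cpt, of f] by blast
  show thesis
  proof
    show "\<forall>y\<in>Y. u y \<in> {a..b}" using S u by auto
    fix v :: "'a \<Rightarrow> real" assume v: "\<forall>y\<in>Y. v y \<in> {a..b}"
    define v' where "v' y = (if y \<in> Y then v y else a)" for y
    have v': "v' \<in> S" using v by (auto simp: S_def v'_def)
    have "\<bar>f v' - f v\<bar> \<le> L * (\<Sum>y\<in>Y. \<bar>v' y - v y\<bar>)"
      by (rule lip) (use v in \<open>auto simp: v'_def\<close>)
    also have "\<dots> = 0" by (simp add: v'_def)
    finally show "f u \<le> f v" using u(2)[OF v'] by simp
  qed
qed

text \<open>The constraints of a box separate, so varying one coordinate at a time already gives the
  signs of the multipliers. This serves twice, for the potentials \<open>q\<close> and for the
  weights \<open>v\<close>.\<close>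

lemma box_minimiser_KKT:
  fixes f :: "('a \<Rightarrow> real) \<Rightarrow> real"
  assumes u: "\<forall>y\<in>Y. u y \<in> {a..b}" and min: "\<And>v. \<forall>y\<in>Y. v y \<in> {a..b} \<Longrightarrow> f u \<le> f v"
    and D: "((\<lambda>t. f (u(j := t))) has_real_derivative D) (at (u j))" and j: "j \<in> Y"
  shows "u j < b \<Longrightarrow> 0 \<le> D" and "a < u j \<Longrightarrow> D \<le> 0"
proof -
  show "0 \<le> D" if lt: "u j < b"
  proof (rule ccontr)
    assume "\<not> 0 \<le> D"
    then obtain d where d: "d > 0" "\<And>h. h > 0 \<Longrightarrow> h < d \<Longrightarrow> f (u(j := u j)) > f (u(j := u j + h))"
      using DERIV_neg_dec_right[OF D] by force
    define h where "h = min (d / 2) (b - u j)"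
    have h: "h > 0" "h < d" "u j + h \<le> b" using d(1) lt by (auto simp: h_def)
    have "f u \<le> f (u(j := u j + h))"
      by (rule min) (use u h j in force)
    with d(2)[OF h(1,2)] show False by simp
  qed
  show "D \<le> 0" if lt: "a < u j"
  proof (rule ccontr)
    assume "\<not> D \<le> 0"
    then obtain d where d: "d > 0" "\<And>h. h > 0 \<Longrightarrow> h < d \<Longrightarrow> f (u(j := u j - h)) < f (u(j := u j))"
      using DERIV_pos_inc_left[OF D] by force
    define h where "h = min (d / 2) (u j - a)"
    have h: "h > 0" "h < d" "a \<le> u j - h" using d(1) lt by (auto simp: h_def)
    have "f u \<le> f (u(j := u j - h))"
      by (rule min) (use u h j in force)
    with d(2)[OF h(1,2)] show False by simp
  qed
qed

text \<open>Dominated convergence: the Lipschitz bound at \<open>s\<close> dominates all difference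
  quotients by \<open>\<bar>L\<bar>\<close>.\<close>

lemma (in finite_measure) DERIV_integral:
  fixes f :: "real \<Rightarrow> 'a \<Rightarrow> real"
  assumes d: "0 < d"
    and int: "\<And>t. \<bar>t - s\<bar> < d \<Longrightarrow> integrable M (f t)"
    and lip: "\<And>t x. \<bar>t - s\<bar> < d \<Longrightarrow> x \<in> space M \<Longrightarrow> \<bar>f t x - f s x\<bar> \<le> L * \<bar>t - s\<bar>"
    and der: "\<And>x. x \<in> space M \<Longrightarrow> ((\<lambda>t. f t x) has_real_derivative f' x) (at s)"
  shows "((\<lambda>t. LINT x|M. f t x) has_real_derivative (LINT x|M. f' x)) (at s)"
  unfolding has_field_derivative_iff tendsto_at_iff_sequentially comp_def
proof (intro allI impI)
  fix X :: "nat \<Rightarrow> real" assume X: "\<forall>i. X i \<in> UNIV - {s}" "X \<longlonglongrightarrow> s"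
  \<comment> \<open>A sequence tending to \<open>s\<close> may start outside the
    \<open>d\<close>-neighbourhood of \<open>s\<close>; those finitely many terms are moved to a
    point inside it that differs from \<open>s\<close>.\<close>
  define Z where "Z i = (if \<bar>X i - s\<bar> < d then X i else s + d / 2)" for i
  have ev: "\<forall>\<^sub>F i in sequentially. Z i = X i"
    using tendstoD[OF X(2) d] by eventually_elim (simp add: Z_def dist_real_def)
  hence Zs: "Z \<longlonglongrightarrow> s" using X(2) tendsto_cong by blast
  have Zd: "\<bar>Z i - s\<bar> < d" "Z i \<noteq> s" for i using X(1) d by (auto simp: Z_def)
  have fs: "integrable M (f s)" using int d by simp
  have meas: "(\<lambda>x. (f (Z i) x - f s x) / (Z i - s)) \<in> borel_measurable M" for i
    using int[OF Zd(1)[of i]] fs by measurable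
  have lim: "(\<lambda>i. (f (Z i) x - f s x) / (Z i - s)) \<longlonglongrightarrow> f' x" if "x \<in> space M" for x
    using der[OF that] Zs Zd unfolding has_field_derivative_iff tendsto_at_iff_sequentially comp_def
    by auto
  have meas': "f' \<in> borel_measurable M"
    by (rule borel_measurable_LIMSEQ_real[OF lim meas])
  have "(\<lambda>i. LINT x|M. (f (Z i) x - f s x) / (Z i - s)) \<longlonglongrightarrow> (LINT x|M. f' x)"
  proof (rule integral_dominated_convergence[where w = "\<lambda>_. \<bar>L\<bar>"])
    show "AE x in M. norm ((f (Z i) x - f s x) / (Z i - s)) \<le> \<bar>L\<bar>" for i
    proof (rule AE_I2)
      fix x assume x: "x \<in> space M"
      have "\<bar>f (Z i) x - f s x\<bar> \<le> L * \<bar>Z i - s\<bar>" using lip Zd x by blast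
      also have "\<dots> \<le> \<bar>L\<bar> * \<bar>Z i - s\<bar>" by (intro mult_right_mono) auto
      finally show "norm ((f (Z i) x - f s x) / (Z i - s)) \<le> \<bar>L\<bar>"
        using Zd(2)[of i] by (simp add: divide_simps)
    qed
  qed (use meas meas' lim in auto)
  moreover have "\<forall>\<^sub>F i in sequentially. (LINT x|M. (f (Z i) x - f s x) / (Z i - s)) =
      ((LINT x|M. f (X i) x) - (LINT x|M. f s x)) / (X i - s)"
    using ev
  proof eventually_elim
    case (elim i)
    have "(LINT x|M. (f (Z i) x - f s x) / (Z i - s)) = (LINT x|M. f (Z i) x - f s x) / (Z i - s)"
      by simp
    also have "(LINT x|M. f (Z i) x - f s x) = (LINT x|M. f (Z i) x) - (LINT x|M. f s x)"
      by (rule Bochner_Integration.integral_diff[OF int[OF Zd(1)] fs])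
    finally show ?case using elim by simp
  qed
  ultimately show "(\<lambda>i. ((LINT x|M. f (X i) x) - (LINT x|M. f s x)) / (X i - s)) \<longlonglongrightarrow> (LINT x|M. f' x)"
    by (rule Lim_transform_eventually)
qed

text \<open>\<open>ennreal\<close> cuts off negative values, so only one inequality remains. It is
  the passage from signed dual integrals to the nonnegative extended value
  \<open>HK2\<close>.\<close>

lemma ennreal_integral_le_nn_integral:
  assumes "integrable M f"
  shows "ennreal (integral\<^sup>L M f) \<le> (\<integral>\<^sup>+ x. ennreal (f x) \<partial>M)"
proof -
  have "integral\<^sup>L M f \<le> (LINT x|M. max 0 (f x))"
    using assms by (intro integral_mono) auto
  hence "ennreal (integral\<^sup>L M f) \<le> ennreal (LINT x|M. max 0 (f x))"
    by (rule ennreal_leI)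
  also have "\<dots> = (\<integral>\<^sup>+ x. ennreal (max 0 (f x)) \<partial>M)"
    using assms by (intro nn_integral_eq_integral[symmetric]) auto
  also have "\<dots> = (\<integral>\<^sup>+ x. ennreal (f x) \<partial>M)"
    by (intro nn_integral_cong) (auto simp: max_def ennreal_neg)
  finally show ?thesis .
qed

section \<open>Lower bounds for the Hellinger--Kantorovich distance\<close>

lemma ennreal_plus_le: "ennreal (a + b) \<le> ennreal a + ennreal b"
proof (cases "0 \<le> a \<and> 0 \<le> b")
  case False
  hence "ennreal (a + b) \<le> ennreal a \<or> ennreal (a + b) \<le> ennreal b"
    by (auto intro!: ennreal_leI)
  thus ?thesis by (auto intro: add_increasing add_increasing2)
qed simp

text \<open>The Fenchel-Young inequality: \<open>exp u - 1\<close> is the convex conjugate of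
  \<open>kl_entropy\<close>.\<close>

lemma kl_entropy_ge:
  assumes "0 \<le> s"
  shows "s * u - exp u + 1 \<le> kl_entropy s"
proof (cases "s = 0")
  case False
  hence s: "s > 0" using assms by simp
  have "s * (1 + (u - ln s)) \<le> s * exp (u - ln s)"
    using s by (intro mult_left_mono exp_ge_add_one_self) auto
  also have "s * exp (u - ln s) = exp u" using s by (simp add: exp_diff)
  finally show ?thesis using s by (simp add: kl_entropy_def algebra_simps)
qed (simp add: kl_entropy_def)

lemma kl_entropy_nonneg: "0 \<le> s \<Longrightarrow> 0 \<le> kl_entropy s"
  using kl_entropy_ge[of s 0] by simp

lemma borel_measurable_kl_entropy [measurable]: "kl_entropy \<in> borel_measurable borel"
  unfolding kl_entropy_def by measurable

lemma KL_density:
  fixes f :: "'a \<Rightarrow> real"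
  assumes "finite_measure \<nu>" and f [measurable]: "f \<in> borel_measurable \<nu>"
    and nn: "\<And>x. x \<in> space \<nu> \<Longrightarrow> 0 \<le> f x"
  shows "KL (density \<nu> (\<lambda>x. ennreal (f x))) \<nu> = (\<integral>\<^sup>+ x. ennreal (kl_entropy (f x)) \<partial>\<nu>)"
proof -
  interpret finite_measure \<nu> by fact
  let ?N = "density \<nu> (\<lambda>x. ennreal (f x))"
  have "absolutely_continuous \<nu> ?N"
    by (intro absolutely_continuousI_density) measurable
  moreover have "AE x in \<nu>. ennreal (f x) = RN_deriv \<nu> ?N x"
    by (rule RN_deriv_unique) auto
  hence "AE x in \<nu>. ennreal (kl_entropy (enn2real (RN_deriv \<nu> ?N x))) = ennreal (kl_entropy (f x))"
    using AE_space
  proof eventually_elim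
    case (elim x)
    show ?case unfolding elim(1)[symmetric] using nn elim(2) by simp
  qed
  ultimately show ?thesis
    unfolding KL_def by (auto intro: nn_integral_cong_AE)
qed

text \<open>Young's inequality, applied pointwise to the density of \<open>N\<close> and integrated
  against \<open>\<mu>\<close>. Without absolute continuity the right-hand side is infinite.\<close>

lemma KL_ge:
  fixes u :: "'a \<Rightarrow> real"
  assumes "finite_measure \<mu>" "finite_measure N" and sets: "sets N = sets \<mu>"
    and u [measurable]: "u \<in> borel_measurable \<mu>" and bd: "\<And>x. x \<in> space \<mu> \<Longrightarrow> \<bar>u x\<bar> \<le> c"
  shows "ennreal ((LINT x|N. u x) + (LINT x|\<mu>. 1 - exp (u x))) \<le> KL N \<mu>"
proof (cases "absolutely_continuous \<mu> N")
  case True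
  interpret finite_measure \<mu> by fact
  interpret N: finite_measure N by fact
  define f where "f x = enn2real (RN_deriv \<mu> N x)" for x
  have [measurable]: "f \<in> borel_measurable \<mu>" unfolding f_def by measurable
  have nn: "0 \<le> f x" for x by (simp add: f_def)
  \<comment> \<open>Finiteness of \<open>N\<close> makes its density finite almost everywhere, so
    that \<open>enn2real\<close> loses nothing.\<close>
  have "AE x in \<mu>. RN_deriv \<mu> N x \<noteq> \<infinity>"
    using True sets N.sigma_finite_measure_axioms by (intro RN_deriv_finite) auto
  hence "AE x in \<mu>. RN_deriv \<mu> N x = ennreal (f x)"
    by eventually_elim (simp add: f_def less_top)
  hence "density \<mu> (RN_deriv \<mu> N) = density \<mu> (\<lambda>x. ennreal (f x))"
    by (intro density_cong) measurable
  hence N: "N = density \<mu> (\<lambda>x. ennreal (f x))"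
    using density_RN_deriv[OF True sets] by simp
  have un: "u \<in> borel_measurable N" using sets u by (simp cong: measurable_cong_sets)
  have iN: "integrable N u"
    using bd un sets_eq_imp_space_eq[OF sets] by (intro N.integrable_const_bound[where B = c]) auto
  hence ifu: "integrable \<mu> (\<lambda>x. f x * u x)"
    unfolding N by (subst (asm) integrable_density) (auto simp: nn)
  have ie: "integrable \<mu> (\<lambda>x. 1 - exp (u x))"
  proof (intro integrable_const_bound[where B = "1 + exp c"] AE_I2)
    fix x assume "x \<in> space \<mu>"
    hence "exp (u x) \<le> exp c" using bd[of x] by simp
    thus "norm (1 - exp (u x)) \<le> 1 + exp c"
      using exp_gt_zero[of "u x"] unfolding real_norm_def by linarith
  qed measurable
  have "(LINT x|N. u x) + (LINT x|\<mu>. 1 - exp (u x)) = (LINT x|\<mu>. f x * u x + (1 - exp (u x)))"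
    unfolding N using ifu ie by (subst integral_density) (auto simp: nn)
  also have "ennreal \<dots> \<le> (\<integral>\<^sup>+ x. ennreal (f x * u x + (1 - exp (u x))) \<partial>\<mu>)"
    using ifu ie by (intro ennreal_integral_le_nn_integral) auto
  also have "\<dots> \<le> (\<integral>\<^sup>+ x. ennreal (kl_entropy (f x)) \<partial>\<mu>)"
    using kl_entropy_ge[OF nn] by (intro nn_integral_mono ennreal_leI) (simp add: add_diff_eq diff_add_eq)
  also have "\<dots> = KL N \<mu>"
    using True by (simp add: KL_def f_def)
  finally show ?thesis .
qed (simp add: KL_def)

section \<open>The truncated cosine and the transport cost\<close>

lemma Cos_bounds: "0 \<le> Cos s" "Cos s \<le> 1"
proof -
  have "- (pi / 2) \<le> min \<bar>s\<bar> (pi / 2)" using pi_ge_zero abs_ge_zero[of s] by linarith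
  thus "0 \<le> Cos s" unfolding Cos_def by (intro cos_ge_zero) auto
qed (simp add: Cos_def)

lemma Cos_sq_le_1: "(Cos s)\<^sup>2 \<le> 1"
  using Cos_bounds[of s] by (simp add: power_le_one)

lemma Cos_eq_cos: "\<bar>s\<bar> \<le> pi / 2 \<Longrightarrow> Cos s = cos s"
  by (auto simp: Cos_def min_def abs_if)

lemma Cos_eq_0: "pi / 2 \<le> \<bar>s\<bar> \<Longrightarrow> Cos s = 0"
  by (simp add: Cos_def min_absorb2)

lemma Cos_pos: "\<bar>s\<bar> < pi / 2 \<Longrightarrow> 0 < Cos s"
  by (subst Cos_eq_cos) (auto intro!: cos_gt_zero_pi simp: abs_less_iff)

lemma continuous_on_Cos [continuous_intros]:
  "continuous_on A f \<Longrightarrow> continuous_on A (\<lambda>x. Cos (f x))"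
proof -
  have "continuous_on UNIV Cos"
    unfolding Cos_def by (intro continuous_intros)
  thus "continuous_on A f \<Longrightarrow> continuous_on A (\<lambda>x. Cos (f x))"
    by (rule continuous_on_compose2) auto
qed

text \<open>In this form \<open>exp (- cost)\<close> is \<open>Cos\<^sup>2\<close>, the right-hand
  side of the constraint in \<open>Q_set\<close>; infinite cost corresponds to a vanishing
  cosine.\<close>

lemma hk_cost_eq:
  assumes "0 < \<kappa>"
  shows "hk_cost \<kappa> x y =
    (if 0 < Cos (norm (x - y) / \<kappa>) then ennreal (- ln ((Cos (norm (x - y) / \<kappa>))\<^sup>2)) else \<infinity>)"
proof (cases "norm (x - y) < \<kappa> * pi / 2")
  case True
  hence "\<bar>norm (x - y) / \<kappa>\<bar> < pi / 2" using assms by (simp add: field_simps)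
  hence "0 < Cos (norm (x - y) / \<kappa>)" "Cos (norm (x - y) / \<kappa>) = cos (norm (x - y) / \<kappa>)"
    by (rule Cos_pos, intro Cos_eq_cos) simp
  thus ?thesis using True
    by (simp add: hk_cost_def ln_realpow)
next
  case False
  hence "pi / 2 \<le> \<bar>norm (x - y) / \<kappa>\<bar>" using assms by (simp add: field_simps)
  hence "Cos (norm (x - y) / \<kappa>) = 0" by (rule Cos_eq_0)
  thus ?thesis using False by (simp add: hk_cost_def)
qed

text \<open>The identity map is measurable in both directions, which rests on second countability.
  Densities with respect to \<open>\<mu> \<Otimes>\<^sub>M \<nu>\<close> can thereby serve as Radon
  measures on the product.\<close>

lemma sets_pair_restrict_borel:
  fixes A :: "'a::second_countable_topology set" and B :: "'b::second_countable_topology set"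
  shows "sets (restrict_space borel A \<Otimes>\<^sub>M restrict_space borel B) = sets (restrict_space borel (A \<times> B))"
proof -
  let ?P = "restrict_space borel A \<Otimes>\<^sub>M restrict_space borel B" and ?R = "restrict_space borel (A \<times> B)"
  have sp: "space ?P = A \<times> B" "space ?R = A \<times> B"
    by (auto simp: space_pair_measure space_restrict_space)
  have [measurable]: "fst \<in> borel_measurable (borel :: ('a \<times> 'b) measure)" "snd \<in> borel_measurable (borel :: ('a \<times> 'b) measure)"
    by (auto intro!: borel_measurable_continuous_onI continuous_intros)
  have "(\<lambda>z. (fst z, snd z)) \<in> ?R \<rightarrow>\<^sub>M ?P"
    by (intro measurable_Pair measurable_restrict_space2 measurable_restrict_space1) 
       (auto simp: sp)
  hence 1: "(\<lambda>z. z) \<in> ?R \<rightarrow>\<^sub>M ?P" by simp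
  have i: "(\<lambda>x. x) \<in> borel_measurable (restrict_space borel C)" for C :: "'c::second_countable_topology set"
    by (intro measurable_restrict_space1) auto
  have "(\<lambda>z. (fst z, snd z)) \<in> ?P \<rightarrow>\<^sub>M (borel \<Otimes>\<^sub>M borel)"
    by (intro measurable_Pair measurable_compose[OF measurable_fst i] measurable_compose[OF measurable_snd i])
  hence 2: "(\<lambda>z. z) \<in> ?P \<rightarrow>\<^sub>M ?R"
    by (intro measurable_restrict_space2) (auto simp: sp borel_prod)
  have "A \<in> sets ?R" if "A \<in> sets ?P" for A
    using measurable_sets[OF 1 that] sets.sets_into_space[OF that] sp by (simp add: Int_absorb2)
  moreover have "A \<in> sets ?P" if "A \<in> sets ?R" for A
    using measurable_sets[OF 2 that] sets.sets_into_space[OF that] sp by (simp add: Int_absorb2)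
  ultimately show ?thesis by blast
qed

section \<open>Radon measures and weak duality\<close>

lemma radon_measuresD:
  assumes "\<mu> \<in> radon_measures X"
  shows "sets \<mu> = sets (restrict_space borel X)" "finite_measure \<mu>" "space \<mu> = X"
  using assms sets_eq_imp_space_eq[of \<mu> "restrict_space borel X"]
  by (auto simp: radon_measures_def space_restrict_space)

lemma radon_measurable_continuous:
  fixes f :: "'a::euclidean_space \<Rightarrow> 'b::topological_space"
  assumes "\<mu> \<in> radon_measures X" "continuous_on X f"
  shows "f \<in> borel_measurable \<mu>"
  using radon_measuresD(1)[OF assms(1)] borel_measurable_continuous_on_restrict[OF assms(2)]
  by (simp cong: measurable_cong_sets)

lemma radon_integrable_continuous:
  fixes f :: "'a::euclidean_space \<Rightarrow> real"
  assumes \<mu>: "\<mu> \<in> radon_measures X" and f: "continuous_on X f" and X: "compact X"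
  shows "integrable \<mu> f"
proof -
  interpret finite_measure \<mu> using \<mu> by (rule radon_measuresD)
  obtain c where "\<And>x. x \<in> X \<Longrightarrow> norm (f x) \<le> c"
    using compact_imp_bounded[OF compact_continuous_image[OF f X]] by (auto simp: bounded_iff)
  thus ?thesis
    using radon_measurable_continuous[OF \<mu> f] radon_measuresD(3)[OF \<mu>]
    by (intro integrable_const_bound[where B = c]) auto
qed

lemma measurable_projections_radon:
  assumes "\<gamma> \<in> radon_measures (X \<times> Y)"
  shows "fst \<in> \<gamma> \<rightarrow>\<^sub>M restrict_space borel X" "snd \<in> \<gamma> \<rightarrow>\<^sub>M restrict_space borel Y"
  using measurable_fst[of "restrict_space borel X" "restrict_space borel Y"]
    measurable_snd[of "restrict_space borel X" "restrict_space borel Y"]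
    radon_measuresD(1)[OF assms] sets_pair_restrict_borel[of X Y]
  by (auto cong: measurable_cong_sets)

text \<open>With \<open>u = ln (1 - \<psi>)\<close> and \<open>v = ln (1 - \<phi>)\<close> the
  product constraint becomes \<open>- u x - v y \<le> hk_cost \<kappa> x y\<close>, and
  \<open>1 - exp u = \<psi>\<close> is what \<open>KL_ge\<close> contributes. The strict bounds make
  \<open>u\<close> and \<open>v\<close> finite and continuous, hence bounded on the compact
  set.\<close>

lemma HK2_ge_aux:
  fixes \<Omega> :: "'a::euclidean_space set"
  assumes \<Omega>: "compact \<Omega>" and \<kappa>: "0 < \<kappa>"
    and \<mu>: "\<mu> \<in> radon_measures \<Omega>" and \<nu>: "\<nu> \<in> radon_measures \<Omega>"
    and Q: "(\<psi>, \<phi>) \<in> Q_set \<kappa> \<Omega>" and lt: "\<And>x. x \<in> \<Omega> \<Longrightarrow> \<psi> x < 1" "\<And>x. x \<in> \<Omega> \<Longrightarrow> \<phi> x < 1"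
  shows "ennreal ((LINT x|\<mu>. \<psi> x) + (LINT y|\<nu>. \<phi> y)) \<le> HK2 \<kappa> \<Omega> \<mu> \<nu>"
  unfolding HK2_def
proof (rule INF_greatest)
  fix \<gamma> assume \<gamma>: "\<gamma> \<in> radon_measures (\<Omega> \<times> \<Omega>)"
  let ?B = "restrict_space borel \<Omega>"
  note [measurable] = measurable_projections_radon[OF \<gamma>]
  have c\<psi>: "continuous_on \<Omega> \<psi>" and c\<phi>: "continuous_on \<Omega> \<phi>"
    and pq: "\<And>x y. x \<in> \<Omega> \<Longrightarrow> y \<in> \<Omega> \<Longrightarrow> (Cos (norm (x - y) / \<kappa>))\<^sup>2 \<le> (1 - \<psi> x) * (1 - \<phi> y)"
    using Q by (auto simp: Q_set_def)
  define u where "u x = ln (1 - \<psi> x)" for x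
  define v where "v x = ln (1 - \<phi> x)" for x
  have cu: "continuous_on \<Omega> u" and cv: "continuous_on \<Omega> v"
    unfolding u_def v_def using lt by (force intro!: continuous_intros c\<psi> c\<phi>)+
  let ?g1 = "distr \<gamma> ?B fst" and ?g2 = "distr \<gamma> ?B snd"
  have KLge: "ennreal ((LINT x|N. w x) + (LINT x|\<rho>. 1 - exp (w x))) \<le> KL N \<rho>"
    if w: "continuous_on \<Omega> w" and \<rho>: "\<rho> \<in> radon_measures \<Omega>" and N: "finite_measure N" "sets N = sets ?B"
    for w N \<rho>
  proof -
    obtain c where c: "\<And>x. x \<in> \<Omega> \<Longrightarrow> norm (w x) \<le> c"
      using compact_imp_bounded[OF compact_continuous_image[OF w \<Omega>]] by (auto simp: bounded_iff)
    show ?thesis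
      using c radon_measuresD[OF \<rho>] N
      by (intro KL_ge[where c = c] radon_measurable_continuous[OF \<rho> w]) auto
  qed
  have K1: "ennreal ((LINT x|?g1. u x) + (LINT x|\<mu>. 1 - exp (u x))) \<le> KL ?g1 \<mu>"
    using radon_measuresD[OF \<gamma>] by (intro KLge cu \<mu> finite_measure.finite_measure_distr) auto
  have K2: "ennreal ((LINT x|?g2. v x) + (LINT x|\<nu>. 1 - exp (v x))) \<le> KL ?g2 \<nu>"
    using radon_measuresD[OF \<gamma>] by (intro KLge cv \<nu> finite_measure.finite_measure_distr) auto
  have mu: "u \<in> borel_measurable ?B" and mv: "v \<in> borel_measurable ?B"
    using cu cv by (auto intro: borel_measurable_continuous_on_restrict)
  have e1: "(LINT x|?g1. u x) = (LINT z|\<gamma>. u (fst z))" "(LINT x|?g2. v x) = (LINT z|\<gamma>. v (snd z))"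
    using mu mv by (auto intro!: integral_distr)
  have e2: "(LINT x|\<mu>. 1 - exp (u x)) = (LINT x|\<mu>. \<psi> x)" 
    using lt(1) by (intro Bochner_Integration.integral_cong) (auto simp: u_def radon_measuresD[OF \<mu>])
  have e3: "(LINT x|\<nu>. 1 - exp (v x)) = (LINT x|\<nu>. \<phi> x)" 
    using lt(2) by (intro Bochner_Integration.integral_cong) (auto simp: v_def radon_measuresD[OF \<nu>])
  have iu: "integrable \<gamma> (\<lambda>z. u (fst z))" and iv: "integrable \<gamma> (\<lambda>z. v (snd z))"
    using \<Omega> by (auto intro!: radon_integrable_continuous[OF \<gamma>] compact_Times
      continuous_on_compose2[OF cu] continuous_on_compose2[OF cv] continuous_intros)
  have "ennreal (LINT z|\<gamma>. - (u (fst z)) - v (snd z)) \<le> (\<integral>\<^sup>+ z. ennreal (- (u (fst z)) - v (snd z)) \<partial>\<gamma>)"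
    using iu iv by (intro ennreal_integral_le_nn_integral) auto
  also have "\<dots> \<le> (\<integral>\<^sup>+ (x, y). hk_cost \<kappa> x y \<partial>\<gamma>)"
  proof (rule nn_integral_mono)
    fix z assume "z \<in> space \<gamma>"
    then obtain x y where z: "z = (x, y)" "x \<in> \<Omega>" "y \<in> \<Omega>" using radon_measuresD(3)[OF \<gamma>] by auto
    show "ennreal (- u (fst z) - v (snd z)) \<le> (case z of (x, y) \<Rightarrow> hk_cost \<kappa> x y)"
    proof (cases "0 < Cos (norm (x - y) / \<kappa>)")
      case True
      hence "ln ((Cos (norm (x - y) / \<kappa>))\<^sup>2) \<le> ln ((1 - \<psi> x) * (1 - \<phi> y))"
        using pq[OF z(2,3)] by (intro ln_mono) auto
      also have "\<dots> = u x + v y"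
        using lt z unfolding u_def v_def by (intro ln_mult_pos) auto
      finally show ?thesis using True \<kappa> by (simp add: z hk_cost_eq ennreal_leI)
    qed (use z \<kappa> in \<open>simp add: hk_cost_eq\<close>)
  qed
  finally have cost: "ennreal (- (LINT z|\<gamma>. u (fst z)) - (LINT z|\<gamma>. v (snd z))) \<le> (\<integral>\<^sup>+ (x, y). hk_cost \<kappa> x y \<partial>\<gamma>)"
    using iu iv by simp
  \<comment> \<open>The integrals of \<open>u\<close> and \<open>v\<close> against the plan enter
    the bounds for the cost and for the marginal entropies with opposite signs, so the final bound
    does not depend on the plan.\<close>
  have "ennreal ((LINT x|\<mu>. \<psi> x) + (LINT y|\<nu>. \<phi> y)) = 
    ennreal ((- (LINT z|\<gamma>. u (fst z)) - (LINT z|\<gamma>. v (snd z)))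
      + ((LINT x|?g1. u x) + (LINT x|\<mu>. 1 - exp (u x)))
      + ((LINT x|?g2. v x) + (LINT x|\<nu>. 1 - exp (v x))))"
    by (rule arg_cong[where f = ennreal]) (simp add: e1 e2 e3)
  also have "\<dots> \<le> ennreal (- (LINT z|\<gamma>. u (fst z)) - (LINT z|\<gamma>. v (snd z)))
      + ennreal ((LINT x|?g1. u x) + (LINT x|\<mu>. 1 - exp (u x)))
      + ennreal ((LINT x|?g2. v x) + (LINT x|\<nu>. 1 - exp (v x)))"
    by (meson add_mono ennreal_plus_le order_refl order_trans)
  also have "\<dots> \<le> (\<integral>\<^sup>+ (x, y). hk_cost \<kappa> x y \<partial>\<gamma>) + KL ?g1 \<mu> + KL ?g2 \<nu>"
    by (intro add_mono cost K1 K2)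
  finally show "ennreal ((LINT x|\<mu>. \<psi> x) + (LINT y|\<nu>. \<phi> y)) \<le> \<dots>" .
qed

text \<open>Lowering both potentials by \<open>d\<close> makes them strictly less than 1 and only
  enlarges the product of \<open>1 - \<psi>\<close> and \<open>1 - \<phi>\<close>; the integrals
  drop by \<open>d\<close> times the total mass.\<close>

lemma HK2_ge:
  fixes \<Omega> :: "'a::euclidean_space set"
  assumes \<Omega>: "compact \<Omega>" and \<kappa>: "0 < \<kappa>"
    and \<mu>: "\<mu> \<in> radon_measures \<Omega>" and \<nu>: "\<nu> \<in> radon_measures \<Omega>"
    and Q: "(\<psi>, \<phi>) \<in> Q_set \<kappa> \<Omega>"
  shows "ennreal ((LINT x|\<mu>. \<psi> x) + (LINT y|\<nu>. \<phi> y)) \<le> HK2 \<kappa> \<Omega> \<mu> \<nu>"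
proof (rule ennreal_le_epsilon)
  fix e :: real assume e: "e > 0"
  interpret mu: finite_measure \<mu> using \<mu> by (rule radon_measuresD)
  interpret nu: finite_measure \<nu> using \<nu> by (rule radon_measuresD)
  \<comment> \<open>The summand 1 avoids a division by zero when both measures vanish.\<close>
  define m where "m = measure \<mu> \<Omega> + measure \<nu> \<Omega> + 1"
  have m: "m > 0" by (simp add: m_def add_nonneg_pos)
  define d where "d = e / m"
  have d: "d > 0" using e m by (simp add: d_def)
  have c: "continuous_on \<Omega> \<psi>" "continuous_on \<Omega> \<phi>"
    and pq: "\<And>x y. x \<in> \<Omega> \<Longrightarrow> y \<in> \<Omega> \<Longrightarrow> (Cos (norm (x - y) / \<kappa>))\<^sup>2 \<le> (1 - \<psi> x) * (1 - \<phi> y)"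
    and le: "\<And>x. x \<in> \<Omega> \<Longrightarrow> \<psi> x \<le> 1" "\<And>x. x \<in> \<Omega> \<Longrightarrow> \<phi> x \<le> 1"
    using Q by (auto simp: Q_set_def)
  have "(Cos (norm (x - y) / \<kappa>))\<^sup>2 \<le> (1 - (\<psi> x - d)) * (1 - (\<phi> y - d))" if "x \<in> \<Omega>" "y \<in> \<Omega>" for x y
    using pq[OF that] mult_mono[of "1 - \<psi> x" "1 - (\<psi> x - d)" "1 - \<phi> y" "1 - (\<phi> y - d)"] le[of x] le[of y] that d
    by (smt (verit))
  moreover have lt: "\<psi> x - d < 1" "\<phi> x - d < 1" if "x \<in> \<Omega>" for x using le[OF that] d by auto
  ultimately have "((\<lambda>x. \<psi> x - d), (\<lambda>x. \<phi> x - d)) \<in> Q_set \<kappa> \<Omega>"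
    by (auto simp: Q_set_def less_imp_le intro!: continuous_intros c)
  hence *: "ennreal ((LINT x|\<mu>. \<psi> x - d) + (LINT y|\<nu>. \<phi> y - d)) \<le> HK2 \<kappa> \<Omega> \<mu> \<nu>"
    using lt by (intro HK2_ge_aux[OF \<Omega> \<kappa> \<mu> \<nu>]) auto
  have "(LINT x|\<mu>. \<psi> x - d) = (LINT x|\<mu>. \<psi> x) - d * measure \<mu> \<Omega>"
    using radon_integrable_continuous[OF \<mu> c(1) \<Omega>] radon_measuresD(3)[OF \<mu>] by simp
  moreover have "(LINT x|\<nu>. \<phi> x - d) = (LINT x|\<nu>. \<phi> x) - d * measure \<nu> \<Omega>"
    using radon_integrable_continuous[OF \<nu> c(2) \<Omega>] radon_measuresD(3)[OF \<nu>] by simp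
  moreover have "d * measure \<mu> \<Omega> + d * measure \<nu> \<Omega> \<le> e"
  proof -
    have "d * measure \<mu> \<Omega> + d * measure \<nu> \<Omega> \<le> d * m"
      using d by (simp add: m_def algebra_simps)
    thus ?thesis using m by (simp add: d_def)
  qed
  ultimately have "(LINT x|\<mu>. \<psi> x) + (LINT y|\<nu>. \<phi> y) \<le> ((LINT x|\<mu>. \<psi> x - d) + (LINT y|\<nu>. \<phi> y - d)) + e"
    by linarith
  hence "ennreal ((LINT x|\<mu>. \<psi> x) + (LINT y|\<nu>. \<phi> y)) \<le> ennreal (((LINT x|\<mu>. \<psi> x - d) + (LINT y|\<nu>. \<phi> y - d)) + e)"
    by (rule ennreal_leI)
  also have "\<dots> \<le> ennreal ((LINT x|\<mu>. \<psi> x - d) + (LINT y|\<nu>. \<phi> y - d)) + ennreal e"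
    by (rule ennreal_plus_le)
  also have "\<dots> \<le> HK2 \<kappa> \<Omega> \<mu> \<nu> + ennreal e"
    by (intro add_mono * order_refl)
  finally show "ennreal ((LINT x|\<mu>. \<psi> x) + (LINT y|\<nu>. \<phi> y)) \<le> HK2 \<kappa> \<Omega> \<mu> \<nu> + ennreal e" .
qed

section \<open>An upper bound for the Hellinger--Kantorovich distance\<close>

text \<open>Jensen's inequality for the measure with density \<open>b\<close>, of mass at most 1,
  filled up to a probability by an atom at which the integrand is 0 and the entropy is
  \<open>kl_entropy 0 = 1\<close>. Convexity enters through tangents: \<open>kl_entropy_ge\<close>
  with \<open>u = ln t\<close>. Where \<open>b\<close> vanishes so must \<open>g\<close>; otherwise
  the convention \<open>g x / 0 = 0\<close> would hide an infinite entropy.\<close>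

lemma entropy_density_bound:
  fixes g b :: "'a \<Rightarrow> real"
  assumes \<mu>: "finite_measure \<mu>" and b: "integrable \<mu> b" and g: "integrable \<mu> g"
    and nn: "\<And>x. x \<in> space \<mu> \<Longrightarrow> 0 \<le> b x" "\<And>x. x \<in> space \<mu> \<Longrightarrow> 0 \<le> g x"
    and b0: "\<And>x. x \<in> space \<mu> \<Longrightarrow> b x = 0 \<Longrightarrow> g x = 0"
    and b1: "(LINT x|\<mu>. b x) \<le> 1"
  shows "ennreal (kl_entropy (LINT x|\<mu>. g x))
     \<le> (\<integral>\<^sup>+ x. ennreal (b x * kl_entropy (g x / b x)) \<partial>\<mu>) + ennreal (1 - (LINT x|\<mu>. b x))"
proof -
  define n where "n = (LINT x|\<mu>. g x)"
  define \<beta> where "\<beta> = (LINT x|\<mu>. b x)"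
  let ?X = "\<integral>\<^sup>+ x. ennreal (b x * kl_entropy (g x / b x)) \<partial>\<mu>"
  have \<beta>: "0 \<le> \<beta>" "\<beta> \<le> 1" using nn b1 by (auto simp: \<beta>_def)
  have n: "0 \<le> n" using nn by (auto simp: n_def)
  have X: "ennreal (n * ln t - t * \<beta> + \<beta>) \<le> ?X" if t: "t > 0" for t
  proof -
    have "n * ln t - t * \<beta> + \<beta> = (LINT x|\<mu>. g x * ln t - t * b x + b x)"
      using b g by (simp add: n_def \<beta>_def)
    also have "ennreal \<dots> \<le> (\<integral>\<^sup>+ x. ennreal (g x * ln t - t * b x + b x) \<partial>\<mu>)"
      using b g by (intro ennreal_integral_le_nn_integral) auto
    also have "\<dots> \<le> ?X"
    proof (intro nn_integral_mono ennreal_leI)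
      fix x assume x: "x \<in> space \<mu>"
      show "g x * ln t - t * b x + b x \<le> b x * kl_entropy (g x / b x)"
      proof (cases "b x = 0")
        case False
        hence bx: "b x > 0" using nn(1)[OF x] by simp
        have "b x * (g x / b x * ln t - exp (ln t) + 1) \<le> b x * kl_entropy (g x / b x)"
          using bx nn(2)[OF x] by (intro mult_left_mono kl_entropy_ge) auto
        also have "b x * (g x / b x * ln t - exp (ln t) + 1) = g x * ln t - t * b x + b x"
          using bx t by (simp add: algebra_simps)
        finally show ?thesis .
      qed (use b0[OF x] in simp)
    qed
    finally show ?thesis .
  qed
  show ?thesis
  proof (cases "n = 0")
    case False
    hence n0: "n > 0" using n by simp
    have "ennreal (kl_entropy n) \<le> ennreal ((n * ln n - n * \<beta> + \<beta>) + (1 - \<beta>))"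
      using n0 \<beta> by (intro ennreal_leI) (simp add: kl_entropy_def mult_left_le)
    also have "\<dots> \<le> ennreal (n * ln n - n * \<beta> + \<beta>) + ennreal (1 - \<beta>)"
      by (rule ennreal_plus_le)
    also have "\<dots> \<le> ?X + ennreal (1 - \<beta>)"
      by (intro add_right_mono X n0)
    finally show ?thesis by (simp add: n_def \<beta>_def)
  next
    case True
    \<comment> \<open>The entropy has no tangent at 0, where its slope is infinite; taking
      \<open>t = e\<close> and letting \<open>e\<close> tend to 0 loses at most
      \<open>e\<close>.\<close>
    have "ennreal (kl_entropy n) \<le> ?X + ennreal (1 - \<beta>)"
    proof (rule ennreal_le_epsilon)
      fix e :: real assume e: "0 < e"
      have "ennreal (kl_entropy n) \<le> ennreal ((n * ln e - e * \<beta> + \<beta>) + (1 - \<beta>) + e)"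
        using \<beta> e True by (intro ennreal_leI) (simp add: kl_entropy_def mult_left_le)
      also have "\<dots> \<le> ennreal (n * ln e - e * \<beta> + \<beta>) + ennreal (1 - \<beta>) + ennreal e"
        by (meson add_mono ennreal_plus_le order_refl order_trans)
      also have "\<dots> \<le> ?X + ennreal (1 - \<beta>) + ennreal e"
        by (intro add_right_mono X e)
      finally show "ennreal (kl_entropy n) \<le> ?X + ennreal (1 - \<beta>) + ennreal e" .
    qed
    thus ?thesis by (simp add: n_def \<beta>_def)
  qed
qed

text \<open>
  The plan is \<open>\<gamma> = b Cos\<^sup>2 / sqrt S\<close> with respect to \<open>\<mu> \<times> \<nu>\<close>. Its first marginal has density
  \<open>sqrt S\<close> with respect to \<open>\<mu>\<close>, and the entropy of the second marginal is controlled by Jensen's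
  inequality relative to \<open>b\<close>; the three logarithms cancel.
\<close>

lemma HK2_le:
  fixes \<Omega> :: "'a::euclidean_space set"
  assumes \<kappa>: "0 < \<kappa>"
    and \<mu>: "\<mu> \<in> radon_measures \<Omega>" and \<nu>: "\<nu> \<in> radon_measures \<Omega>"
    and b [measurable]: "case_prod b \<in> borel_measurable (\<mu> \<Otimes>\<^sub>M \<nu>)"
    and nn: "\<And>x y. x \<in> \<Omega> \<Longrightarrow> y \<in> \<Omega> \<Longrightarrow> 0 \<le> b x y"
    and bd: "\<And>x y. x \<in> \<Omega> \<Longrightarrow> y \<in> \<Omega> \<Longrightarrow> b x y \<le> B"
    and b1: "\<And>y. y \<in> \<Omega> \<Longrightarrow> (LINT x|\<mu>. b x y) \<le> 1"
    and S_def: "\<And>x. S x = (LINT y|\<nu>. b x y * (Cos (norm (x - y) / \<kappa>))\<^sup>2)"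
    and s0: "0 < s0" and Sge: "\<And>x. x \<in> \<Omega> \<Longrightarrow> s0 \<le> S x"
  shows "HK2 \<kappa> \<Omega> \<mu> \<nu> \<le> ennreal (measure \<mu> \<Omega> + measure \<nu> \<Omega> - 2 * (LINT x|\<mu>. sqrt (S x)))"
proof -
  interpret mu: finite_measure \<mu> using \<mu> by (rule radon_measuresD)
  interpret nu: finite_measure \<nu> using \<nu> by (rule radon_measuresD)
  interpret mn: pair_sigma_finite \<mu> \<nu> ..
  interpret fmn: finite_measure "\<mu> \<Otimes>\<^sub>M \<nu>"
    by (intro finite_measure_pair_measure mu.finite_measure_axioms nu.finite_measure_axioms)
  note sp = radon_measuresD(3)[OF \<mu>] radon_measuresD(3)[OF \<nu>]
  let ?B = "restrict_space borel \<Omega>"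
  have smu: "sets \<mu> = sets ?B" and snu: "sets \<nu> = sets ?B"
    using radon_measuresD \<mu> \<nu> by auto
  define P where "P = \<mu> \<Otimes>\<^sub>M \<nu>"
  have spP: "space P = \<Omega> \<times> \<Omega>" by (simp add: P_def space_pair_measure sp)
  have setsP: "sets P = sets (restrict_space borel (\<Omega> \<times> \<Omega>))"
    unfolding P_def using sets_pair_measure_cong[OF smu snu] sets_pair_restrict_borel[of \<Omega> \<Omega>] by simp
  define K where "K x y = (Cos (norm (x - y) / \<kappa>))\<^sup>2" for x y :: 'a
  have K: "0 \<le> K x y" "K x y \<le> 1" for x y by (auto simp: K_def Cos_sq_le_1)
  have "(\<lambda>p. K (fst p) (snd p)) \<in> borel_measurable borel"
    unfolding K_def by (intro borel_measurable_continuous_onI continuous_intros) (use \<kappa> in auto)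
  hence Km [measurable]: "(\<lambda>p. K (fst p) (snd p)) \<in> borel_measurable P"
    using measurable_restrict_space1[of _ borel borel "\<Omega> \<times> \<Omega>"] setsP by (simp cong: measurable_cong_sets)
  have bm [measurable]: "(\<lambda>p. b (fst p) (snd p)) \<in> borel_measurable P"
    using b by (simp add: P_def case_prod_beta')
  have S: "S x = (LINT y|\<nu>. b x y * K x y)" for x unfolding S_def K_def ..
  have "(\<lambda>p. b (fst p) (snd p) * K (fst p) (snd p)) \<in> borel_measurable P" by measurable
  hence Sm [measurable]: "S \<in> borel_measurable \<mu>"
    unfolding S[abs_def] P_def by (intro nu.borel_measurable_lebesgue_integral) (simp add: case_prod_beta')
  define r where "r x = sqrt (S x)" for x
  have [measurable]: "r \<in> borel_measurable \<mu>" unfolding r_def using Sm by measurable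
  have rP [measurable]: "(\<lambda>p. r (fst p)) \<in> borel_measurable P" unfolding P_def by measurable
  have r0: "0 < sqrt s0" using s0 by simp
  have rge: "sqrt s0 \<le> r x" and rpos: "r x > 0" and rr: "r x * r x = S x" if "x \<in> \<Omega>" for x
    using Sge[OF that] s0 by (auto simp: r_def intro: less_le_trans)
  define g where "g x y = b x y * K x y / r x" for x y
  have gm [measurable]: "(\<lambda>p. g (fst p) (snd p)) \<in> borel_measurable P"
    unfolding g_def by measurable
  have section1: "(\<lambda>y. f x y) \<in> borel_measurable \<nu>"
    if "(\<lambda>p. f (fst p) (snd p)) \<in> borel_measurable P" "x \<in> \<Omega>" for f :: "'a \<Rightarrow> 'a \<Rightarrow> real" and x
    using measurable_Pair2[of "\<lambda>p. f (fst p) (snd p)" \<mu> \<nu> borel x] that sp by (simp add: P_def)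
  have section2: "(\<lambda>x. f x y) \<in> borel_measurable \<mu>"
    if "(\<lambda>p. f (fst p) (snd p)) \<in> borel_measurable P" "y \<in> \<Omega>" for f :: "'a \<Rightarrow> 'a \<Rightarrow> real" and y
    using measurable_Pair1[of "\<lambda>p. f (fst p) (snd p)" \<mu> \<nu> borel y] that sp by (simp add: P_def)
  have b_abs: "\<bar>b x y\<bar> \<le> \<bar>B\<bar>" if "x \<in> \<Omega>" "y \<in> \<Omega>" for x y
    using nn[OF that] bd[OF that] by simp
  have g0: "0 \<le> g x y" if "x \<in> \<Omega>" "y \<in> \<Omega>" for x y
    unfolding g_def using nn[OF that] K(1) rpos[OF that(1)] by (intro divide_nonneg_pos mult_nonneg_nonneg)
  have gG: "g x y \<le> \<bar>B\<bar> / sqrt s0" if "x \<in> \<Omega>" "y \<in> \<Omega>" for x y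
  proof -
    have "b x y * K x y \<le> \<bar>B\<bar> * 1"
      using b_abs[OF that] nn[OF that] K by (intro mult_mono) auto
    thus ?thesis unfolding g_def using rge[OF that(1)] r0 by (intro frac_le) auto
  qed
  have iby: "integrable \<nu> (\<lambda>y. b x y)" if "x \<in> \<Omega>" for x
    using b_abs that sp by (intro nu.integrable_const_bound[where B = "\<bar>B\<bar>"] section1 bm) auto
  have ibx: "integrable \<mu> (\<lambda>x. b x y)" if "y \<in> \<Omega>" for y
    using b_abs that sp by (intro mu.integrable_const_bound[where B = "\<bar>B\<bar>"] section2 bm) auto
  have igy: "integrable \<nu> (\<lambda>y. g x y)" if "x \<in> \<Omega>" for x
    using gG g0 that sp by (intro nu.integrable_const_bound[where B = "\<bar>B\<bar> / sqrt s0"] section1 gm) auto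
  have igx: "integrable \<mu> (\<lambda>x. g x y)" if "y \<in> \<Omega>" for y
    using gG g0 that sp by (intro mu.integrable_const_bound[where B = "\<bar>B\<bar> / sqrt s0"] section2 gm) auto
  have gint: "(LINT y|\<nu>. g x y) = r x" if "x \<in> \<Omega>" for x
  proof -
    have "(LINT y|\<nu>. g x y) = S x / r x" by (simp add: g_def S)
    also have "\<dots> = r x" unfolding rr[OF that, symmetric] using rpos[OF that] by simp
    finally show ?thesis .
  qed
  have gnn1: "(\<integral>\<^sup>+ y. ennreal (g x y) \<partial>\<nu>) = ennreal (r x)" if "x \<in> \<Omega>" for x
    using igy[OF that] g0 that sp by (subst nn_integral_eq_integral) (auto simp: gint)
  define n where "n y = (LINT x|\<mu>. g x y)" for y
  have gnn2: "(\<integral>\<^sup>+ x. ennreal (g x y) \<partial>\<mu>) = ennreal (n y)" if "y \<in> \<Omega>" for y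
    using igx[OF that] g0 that sp by (subst nn_integral_eq_integral) (auto simp: n_def)
  have n0: "0 \<le> n y" if "y \<in> \<Omega>" for y unfolding n_def using g0 that sp by (intro integral_nonneg_AE) auto
  have swapm: "(\<lambda>p. f (snd p) (fst p)) \<in> borel_measurable (\<nu> \<Otimes>\<^sub>M \<mu>)"
    if "(\<lambda>p. f (fst p) (snd p)) \<in> borel_measurable P" for f :: "'a \<Rightarrow> 'a \<Rightarrow> real"
    using measurable_compose[OF measurable_pair_swap' that[unfolded P_def]] by (simp add: case_prod_beta')
  have nm [measurable]: "n \<in> borel_measurable \<nu>"
    unfolding n_def using swapm[OF gm]
    by (intro mu.borel_measurable_lebesgue_integral) (simp add: case_prod_beta')
  define \<gamma> where "\<gamma> = density P (\<lambda>p. ennreal (g (fst p) (snd p)))"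
  have sp\<gamma>: "space \<gamma> = \<Omega> \<times> \<Omega>" by (simp add: \<gamma>_def spP)
  have "emeasure \<gamma> (space \<gamma>) < \<infinity>"
  proof -
    have "emeasure \<gamma> (space \<gamma>) = (\<integral>\<^sup>+ p. ennreal (g (fst p) (snd p)) \<partial>P)"
      by (simp add: \<gamma>_def emeasure_density cong: nn_integral_cong)
    also have "\<dots> \<le> (\<integral>\<^sup>+ p. ennreal (\<bar>B\<bar> / sqrt s0) \<partial>P)"
      using gG by (intro nn_integral_mono ennreal_leI) (auto simp: spP)
    also have "\<dots> < \<infinity>"
      using fmn.emeasure_finite
      by (simp add: P_def ennreal_mult_eq_top_iff less_top[symmetric])
    finally show ?thesis .
  qed
  hence \<gamma>: "\<gamma> \<in> radon_measures (\<Omega> \<times> \<Omega>)"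
    by (auto simp: radon_measures_def \<gamma>_def setsP intro!: finite_measureI)
  note fsm [measurable] = measurable_projections_radon[OF \<gamma>]
  have tonelli1: "(\<integral>\<^sup>+ p. f p \<partial>P) = (\<integral>\<^sup>+ x. \<integral>\<^sup>+ y. f (x, y) \<partial>\<nu> \<partial>\<mu>)"
    if "f \<in> borel_measurable P" for f :: "'a \<times> 'a \<Rightarrow> ennreal"
    using nu.nn_integral_fst[of f \<mu>] that by (simp add: P_def)
  have tonelli2: "(\<integral>\<^sup>+ p. f p \<partial>P) = (\<integral>\<^sup>+ y. \<integral>\<^sup>+ x. f (x, y) \<partial>\<mu> \<partial>\<nu>)"
    if "f \<in> borel_measurable P" for f :: "'a \<times> 'a \<Rightarrow> ennreal"
    using mn.nn_integral_snd[of f] that by (simp add: P_def)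
  have marg: "emeasure (distr \<gamma> ?B f) A = (\<integral>\<^sup>+ p. ennreal (g (fst p) (snd p)) * indicator A (f p) \<partial>P)"
    if f: "f \<in> \<gamma> \<rightarrow>\<^sub>M ?B" and A: "A \<in> sets ?B" for f A
  proof -
    have "f -` A \<inter> space \<gamma> \<in> sets P" using measurable_sets[OF f A] by (simp add: \<gamma>_def)
    hence "emeasure (distr \<gamma> ?B f) A = (\<integral>\<^sup>+ p. ennreal (g (fst p) (snd p)) * indicator (f -` A \<inter> space \<gamma>) p \<partial>P)"
      using f A by (simp add: emeasure_distr) (simp add: \<gamma>_def emeasure_density)
    also have "\<dots> = (\<integral>\<^sup>+ p. ennreal (g (fst p) (snd p)) * indicator A (f p) \<partial>P)"
      by (intro nn_integral_cong) (auto simp: \<gamma>_def split: split_indicator)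
    finally show ?thesis .
  qed
  have iA: "(\<lambda>p. indicator A (f p) :: ennreal) \<in> borel_measurable P" if "f \<in> \<gamma> \<rightarrow>\<^sub>M ?B" "A \<in> sets ?B" for f A
  proof -
    have "f \<in> P \<rightarrow>\<^sub>M ?B" using that(1) by (simp add: \<gamma>_def)
    thus ?thesis using that(2) by measurable
  qed
  have d1: "distr \<gamma> ?B fst = density \<mu> (\<lambda>x. ennreal (r x))"
  proof (rule measure_eqI)
    fix A assume "A \<in> sets (distr \<gamma> ?B fst)"
    hence A: "A \<in> sets ?B" by simp
    have "emeasure (distr \<gamma> ?B fst) A = (\<integral>\<^sup>+ x. \<integral>\<^sup>+ y. ennreal (g x y) * indicator A x \<partial>\<nu> \<partial>\<mu>)"
      using iA[OF fsm(1) A] by (subst marg[OF fsm(1) A], subst tonelli1) auto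
    also have "\<dots> = (\<integral>\<^sup>+ x. ennreal (r x) * indicator A x \<partial>\<mu>)"
      by (intro nn_integral_cong, subst nn_integral_multc)
         (auto simp: gnn1 sp intro!: measurable_compose[OF section1[OF gm]])
    also have "\<dots> = emeasure (density \<mu> (\<lambda>x. ennreal (r x))) A"
      using A smu by (subst emeasure_density) auto
    finally show "emeasure (distr \<gamma> ?B fst) A = \<dots>" .
  qed (simp add: smu)
  have d2: "distr \<gamma> ?B snd = density \<nu> (\<lambda>x. ennreal (n x))"
  proof (rule measure_eqI)
    fix A assume "A \<in> sets (distr \<gamma> ?B snd)"
    hence A: "A \<in> sets ?B" by simp
    have "emeasure (distr \<gamma> ?B snd) A = (\<integral>\<^sup>+ y. \<integral>\<^sup>+ x. ennreal (g x y) * indicator A y \<partial>\<mu> \<partial>\<nu>)"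
      using iA[OF fsm(2) A] by (subst marg[OF fsm(2) A], subst tonelli2) auto
    also have "\<dots> = (\<integral>\<^sup>+ x. ennreal (n x) * indicator A x \<partial>\<nu>)"
      by (intro nn_integral_cong, subst nn_integral_multc)
         (auto simp: gnn2 sp intro!: measurable_compose[OF section2[OF gm]])
    also have "\<dots> = emeasure (density \<nu> (\<lambda>x. ennreal (n x))) A"
      using A snu by (subst emeasure_density) auto
    finally show "emeasure (distr \<gamma> ?B snd) A = \<dots>" .
  qed (simp add: snu)
  have KL1: "KL (distr \<gamma> ?B fst) \<mu> = (\<integral>\<^sup>+ x. ennreal (kl_entropy (r x)) \<partial>\<mu>)"
    unfolding d1 using rpos sp by (intro KL_density mu.finite_measure_axioms) (auto simp: less_imp_le)
  have KL2: "KL (distr \<gamma> ?B snd) \<nu> = (\<integral>\<^sup>+ y. ennreal (kl_entropy (n y)) \<partial>\<nu>)"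
    unfolding d2 using n0 sp by (intro KL_density nu.finite_measure_axioms) auto
  define c where "c x y = (if 0 < K x y then ennreal (- ln (K x y)) else \<infinity>)" for x y
  have cm [measurable]: "(\<lambda>p. c (fst p) (snd p)) \<in> borel_measurable P"
    unfolding c_def by measurable
  have "hk_cost \<kappa> x y = c x y" for x y
    using Cos_bounds(1)[of "norm (x - y) / \<kappa>"] by (simp add: hk_cost_eq[OF \<kappa>] c_def K_def)
  hence cost: "(\<integral>\<^sup>+ (x, y). hk_cost \<kappa> x y \<partial>\<gamma>) = (\<integral>\<^sup>+ p. ennreal (g (fst p) (snd p)) * c (fst p) (snd p) \<partial>P)"
    unfolding \<gamma>_def case_prod_beta' by (subst nn_integral_density) auto
  define e where "e x y = ennreal (b x y * kl_entropy (g x y / b x y))" for x y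
  have em [measurable]: "(\<lambda>p. e (fst p) (snd p)) \<in> borel_measurable P"
    unfolding e_def by measurable
  define \<beta> where "\<beta> y = (LINT x|\<mu>. b x y)" for y
  have \<beta>m [measurable]: "\<beta> \<in> borel_measurable \<nu>"
    unfolding \<beta>_def using swapm[OF bm]
    by (intro mu.borel_measurable_lebesgue_integral) (simp add: case_prod_beta')
  have \<beta>01: "0 \<le> \<beta> y" "\<beta> y \<le> 1" if "y \<in> \<Omega>" for y
    using b1[OF that] nn that sp unfolding \<beta>_def by (auto intro!: integral_nonneg_AE)
  have jensen: "ennreal (kl_entropy (n y)) \<le> (\<integral>\<^sup>+ x. e x y \<partial>\<mu>) + ennreal (1 - \<beta> y)" if "y \<in> \<Omega>" for y
    unfolding n_def \<beta>_def e_def using that nn g0 b1 sp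
    by (intro entropy_density_bound mu.finite_measure_axioms ibx igx) (auto simp: g_def)
  \<comment> \<open>If \<open>b\<close> or the kernel vanishes, so does \<open>g\<close>, and
    \<open>0 * \<infinity> = 0\<close> removes the infinite cost. Otherwise
    \<open>ln (g / b) = ln K - ln r\<close> cancels the cost against the entropy and leaves only
    \<open>ln r\<close>, which does not depend on \<open>y\<close>.\<close>
  have pt: "ennreal (g x y) * c x y + e x y = ennreal (- g x y * ln (r x) - g x y + b x y)" 
    and pt0: "0 \<le> - g x y * ln (r x) - g x y + b x y" if "x \<in> \<Omega>" "y \<in> \<Omega>" for x y
  proof -
    have rx: "r x > 0" using rpos that by auto
    have "ennreal (g x y) * c x y + e x y = ennreal (- g x y * ln (r x) - g x y + b x y)
      \<and> 0 \<le> - g x y * ln (r x) - g x y + b x y"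
    proof (cases "b x y = 0 \<or> K x y = 0")
      case True
      thus ?thesis using nn[OF that] by (auto simp: g_def e_def kl_entropy_def)
    next
      case False
      hence pos: "b x y > 0" "K x y > 0" using nn[OF that] K(1)[of x y] by auto
      hence gp: "g x y > 0" using rx by (simp add: g_def)
      have "- ln (K x y) \<ge> 0" using pos K(2)[of x y] by simp
      moreover have "0 \<le> b x y * kl_entropy (g x y / b x y)"
        using pos gp by (intro mult_nonneg_nonneg kl_entropy_nonneg) auto
      moreover have "ln (g x y / b x y) = ln (K x y) - ln (r x)"
        using pos rx by (simp add: g_def ln_div)
      hence "g x y * - ln (K x y) + b x y * kl_entropy (g x y / b x y) = - g x y * ln (r x) - g x y + b x y"
      proof -
        have "ln (K x y) = ln (g x y / b x y) + ln (r x)"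
          using \<open>ln (g x y / b x y) = ln (K x y) - ln (r x)\<close> by simp
        thus ?thesis using pos gp by (simp add: kl_entropy_def algebra_simps)
      qed
      moreover have "0 \<le> g x y * - ln (K x y)"
        using calculation(1) gp by (intro mult_nonneg_nonneg) auto
      ultimately show ?thesis
        using pos gp by (simp add: c_def e_def flip: ennreal_mult ennreal_plus)
    qed
    thus "ennreal (g x y) * c x y + e x y = ennreal (- g x y * ln (r x) - g x y + b x y)" 
      "0 \<le> - g x y * ln (r x) - g x y + b x y" by auto
  qed
  define D where "D x = (LINT y|\<nu>. b x y)" for x
  \<comment> \<open>Since \<open>g x\<close> integrates to \<open>r x\<close> against
    \<open>\<nu>\<close>, the entropy of the first marginal cancels the remaining term
    \<open>r * ln r\<close>.\<close>
  have inner: "(\<integral>\<^sup>+ y. ennreal (g x y) * c x y + e x y \<partial>\<nu>) + ennreal (kl_entropy (r x)) = ennreal (1 + D x - 2 * r x)"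
    and inner0: "0 \<le> 1 + D x - 2 * r x" if "x \<in> \<Omega>" for x
  proof -
    have i: "integrable \<nu> (\<lambda>y. - g x y * ln (r x) - g x y + b x y)"
      using igy[OF that] iby[OF that] by auto
    have lin: "(LINT y|\<nu>. - g x y * ln (r x) - g x y + b x y) = - r x * ln (r x) - r x + D x"
      using igy[OF that] iby[OF that] by (simp add: gint[OF that] D_def)
    have "(\<integral>\<^sup>+ y. ennreal (g x y) * c x y + e x y \<partial>\<nu>) = (\<integral>\<^sup>+ y. ennreal (- g x y * ln (r x) - g x y + b x y) \<partial>\<nu>)"
      using pt that sp by (intro nn_integral_cong) auto
    also have "\<dots> = ennreal (LINT y|\<nu>. - g x y * ln (r x) - g x y + b x y)"
      using pt0 that sp i by (intro nn_integral_eq_integral) auto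
    finally have 1: "(\<integral>\<^sup>+ y. ennreal (g x y) * c x y + e x y \<partial>\<nu>) = ennreal (- r x * ln (r x) - r x + D x)"
      unfolding lin .
    have "0 \<le> (LINT y|\<nu>. - g x y * ln (r x) - g x y + b x y)"
      using pt0 that sp by (intro integral_nonneg_AE) auto
    hence 2: "0 \<le> - r x * ln (r x) - r x + D x" unfolding lin .
    have 3: "0 \<le> kl_entropy (r x)" using rpos[OF that] by (intro kl_entropy_nonneg) auto
    have 4: "- r x * ln (r x) - r x + D x + kl_entropy (r x) = 1 + D x - 2 * r x"
      using rpos[OF that] by (simp add: kl_entropy_def)
    show "(\<integral>\<^sup>+ y. ennreal (g x y) * c x y + e x y \<partial>\<nu>) + ennreal (kl_entropy (r x)) = ennreal (1 + D x - 2 * r x)"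
      unfolding 1 ennreal_plus[OF 2 3, symmetric] 4 ..
    show "0 \<le> 1 + D x - 2 * r x" using 2 3 4 by linarith
  qed
  have ib: "integrable P (\<lambda>p. b (fst p) (snd p))"
    unfolding P_def using b_abs bm spP by (intro fmn.integrable_const_bound[where B = "\<bar>B\<bar>"]) (auto simp: P_def)
  have iD: "integrable \<mu> D"
    unfolding D_def using mn.integrable_fst'[of "\<lambda>p. b (fst p) (snd p)"] ib by (simp add: P_def)
  have ir: "integrable \<mu> r"
  proof (rule mu.integrable_const_bound[where B = "sqrt (\<bar>B\<bar> * measure \<nu> \<Omega>)"])
    have "S x \<le> \<bar>B\<bar> * measure \<nu> \<Omega>" if "x \<in> \<Omega>" for x
    proof -
      have bK: "0 \<le> b x y * K x y \<and> b x y * K x y \<le> \<bar>B\<bar>" if "y \<in> \<Omega>" for y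
        using mult_mono[of "b x y" "\<bar>B\<bar>" "K x y" 1] b_abs nn K[of x y] that \<open>x \<in> \<Omega>\<close> by auto
      have "(\<lambda>p. b (fst p) (snd p) * K (fst p) (snd p)) \<in> borel_measurable P" by measurable
      hence "integrable \<nu> (\<lambda>y. b x y * K x y)"
        using bK that sp by (intro nu.integrable_const_bound[where B = "\<bar>B\<bar>"] section1[of "\<lambda>x y. b x y * K x y"]) auto
      hence "S x \<le> (LINT y|\<nu>. \<bar>B\<bar>)"
        unfolding S using bK sp by (intro integral_mono) auto
      thus ?thesis using sp by (simp add: mult.commute)
    qed
    thus "AE x in \<mu>. norm (r x) \<le> sqrt (\<bar>B\<bar> * measure \<nu> \<Omega>)"
      using rpos sp by (intro AE_I2) (metis abs_of_pos r_def real_norm_def real_sqrt_le_mono)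
  qed measurable
  have ibeta: "integrable \<nu> \<beta>"
    using \<beta>01 sp by (intro nu.integrable_const_bound[where B = 1]) auto
  have fub: "(LINT y|\<nu>. \<beta> y) = (LINT x|\<mu>. D x)"
    unfolding \<beta>_def D_def using mn.Fubini_integral[of b] ib by (simp add: P_def case_prod_beta')
  let ?C = "\<integral>\<^sup>+ p. ennreal (g (fst p) (snd p)) * c (fst p) (snd p) \<partial>P"
  let ?E = "\<integral>\<^sup>+ p. e (fst p) (snd p) \<partial>P"
  let ?R = "\<integral>\<^sup>+ x. ennreal (kl_entropy (r x)) \<partial>\<mu>"
  let ?L = "LINT y|\<nu>. 1 - \<beta> y"
  have "(\<integral>\<^sup>+ y. ennreal (kl_entropy (n y)) \<partial>\<nu>) \<le> (\<integral>\<^sup>+ y. (\<integral>\<^sup>+ x. e x y \<partial>\<mu>) + ennreal (1 - \<beta> y) \<partial>\<nu>)"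
    using jensen sp by (intro nn_integral_mono) auto
  also have "\<dots> = (\<integral>\<^sup>+ y. \<integral>\<^sup>+ x. e x y \<partial>\<mu> \<partial>\<nu>) + (\<integral>\<^sup>+ y. ennreal (1 - \<beta> y) \<partial>\<nu>)"
  proof (rule nn_integral_add)
    have "(\<lambda>p. e (snd p) (fst p)) \<in> borel_measurable (\<nu> \<Otimes>\<^sub>M \<mu>)"
      using measurable_compose[OF measurable_pair_swap' em[unfolded P_def]] by (simp add: case_prod_beta')
    thus "(\<lambda>y. \<integral>\<^sup>+ x. e x y \<partial>\<mu>) \<in> borel_measurable \<nu>"
      by (intro mu.borel_measurable_nn_integral) (simp add: case_prod_beta')
  qed measurable
  also have "(\<integral>\<^sup>+ y. \<integral>\<^sup>+ x. e x y \<partial>\<mu> \<partial>\<nu>) = ?E"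
    by (subst tonelli2) auto
  also have "(\<integral>\<^sup>+ y. ennreal (1 - \<beta> y) \<partial>\<nu>) = ennreal ?L"
    using \<beta>01 ibeta sp by (intro nn_integral_eq_integral) auto
  finally have N: "(\<integral>\<^sup>+ y. ennreal (kl_entropy (n y)) \<partial>\<nu>) \<le> ?E + ennreal ?L" .
  have cem: "(\<lambda>p. ennreal (g (fst p) (snd p)) * c (fst p) (snd p) + e (fst p) (snd p)) \<in> borel_measurable P"
    by measurable
  have "?C + ?E + ?R = (\<integral>\<^sup>+ p. ennreal (g (fst p) (snd p)) * c (fst p) (snd p) + e (fst p) (snd p) \<partial>P) + ?R"
    by (subst nn_integral_add) auto
  also have "\<dots> = (\<integral>\<^sup>+ x. \<integral>\<^sup>+ y. ennreal (g x y) * c x y + e x y \<partial>\<nu> \<partial>\<mu>) + ?R"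
    by (subst tonelli1[OF cem]) simp
  also have "\<dots> = (\<integral>\<^sup>+ x. (\<integral>\<^sup>+ y. ennreal (g x y) * c x y + e x y \<partial>\<nu>) + ennreal (kl_entropy (r x)) \<partial>\<mu>)"
  proof (rule nn_integral_add[symmetric])
    show "(\<lambda>x. \<integral>\<^sup>+ y. ennreal (g x y) * c x y + e x y \<partial>\<nu>) \<in> borel_measurable \<mu>"
      using cem unfolding P_def by (intro nu.borel_measurable_nn_integral) (simp add: case_prod_beta')
  qed measurable
  also have "\<dots> = (\<integral>\<^sup>+ x. ennreal (1 + D x - 2 * r x) \<partial>\<mu>)"
    using inner sp by (intro nn_integral_cong) auto
  also have "\<dots> = ennreal (LINT x|\<mu>. 1 + D x - 2 * r x)"
    using inner0 iD ir sp by (intro nn_integral_eq_integral) auto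
  finally have CER: "?C + ?E + ?R = ennreal (LINT x|\<mu>. 1 + D x - 2 * r x)" .
  \<comment> \<open>The bound \<open>N\<close> for the entropy of the second marginal consists of
    \<open>?E\<close> and the defect \<open>?L\<close>. The former is combined with the cost; in the
    latter Fubini's theorem cancels the total mass of \<open>b\<close> between \<open>D\<close> and
    \<open>\<beta>\<close>.\<close>
  have "HK2 \<kappa> \<Omega> \<mu> \<nu> \<le> ?C + ?R + (\<integral>\<^sup>+ y. ennreal (kl_entropy (n y)) \<partial>\<nu>)"
    unfolding HK2_def by (rule INF_lower2[OF \<gamma>]) (simp only: KL1 KL2 cost order_refl)
  also have "\<dots> \<le> ?C + ?R + (?E + ennreal ?L)"
    by (intro add_left_mono N)
  also have "\<dots> = ?C + ?E + ?R + ennreal ?L"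
    by (simp only: add_ac)
  also have "\<dots> = ennreal ((LINT x|\<mu>. 1 + D x - 2 * r x) + ?L)"
    unfolding CER using inner0 \<beta>01 sp by (intro ennreal_plus[symmetric] integral_nonneg_AE) auto
  also have "(LINT x|\<mu>. 1 + D x - 2 * r x) + ?L = measure \<mu> \<Omega> + measure \<nu> \<Omega> - 2 * (LINT x|\<mu>. r x)"
    using iD ir ibeta sp by (simp add: fub)
  finally show ?thesis by (simp add: r_def)
qed

section \<open>Duality for discrete second marginals\<close>

lemma continuous_on_lse:
  assumes "finite I" "I \<noteq> {}" "\<And>i. i \<in> I \<Longrightarrow> continuous_on A (\<lambda>x. w x i)"
  shows "continuous_on A (\<lambda>x. lse N I (w x))"
  unfolding lse_def divide_inverse using assms sum_exp_pos[OF assms(1,2), of "\<lambda>i. N * w x i" for x]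
  by (intro continuous_intros) (auto simp: less_le)

lemma continuous_on_softmax:
  assumes "finite I" "i \<in> I" "\<And>i. i \<in> I \<Longrightarrow> continuous_on A (\<lambda>x. w x i)"
  shows "continuous_on A (\<lambda>x. softmax N I (w x) i)"
proof -
  have "(\<Sum>j\<in>I. exp (N * w x j)) \<noteq> 0" for x
    using sum_exp_pos[of I "\<lambda>i. N * w x i"] assms by force
  thus ?thesis
    unfolding softmax_def using assms by (intro continuous_intros) auto
qed

text \<open>\<open>point_measure\<close> lives on all subsets of \<open>Y\<close>; the push-forward
  moves it to the Borel sets of \<open>\<Omega>\<close>, as \<open>radon_measures\<close>
  demands.\<close>

definition discrete_measure :: "'a::euclidean_space set \<Rightarrow> 'a set \<Rightarrow> ('a \<Rightarrow> real) \<Rightarrow> 'a measure" where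
  "discrete_measure \<Omega> Y v = distr (point_measure Y (\<lambda>y. ennreal (v y))) (restrict_space borel \<Omega>) (\<lambda>y. y)"

lemma
  assumes Y: "finite Y" "Y \<subseteq> \<Omega>" and v: "\<And>y. y \<in> Y \<Longrightarrow> 0 \<le> v y"
  shows discrete_measure_radon: "discrete_measure \<Omega> Y v \<in> radon_measures \<Omega>"
    and integral_discrete_measure: "f \<in> borel_measurable (restrict_space borel \<Omega>) \<Longrightarrow>
      (LINT y|discrete_measure \<Omega> Y v. (f y :: real)) = (\<Sum>y\<in>Y. v y * f y)"
    and measure_discrete_measure: "measure (discrete_measure \<Omega> Y v) \<Omega> = (\<Sum>y\<in>Y. v y)"
proof -
  have m [measurable]: "(\<lambda>y. y) \<in> point_measure Y (\<lambda>y. ennreal (v y)) \<rightarrow>\<^sub>M restrict_space borel \<Omega>"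
    using Y by (auto simp: measurable_def space_point_measure space_restrict_space sets_point_measure)
  have "finite_measure (point_measure Y (\<lambda>y. ennreal (v y)))"
    using Y by (intro finite_measureI) (simp add: space_point_measure emeasure_point_measure_finite less_top[symmetric])
  thus r: "discrete_measure \<Omega> Y v \<in> radon_measures \<Omega>"
    unfolding radon_measures_def discrete_measure_def using finite_measure.finite_measure_distr[OF _ m] by auto
  show i: "(LINT y|discrete_measure \<Omega> Y v. f y) = (\<Sum>y\<in>Y. v y * f y)"
    if "f \<in> borel_measurable (restrict_space borel \<Omega>)" for f :: "'a \<Rightarrow> real"
    unfolding discrete_measure_def using that Y v
    by (subst integral_distr) (auto simp: lebesgue_integral_point_measure_finite space_restrict_space)
  show "measure (discrete_measure \<Omega> Y v) \<Omega> = (\<Sum>y\<in>Y. v y)"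
    using i[of "\<lambda>_. 1"] radon_measuresD(3)[OF r] by simp
qed

definition cos_kernel :: "real \<Rightarrow> 'a::euclidean_space \<Rightarrow> 'a \<Rightarrow> real" where
  "cos_kernel \<kappa> x y = (Cos (norm (x - y) / \<kappa>))\<^sup>2"

lemma cos_kernel_bounds: "0 \<le> cos_kernel \<kappa> x y" "cos_kernel \<kappa> x y \<le> 1"
  by (auto simp: cos_kernel_def Cos_sq_le_1)

lemma continuous_on_cos_kernel [continuous_intros]:
  assumes "continuous_on A f" "continuous_on A g"
  shows "continuous_on A (\<lambda>z. cos_kernel \<kappa> (f z) (g z))"
  unfolding cos_kernel_def divide_inverse using assms by (intro continuous_intros)

text \<open>With \<open>max\<close> instead of \<open>lse\<close> this would be the least \<open>p\<close> with \<open>p x * q y \<ge> cos_kernel \<kappa> x y\<close> for all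
  \<open>y \<in> Y\<close>. Thus \<open>p\<close> and \<open>q\<close> stand for \<open>1 - \<psi>\<close> and \<open>1 - \<phi>\<close> in the constraint of \<open>Q_set\<close>.\<close>

definition soft_potential :: "real \<Rightarrow> real \<Rightarrow> 'a::euclidean_space set \<Rightarrow> ('a \<Rightarrow> real) \<Rightarrow> 'a \<Rightarrow> real" where
  "soft_potential \<kappa> N Y q x = lse N Y (\<lambda>y. cos_kernel \<kappa> x y / q y)"

lemma continuous_on_soft_potential:
  assumes "finite Y" "Y \<noteq> {}" "\<And>y. y \<in> Y \<Longrightarrow> q y \<noteq> 0"
  shows "continuous_on A (soft_potential \<kappa> N Y q)"
  unfolding soft_potential_def[abs_def] using assms by (intro continuous_on_lse continuous_intros) auto

lemma abs_divide_diff_le: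
  assumes "0 < l" "l \<le> s" "l \<le> t" "0 \<le> k" "k \<le> (1::real)"
  shows "\<bar>k / s - k / t\<bar> \<le> \<bar>s - t\<bar> / l\<^sup>2"
proof -
  have "k / s - k / t = k * (t - s) / (s * t)"
    using assms by (simp add: field_simps)
  hence "\<bar>k / s - k / t\<bar> = k * \<bar>s - t\<bar> / (s * t)"
    using assms by (simp add: abs_mult abs_minus_commute)
  also have "\<dots> \<le> 1 * \<bar>s - t\<bar> / (l * l)"
    using assms by (intro frac_le mult_mono) auto
  finally show ?thesis by (simp add: power2_eq_square)
qed

lemma soft_potential_lipschitz:
  assumes "0 < N" "finite Y" "Y \<noteq> {}" "0 < l" "\<And>y. y \<in> Y \<Longrightarrow> l \<le> q y" "\<And>y. y \<in> Y \<Longrightarrow> l \<le> q' y"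
  shows "\<bar>soft_potential \<kappa> N Y q x - soft_potential \<kappa> N Y q' x\<bar> \<le> (\<Sum>y\<in>Y. \<bar>q y - q' y\<bar>) / l\<^sup>2"
  unfolding soft_potential_def
proof (rule lse_lipschitz[OF assms(1-3)])
  fix y assume y: "y \<in> Y"
  have "\<bar>cos_kernel \<kappa> x y / q y - cos_kernel \<kappa> x y / q' y\<bar> \<le> \<bar>q y - q' y\<bar> / l\<^sup>2"
    using assms(4) assms(5,6)[OF y] by (intro abs_divide_diff_le cos_kernel_bounds)
  also have "\<dots> \<le> (\<Sum>y\<in>Y. \<bar>q y - q' y\<bar>) / l\<^sup>2"
    using assms y by (intro divide_right_mono member_le_sum) auto
  finally show "\<bar>cos_kernel \<kappa> x y / q y - cos_kernel \<kappa> x y / q' y\<bar> \<le> (\<Sum>y\<in>Y. \<bar>q y - q' y\<bar>) / l\<^sup>2" .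
qed

text \<open>\<open>q\<close> maximises the smoothed dual functional over a box. By the first-order conditions, the
  derivatives of the potential with respect to \<open>q y\<close> provide the density \<open>b\<close> of a competitor in
  \<open>HK2_le\<close>.\<close>

lemma semidiscrete_duality:
  fixes \<Omega> :: "'a::euclidean_space set"
  assumes \<Omega>: "compact \<Omega>" and \<kappa>: "0 < \<kappa>"
    and Y: "finite Y" "Y \<noteq> {}" "Y \<subseteq> \<Omega>"
    and cover: "\<And>x. x \<in> \<Omega> \<Longrightarrow> \<exists>y\<in>Y. 0 < cos_kernel \<kappa> x y"
    and \<mu>: "\<mu> \<in> radon_measures \<Omega>" and M: "measure \<mu> \<Omega> \<le> M"
    and v: "\<And>y. y \<in> Y \<Longrightarrow> \<eta> \<le> v y" and \<eta>: "0 < \<eta>"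
    and N: "0 < N" and l: "0 < l" "l \<le> R" and R: "M < \<eta> * R\<^sup>2"
  obtains q where "\<forall>y\<in>Y. q y \<in> {l..R}"
    "HK2 \<kappa> \<Omega> \<mu> (discrete_measure \<Omega> Y v) \<le> ennreal ((LINT x|\<mu>. 1 - soft_potential \<kappa> N Y q x)
      + (\<Sum>y\<in>Y. v y * (1 - q y)) + l * (\<Sum>y\<in>Y. v y) + M * ln (card Y) / N)"
proof -
  interpret finite_measure \<mu> using \<mu> by (rule radon_measuresD)
  note sp = radon_measuresD(3)[OF \<mu>]
  define p where "p q x = soft_potential \<kappa> N Y q x" for q x
  define w where "w q x y = cos_kernel \<kappa> x y / q y" for q and x y :: 'a
  define ch where "ch q x y = softmax N Y (w q x) y" for q x y
  have p: "p q x = lse N Y (w q x)" for q x by (simp add: p_def soft_potential_def w_def[abs_def])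
  have ip: "integrable \<mu> (p q)" if "\<forall>y\<in>Y. 0 < q y" for q
    unfolding p_def[abs_def] using that Y
    by (intro radon_integrable_continuous[OF \<mu> _ \<Omega>] continuous_on_soft_potential) force+
  \<comment> \<open>Minimising \<open>F\<close> means maximising the dual value, which equals
    \<open>measure \<mu> \<Omega> + (\<Sum>y\<in>Y. v y) - F q\<close>.\<close>
  define F where "F q = (LINT x|\<mu>. p q x) + (\<Sum>y\<in>Y. v y * q y)" for q
  have lip: "\<bar>F q - F q'\<bar> \<le> (measure \<mu> \<Omega> / l\<^sup>2 + (\<Sum>y\<in>Y. \<bar>v y\<bar>)) * (\<Sum>y\<in>Y. \<bar>q y - q' y\<bar>)"
    if q: "\<forall>y\<in>Y. q y \<in> {l..R}" "\<forall>y\<in>Y. q' y \<in> {l..R}" for q q'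
  proof -
    let ?d = "\<Sum>y\<in>Y. \<bar>q y - q' y\<bar>"
    have pos: "\<forall>y\<in>Y. 0 < q y" "\<forall>y\<in>Y. 0 < q' y" using q l by force+
    have "\<bar>(LINT x|\<mu>. p q x) - (LINT x|\<mu>. p q' x)\<bar> = \<bar>LINT x|\<mu>. p q x - p q' x\<bar>"
      using ip pos by simp
    also have "\<dots> \<le> (LINT x|\<mu>. \<bar>p q x - p q' x\<bar>)"
      using integral_norm_bound[of \<mu> "\<lambda>x. p q x - p q' x"] by simp
    also have "\<dots> \<le> (LINT x|\<mu>. ?d / l\<^sup>2)"
      unfolding p_def using ip[OF pos(1)] ip[OF pos(2)] q l Y N
      by (intro integral_mono soft_potential_lipschitz) (auto simp: p_def[abs_def])
    also have "\<dots> = measure \<mu> \<Omega> / l\<^sup>2 * ?d" using sp by simp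
    finally have 1: "\<bar>(LINT x|\<mu>. p q x) - (LINT x|\<mu>. p q' x)\<bar> \<le> measure \<mu> \<Omega> / l\<^sup>2 * ?d" .
    have "(\<Sum>y\<in>Y. v y * q y) - (\<Sum>y\<in>Y. v y * q' y) = (\<Sum>y\<in>Y. v y * (q y - q' y))"
      by (simp add: sum_subtractf right_diff_distrib)
    also have "\<bar>\<dots>\<bar> \<le> (\<Sum>y\<in>Y. \<bar>v y\<bar> * \<bar>q y - q' y\<bar>)"
      using sum_abs[of "\<lambda>y. v y * (q y - q' y)" Y] by (simp add: abs_mult)
    also have "\<dots> \<le> (\<Sum>y\<in>Y. \<bar>v y\<bar> * ?d)"
      using Y by (intro sum_mono mult_left_mono member_le_sum) auto
    also have "\<dots> = (\<Sum>y\<in>Y. \<bar>v y\<bar>) * ?d" by (simp add: sum_distrib_right)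
    finally have 2: "\<bar>(\<Sum>y\<in>Y. v y * q y) - (\<Sum>y\<in>Y. v y * q' y)\<bar> \<le> (\<Sum>y\<in>Y. \<bar>v y\<bar>) * ?d" .
    show ?thesis using 1 2 by (simp add: F_def algebra_simps)
  qed
  obtain q where q: "\<forall>y\<in>Y. q y \<in> {l..R}" and min: "\<And>q'. \<forall>y\<in>Y. q' y \<in> {l..R} \<Longrightarrow> F q \<le> F q'"
  proof (rule box_minimiser[OF Y(1) l(2) lip])
    fix u assume "\<forall>y\<in>Y. u y \<in> {l..R}" "\<And>v. \<forall>y\<in>Y. v y \<in> {l..R} \<Longrightarrow> F u \<le> F v"
    thus thesis by (rule that)
  qed
  have qpos: "0 < q y" if "y \<in> Y" for y using q l that by force
  have vpos: "0 < v y" if "y \<in> Y" for y using v[OF that] \<eta> by simp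
  have cw: "continuous_on A (\<lambda>x. w q x y)" if "y \<in> Y" for y A
    unfolding w_def using qpos[OF that] by (intro continuous_intros) auto
  have cch: "continuous_on A (\<lambda>x. ch q x y)" if "y \<in> Y" for y A
    unfolding ch_def using cw Y that by (intro continuous_on_softmax) auto
  have w0: "0 \<le> w q x y" "w q x y \<le> 1 / q y" if "y \<in> Y" for x y
    using qpos[OF that] cos_kernel_bounds[of \<kappa> x y] by (auto simp: w_def divide_right_mono)
  have ch01: "0 \<le> ch q x y" "ch q x y \<le> 1" if "y \<in> Y" for x y
    using softmax_nonneg softmax_le_1[OF Y(1) that] by (auto simp: ch_def)
  \<comment> \<open>Minus the derivative of \<open>p q x\<close> in the variable \<open>q y\<close>:
    the softmax weight times \<open>w / q\<close>, because
    \<open>cos_kernel \<kappa> x y / q y\<close> has derivative \<open>- w / q\<close> in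
    \<open>q y\<close>.\<close>
  define \<beta> where "\<beta> x y = ch q x y * w q x y / q y" for x y
  have c\<beta>: "continuous_on A (\<lambda>x. \<beta> x y)" if "y \<in> Y" for y A
    unfolding \<beta>_def using cw cch qpos that by (intro continuous_intros) force+
  have \<beta>0: "0 \<le> \<beta> x y" if "y \<in> Y" for x y
    using w0 ch01 qpos that by (auto simp: \<beta>_def less_imp_le)
  have \<beta>le: "\<beta> x y \<le> 1 / (q y)\<^sup>2" if "y \<in> Y" for x y
  proof -
    have "ch q x y * w q x y \<le> 1 * (1 / q y)"
      using w0 ch01 that by (intro mult_mono) auto
    hence "ch q x y * w q x y / q y \<le> (1 / q y) / q y"
      using qpos[OF that] by (intro divide_right_mono) auto
    thus ?thesis by (simp add: \<beta>_def power2_eq_square)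
  qed
  have i\<beta>: "integrable \<mu> (\<lambda>x. \<beta> x y)" if "y \<in> Y" for y
    using that by (intro radon_integrable_continuous[OF \<mu> _ \<Omega>] c\<beta>)
  define B where "B y = (LINT x|\<mu>. \<beta> x y)" for y
  have der: "((\<lambda>t. F (q(j := t))) has_real_derivative (v j - B j)) (at (q j))" if j: "j \<in> Y" for j
  proof -
    have "((\<lambda>t. LINT x|\<mu>. p (q(j := t)) x) has_real_derivative (LINT x|\<mu>. - \<beta> x j)) (at (q j))"
    \<comment> \<open>While \<open>t\<close> stays within \<open>q j / 2\<close> of
      \<open>q j\<close>, all values of \<open>q(j := t)\<close> on \<open>Y\<close> are at least
      half the minimum of \<open>q\<close>; the Lipschitz constant is the inverse square of that
      half.\<close>
    proof (rule DERIV_integral[where d = "q j / 2" and L = "4 / (Min (q ` Y))\<^sup>2"])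
      fix t assume t: "\<bar>t - q j\<bar> < q j / 2"
      hence tp: "t > q j / 2" by (simp add: abs_if split: if_splits)
      hence pos: "\<forall>y\<in>Y. 0 < (q(j := t)) y" using qpos j by auto (smt (verit) qpos field_sum_of_halves)
      show "integrable \<mu> (p (q(j := t)))" by (rule ip[OF pos])
      fix x
      let ?m = "Min (q ` Y)"
      have m: "?m > 0" using Y qpos by (subst Min_gr_iff) auto
      have mle: "?m \<le> q y" if "y \<in> Y" for y using Y that by (intro Min_le) auto
      have "\<bar>p (q(j := t)) x - p q x\<bar> \<le> (\<Sum>y\<in>Y. \<bar>(q(j := t)) y - q y\<bar>) / (?m / 2)\<^sup>2"
        unfolding p_def
      proof (intro soft_potential_lipschitz)
        fix y assume y: "y \<in> Y"
        show "?m / 2 \<le> q y" using mle[OF y] m by simp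
        show "?m / 2 \<le> (q(j := t)) y" using mle[OF y] mle[OF j] m tp by auto
      qed (use Y N m in auto)
      also have "(\<Sum>y\<in>Y. \<bar>(q(j := t)) y - q y\<bar>) = (\<Sum>y\<in>Y. if y = j then \<bar>t - q j\<bar> else 0)"
        by (intro sum.cong) auto
      also have "\<dots> = \<bar>t - q j\<bar>" using Y j by simp
      also have "\<bar>t - q j\<bar> / (?m / 2)\<^sup>2 = 4 / ?m\<^sup>2 * \<bar>t - q j\<bar>"
        by (simp add: power_divide)
      finally show "\<bar>p (q(j := t)) x - p (q(j := q j)) x\<bar> \<le> 4 / ?m\<^sup>2 * \<bar>t - q j\<bar>" by (simp add: fun_upd_def)
    next
      fix x
      have "((\<lambda>t. w (q(j := t)) x y) has_real_derivative (if y = j then - (w q x j / q j) else 0)) (at (q j))" for y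
      proof (cases "y = j")
        case True
        have "((\<lambda>t. cos_kernel \<kappa> x j / t) has_real_derivative - (w q x j / q j)) (at (q j))"
          using qpos[OF j] by (auto intro!: derivative_eq_intros simp: w_def power2_eq_square)
        thus ?thesis using True by (simp add: w_def)
      qed (simp add: w_def)
      hence "((\<lambda>t. lse N Y (w (q(j := t)) x)) has_real_derivative
         (\<Sum>y\<in>Y. softmax N Y (w (q(j := q j)) x) y * (if y = j then - (w q x j / q j) else 0))) (at (q j))"
        using N Y by (intro DERIV_lse) auto
      also have "(\<Sum>y\<in>Y. softmax N Y (w (q(j := q j)) x) y * (if y = j then - (w q x j / q j) else 0))
        = (\<Sum>y\<in>Y. if y = j then - \<beta> x j else 0)"
        by (intro sum.cong) (auto simp: \<beta>_def ch_def)
      also have "\<dots> = - \<beta> x j" using Y j by simp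
      finally show "((\<lambda>t. p (q(j := t)) x) has_real_derivative - \<beta> x j) (at (q j))" by (simp add: p fun_upd_def)
    qed (use qpos[OF j] in auto)
    moreover have "((\<lambda>t. \<Sum>y\<in>Y. v y * (q(j := t)) y) has_real_derivative (\<Sum>y\<in>Y. if y = j then v j else 0)) (at (q j))"
      by (intro DERIV_sum) (auto intro!: derivative_eq_intros)
    ultimately have "((\<lambda>t. F (q(j := t))) has_real_derivative ((LINT x|\<mu>. - \<beta> x j) + (\<Sum>y\<in>Y. if y = j then v j else 0))) (at (q j))"
      unfolding F_def by (rule DERIV_add)
    thus ?thesis using Y j by (simp add: B_def)
  qed
  \<comment> \<open>On the upper face the first-order condition points the wrong way. There
    \<open>\<beta> \<le> 1 / R\<^sup>2\<close> gives
    \<open>B y \<le> M / R\<^sup>2 \<le> \<eta>\<close> instead, which dictates the size of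
    \<open>R\<close>.\<close>
  have Bv: "B y \<le> v y" if y: "y \<in> Y" for y
  proof (cases "q y < R")
    case True
    thus ?thesis using box_minimiser_KKT(1)[OF q min der[OF y] y] by simp
  next
    case False
    hence qR: "q y = R" using q y by force
    have "B y \<le> (LINT x|\<mu>. 1 / R\<^sup>2)"
      unfolding B_def using i\<beta>[OF y] \<beta>le[OF y] qR by (intro integral_mono) auto
    also have "\<dots> = measure \<mu> \<Omega> / R\<^sup>2" using sp by simp
    also have "\<dots> \<le> M / R\<^sup>2" using M by (intro divide_right_mono) auto
    also have "\<dots> \<le> \<eta>" using R l by (simp add: field_simps)
    finally show ?thesis using v[OF y] by simp
  qed
  \<comment> \<open>One half of complementary slackness; the lower face contributes a defect of at
    most \<open>l * v y\<close>, since \<open>B y\<close> is nonnegative.\<close>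
  have slack: "(v y - B y) * q y \<le> l * v y" if y: "y \<in> Y" for y
  proof (cases "l < q y")
    case True
    hence "v y - B y \<le> 0" using box_minimiser_KKT(2)[OF q min der[OF y] y] by simp
    hence "(v y - B y) * q y \<le> 0" using qpos[OF y] by (simp add: mult_le_0_iff)
    also have "0 \<le> l * v y" using l vpos[OF y] by simp
    finally show ?thesis .
  next
    case False
    hence ql: "q y = l" using q y by force
    have "0 \<le> B y" unfolding B_def using \<beta>0[OF y] by simp
    thus ?thesis using l by (simp add: ql mult.commute mult_left_mono)
  qed
  let ?D = "discrete_measure \<Omega> Y v"
  have D: "?D \<in> radon_measures \<Omega>" using Y vpos by (intro discrete_measure_radon) (auto simp: less_imp_le)
  have intD: "(LINT y|?D. f y) = (\<Sum>y\<in>Y. v y * f y)"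
    if "f \<in> borel_measurable (restrict_space borel \<Omega>)" for f :: "'a \<Rightarrow> real"
    using that Y vpos by (intro integral_discrete_measure) (auto simp: less_imp_le)
  \<comment> \<open>The factor \<open>1 / v j\<close> turns \<open>B j \<le> v j\<close> into the
    bound 1 that \<open>HK2_le\<close> requires; the sum over indicators makes \<open>b\<close>
    jointly measurable.\<close>
  define b where "b x y = (\<Sum>j\<in>Y. indicator {j} y * (\<beta> x j / v j))" for x y
  have bY: "b x y = \<beta> x y / v y" if "y \<in> Y" for x y
  proof -
    have "b x y = (\<Sum>j\<in>Y. if j = y then \<beta> x y / v y else 0)"
      unfolding b_def by (intro sum.cong) (auto simp: indicator_def)
    thus ?thesis using Y that by simp
  qed
  have b0: "b x y = 0" if "y \<notin> Y" for x y
    unfolding b_def using that by (intro sum.neutral) (auto simp: indicator_def)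
  have sets1: "{j} \<in> sets (restrict_space borel \<Omega>)" if "j \<in> Y" for j
    using that Y by (auto simp: sets_restrict_space intro!: image_eqI[of _ _ "{j}"])
  \<comment> \<open>\<open>\<beta> x y * cos_kernel \<kappa> x y = ch q x y * (w q x
    y)\<^sup>2\<close>, so \<open>S x\<close> is the second moment of \<open>w q x\<close> under the
    softmax weights. It is compared below with the square of the mean \<open>pm x\<close>.\<close>
  define S where "S x = (\<Sum>y\<in>Y. ch q x y * (w q x y)\<^sup>2)" for x
  have S: "S x = (LINT y|?D. b x y * (Cos (norm (x - y) / \<kappa>))\<^sup>2)" for x
  proof -
    have "(\<lambda>y. cos_kernel \<kappa> x y) \<in> borel_measurable (restrict_space borel \<Omega>)"
      by (intro borel_measurable_continuous_on_restrict continuous_intros)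
    hence m: "(\<lambda>y. b x y * cos_kernel \<kappa> x y) \<in> borel_measurable (restrict_space borel \<Omega>)"
      unfolding b_def using sets1 by (intro borel_measurable_times borel_measurable_sum borel_measurable_indicator) auto
    have "(LINT y|?D. b x y * cos_kernel \<kappa> x y) = (\<Sum>y\<in>Y. v y * (b x y * cos_kernel \<kappa> x y))"
      by (rule intD[OF m])
    also have "\<dots> = S x"
      unfolding S_def
    proof (intro sum.cong refl)
      fix y assume y: "y \<in> Y"
      thus "v y * (b x y * cos_kernel \<kappa> x y) = ch q x y * (w q x y)\<^sup>2"
        using vpos[OF y] qpos[OF y] by (simp add: bY \<beta>_def w_def power2_eq_square)
    qed
    finally show ?thesis by (simp add: cos_kernel_def)
  qed
  have cS: "continuous_on \<Omega> S"
    unfolding S_def[abs_def] using cch cw by (intro continuous_intros) auto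
  \<comment> \<open>The covering condition enters here. With compactness it yields a positive lower
    bound of \<open>S\<close>, which keeps the density of the plan in \<open>HK2_le\<close>
    bounded.\<close>
  have Spos: "0 < S x" if x: "x \<in> \<Omega>" for x
  proof -
    obtain y where y: "y \<in> Y" "0 < cos_kernel \<kappa> x y" using cover[OF x] by auto
    have "0 < ch q x y" unfolding ch_def using Y by (intro softmax_pos) auto
    hence "0 < ch q x y * (w q x y)\<^sup>2" using y qpos[OF y(1)] by (auto simp: w_def)
    also have "\<dots> \<le> S x"
      unfolding S_def using y Y ch01 by (intro member_le_sum) auto
    finally show ?thesis .
  qed
  obtain s0 where s0: "0 < s0" "\<And>x. x \<in> \<Omega> \<Longrightarrow> s0 \<le> S x"
  proof -
    have "\<Omega> \<noteq> {}" using Y by auto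
    from continuous_attains_inf[OF \<Omega> this cS] obtain x where "x \<in> \<Omega>" "\<And>y. y \<in> \<Omega> \<Longrightarrow> S x \<le> S y" by blast
    thus ?thesis using that Spos by blast
  qed
  define Bmax where "Bmax = (\<Sum>y\<in>Y. 1 / (q y)\<^sup>2 / v y)"
  have hk: "HK2 \<kappa> \<Omega> \<mu> ?D \<le> ennreal (measure \<mu> \<Omega> + measure ?D \<Omega> - 2 * (LINT x|\<mu>. sqrt (S x)))"
  proof (rule HK2_le[OF \<kappa> \<mu> D, where b = b and B = Bmax and ?s0.0 = s0])
    show "case_prod b \<in> borel_measurable (\<mu> \<Otimes>\<^sub>M ?D)"
    proof -
      have "(\<lambda>x. \<beta> x j / v j) \<in> borel_measurable \<mu>" if "j \<in> Y" for j
        using i\<beta>[OF that] by measurable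
      moreover have "{j} \<in> sets ?D" if "j \<in> Y" for j
        using sets1[OF that] radon_measuresD(1)[OF D] by simp
      ultimately show ?thesis
        unfolding b_def case_prod_beta' by (intro borel_measurable_sum borel_measurable_times) 
          (auto intro: measurable_compose[OF measurable_fst] measurable_compose[OF measurable_snd] borel_measurable_indicator)
    qed
    show "0 \<le> b x y" for x y
      using \<beta>0[of y x] vpos[of y] by (cases "y \<in> Y") (auto simp: bY b0)
    show "b x y \<le> Bmax" for x y
    proof (cases "y \<in> Y")
      case True
      have "\<beta> x y / v y \<le> 1 / (q y)\<^sup>2 / v y" using \<beta>le[OF True] vpos[OF True] by (intro divide_right_mono) auto
      also have "\<dots> \<le> Bmax" unfolding Bmax_def using True Y vpos 
        by (intro member_le_sum[of y Y "\<lambda>y. 1 / (q y)\<^sup>2 / v y"]) (auto simp: less_imp_le)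
      finally show ?thesis using True by (simp add: bY)
    qed (auto simp: b0 Bmax_def less_imp_le[OF vpos] intro!: sum_nonneg)
    show "(LINT x|\<mu>. b x y) \<le> 1" if "y \<in> \<Omega>" for y
    proof (cases "y \<in> Y")
      case True
      have "(LINT x|\<mu>. b x y) = B y / v y" using True by (simp add: bY B_def)
      thus ?thesis using Bv[OF True] vpos[OF True] by simp
    qed (simp add: b0)
  qed (use S s0 in auto)
  define pm where "pm x = (\<Sum>y\<in>Y. ch q x y * w q x y)" for x
  \<comment> \<open>The variance of \<open>w q x\<close> under the softmax weights is
    nonnegative.\<close>
  have pmS: "pm x \<le> sqrt (S x)" for x
  proof -
    have ch1: "(\<Sum>y\<in>Y. ch q x y) = 1" unfolding ch_def using Y by (intro sum_softmax) auto
    have "0 \<le> (\<Sum>y\<in>Y. ch q x y * (w q x y - pm x)\<^sup>2)"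
      using ch01 by (intro sum_nonneg) auto
    also have "\<dots> = (\<Sum>y\<in>Y. ch q x y * (w q x y)\<^sup>2 - 2 * pm x * (ch q x y * w q x y) + (pm x)\<^sup>2 * ch q x y)"
      by (intro sum.cong) (auto simp: power2_eq_square algebra_simps)
    also have "\<dots> = S x - 2 * pm x * pm x + (pm x)\<^sup>2"
      by (simp add: sum.distrib sum_subtractf S_def pm_def ch1 flip: sum_distrib_left)
    finally have "(pm x)\<^sup>2 \<le> S x" by (simp add: power2_eq_square)
    thus ?thesis by (rule real_le_rsqrt)
  qed
  have ppm: "p q x \<le> pm x + ln (card Y) / N" for x
    unfolding p pm_def ch_def using N Y by (intro lse_le_softmax_mean)
  have ipm: "integrable \<mu> pm"
    unfolding pm_def[abs_def] using cch cw by (intro radon_integrable_continuous[OF \<mu> _ \<Omega>] continuous_intros) auto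
  have iS: "integrable \<mu> (\<lambda>x. sqrt (S x))"
    using cS by (intro radon_integrable_continuous[OF \<mu> _ \<Omega>] continuous_intros) auto
  have 1: "(LINT x|\<mu>. pm x) \<le> (LINT x|\<mu>. sqrt (S x))"
    using pmS ipm iS by (intro integral_mono) auto
  have "(LINT x|\<mu>. p q x) \<le> (LINT x|\<mu>. pm x + ln (card Y) / N)"
    using ppm ipm ip qpos by (intro integral_mono) auto
  also have "\<dots> = (LINT x|\<mu>. pm x) + measure \<mu> \<Omega> * (ln (card Y) / N)"
    using ipm sp by simp
  also have "measure \<mu> \<Omega> * (ln (card Y) / N) \<le> M * (ln (card Y) / N)"
    using M N Y by (intro mult_right_mono) (auto simp: Suc_le_eq card_gt_0_iff)
  finally have 2: "(LINT x|\<mu>. p q x) \<le> (LINT x|\<mu>. pm x) + M * ln (card Y) / N" by simp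
  have "(LINT x|\<mu>. pm x) = (LINT x|\<mu>. (\<Sum>y\<in>Y. \<beta> x y * q y))"
    unfolding pm_def \<beta>_def using qpos by (intro Bochner_Integration.integral_cong sum.cong) (auto simp: less_imp_neq[symmetric])
  also have "\<dots> = (\<Sum>y\<in>Y. B y * q y)"
    using i\<beta> by (subst Bochner_Integration.integral_sum) (auto simp: B_def)
  finally have 3: "(LINT x|\<mu>. pm x) = (\<Sum>y\<in>Y. B y * q y)" .
  have "(\<Sum>y\<in>Y. v y * q y) - (\<Sum>y\<in>Y. B y * q y) = (\<Sum>y\<in>Y. (v y - B y) * q y)"
    by (simp add: sum_subtractf left_diff_distrib)
  also have "\<dots> \<le> (\<Sum>y\<in>Y. l * v y)" by (intro sum_mono slack)
  finally have 4: "(\<Sum>y\<in>Y. v y * q y) - (\<Sum>y\<in>Y. B y * q y) \<le> l * (\<Sum>y\<in>Y. v y)"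
    by (simp add: sum_distrib_left)
  have 5: "(LINT x|\<mu>. 1 - p q x) = measure \<mu> \<Omega> - (LINT x|\<mu>. p q x)"
    using ip qpos sp by simp
  have 6: "(\<Sum>y\<in>Y. v y * (1 - q y)) = (\<Sum>y\<in>Y. v y) - (\<Sum>y\<in>Y. v y * q y)"
    by (simp add: sum_subtractf right_diff_distrib)
  have 7: "measure ?D \<Omega> = (\<Sum>y\<in>Y. v y)"
    using Y vpos by (intro measure_discrete_measure) (auto simp: less_imp_le)
  \<comment> \<open>Up to the two error terms, \<open>LINT x|\<mu>. p q x\<close> and the sum of
    \<open>v y * q y\<close> are both at most \<open>LINT x|\<mu>. pm x\<close>; this accounts for
    the factor 2.\<close>
  have "measure \<mu> \<Omega> + measure ?D \<Omega> - 2 * (LINT x|\<mu>. sqrt (S x)) \<le> (LINT x|\<mu>. 1 - p q x)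
      + (\<Sum>y\<in>Y. v y * (1 - q y)) + l * (\<Sum>y\<in>Y. v y) + M * ln (card Y) / N"
    using 1 2 3 4 5 6 7 by linarith
  from order_trans[OF hk ennreal_leI[OF this]] q show thesis
    unfolding p_def using that by blast
qed

section \<open>Minimisation over the barycentre\<close>

text \<open>The dual functional at \<open>1 - soft_potential\<close> and \<open>1 - q\<close>, with
  \<open>discrete_measure \<Omega> Y v\<close> as the second measure. For fixed positive
  \<open>q\<close> it is weak-star continuous in \<open>\<mu>\<close>.\<close>

definition dual_value ::
  "real \<Rightarrow> real \<Rightarrow> 'a::euclidean_space set \<Rightarrow> ('a \<Rightarrow> real) \<Rightarrow> 'a measure \<Rightarrow> ('a \<Rightarrow> real) \<Rightarrow> real" where
  "dual_value \<kappa> N Y v \<mu> q = (LINT x|\<mu>. 1 - soft_potential \<kappa> N Y q x) + (\<Sum>y\<in>Y. v y * (1 - q y))"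

lemma soft_potential_antimono:
  assumes "0 < N" "finite Y" "Y \<noteq> {}" "\<And>y. y \<in> Y \<Longrightarrow> 0 < q y" "\<And>y. y \<in> Y \<Longrightarrow> q y \<le> q' y"
  shows "soft_potential \<kappa> N Y q' x \<le> soft_potential \<kappa> N Y q x"
  unfolding soft_potential_def
proof (intro lse_mono divide_left_mono cos_kernel_bounds)
  fix y assume "y \<in> Y"
  hence "0 < q y" "0 < q' y" using assms(4,5)[of y] by (auto intro: less_le_trans)
  thus "0 < q' y * q y" by simp
qed (use assms in auto)

text \<open>Rounding a good \<open>q\<close> up to a grid of mesh \<open>l\<close> lowers the soft
  potential, which helps, and costs at most \<open>l\<close> times the total weight in the other
  term. The grid depends on neither \<open>\<mu>\<close> nor \<open>v\<close>.\<close>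

lemma finite_dual_net:
  fixes \<Omega> :: "'a::euclidean_space set"
  assumes \<Omega>: "compact \<Omega>" and \<kappa>: "0 < \<kappa>"
    and Y: "finite Y" "Y \<noteq> {}" "Y \<subseteq> \<Omega>"
    and cover: "\<And>x. x \<in> \<Omega> \<Longrightarrow> \<exists>y\<in>Y. 0 < cos_kernel \<kappa> x y"
    and \<eta>: "0 < \<eta>" and R: "\<eta> \<le> R" and N: "0 < N" and M: "0 < M" and e: "0 < e"
  obtains G where "finite G" "\<And>q y. q \<in> G \<Longrightarrow> y \<in> Y \<Longrightarrow> 0 < q y" "(\<lambda>_. 1) \<in> G" "(\<lambda>_. 1 / 2) \<in> G"
    "\<And>\<mu> v. \<mu> \<in> radon_measures \<Omega> \<Longrightarrow> measure \<mu> \<Omega> \<le> M \<Longrightarrow> \<forall>y\<in>Y. v y \<in> {\<eta>..R} \<Longrightarrow>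
       \<exists>q\<in>G. HK2 \<kappa> \<Omega> \<mu> (discrete_measure \<Omega> Y v)
         \<le> ennreal (dual_value \<kappa> N Y v \<mu> q + e + M * ln (card Y) / N)"
proof -
  define J where "J = real (card Y)"
  have J: "J > 0" using Y by (simp add: J_def card_gt_0_iff)
  have Rp: "R > 0" using \<eta> R by simp
  \<comment> \<open>The error \<open>l * (\<Sum>y\<in>Y. v y)\<close> arises twice, in
    \<open>semidiscrete_duality\<close> and in the rounding, and the sum of the weights is at most
    \<open>J * R\<close>.\<close>
  define l where "l = e / (2 * J * R)"
  have l: "l > 0" using e J Rp by (simp add: l_def)
  \<comment> \<open>\<open>M / \<eta> + 1\<close> gives both \<open>M < \<eta> * R'\<close> and
    \<open>1 \<le> R'\<close>, hence \<open>M < \<eta> * R'\<^sup>2\<close>; the summand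
    \<open>l\<close> ensures \<open>l \<le> R'\<close>.\<close>
  define R' where "R' = M / \<eta> + 1 + l"
  have R': "l \<le> R'" "M < \<eta> * R'\<^sup>2"
  proof -
    show "l \<le> R'" using M \<eta> by (simp add: R'_def)
    have R1: "R' \<ge> 1" using M \<eta> l by (simp add: R'_def)
    have "M < \<eta> * R'" using M \<eta> l by (simp add: R'_def algebra_simps add_pos_pos)
    also have "\<dots> \<le> \<eta> * R'\<^sup>2" using R1 \<eta> by (simp add: power2_eq_square)
    finally show "M < \<eta> * R'\<^sup>2" .
  qed
  define K where "K = nat \<lceil>(R' - l) / l\<rceil>"
  define S where "S = (\<lambda>k. l + real k * l) ` {..K}"
  have "finite S" by (simp add: S_def)
  \<comment> \<open>The two constants serve later estimates. At 1 the weights drop out of the dual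
    value, which bounds the soft maximum from below; at 1/2 the value grows with the weights, which
    keeps the outer minimiser away from large ones.\<close>
  define G where "G = {\<lambda>_. 1, \<lambda>_. 1 / 2} \<union> PiE Y (\<lambda>_. S)"
  show thesis
  proof
    show "finite G" using \<open>finite S\<close> Y by (auto simp: G_def intro: finite_PiE)
    show "0 < q y" if "q \<in> G" "y \<in> Y" for q y
      using that l by (auto simp: G_def S_def dest!: PiE_mem[where x = y] intro!: add_pos_nonneg)
    show "(\<lambda>_. 1) \<in> G" "(\<lambda>_. 1 / 2) \<in> G" by (auto simp: G_def)
    fix \<mu> :: "'a measure" and v
    assume \<mu>: "\<mu> \<in> radon_measures \<Omega>" "measure \<mu> \<Omega> \<le> M" and v: "\<forall>y\<in>Y. v y \<in> {\<eta>..R}"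
    interpret finite_measure \<mu> using \<mu>(1) by (rule radon_measuresD)
    obtain q where q: "\<forall>y\<in>Y. q y \<in> {l..R'}" and
      hk: "HK2 \<kappa> \<Omega> \<mu> (discrete_measure \<Omega> Y v) \<le> ennreal ((LINT x|\<mu>. 1 - soft_potential \<kappa> N Y q x)
      + (\<Sum>y\<in>Y. v y * (1 - q y)) + l * (\<Sum>y\<in>Y. v y) + M * ln (card Y) / N)"
      using semidiscrete_duality[OF \<Omega> \<kappa> Y cover \<mu>, of \<eta> v N l R'] v \<eta> N l R' by auto
    define k where "k y = nat \<lceil>(q y - l) / l\<rceil>" for y
    define q' where "q' = (\<lambda>y\<in>Y. l + real (k y) * l)"
    have kK: "k y \<le> K" if "y \<in> Y" for y
      unfolding k_def K_def using q that l by (intro nat_mono ceiling_mono divide_right_mono) auto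
    hence q'G: "q' \<in> G" by (auto simp: G_def q'_def S_def)
    have qq': "q y \<le> q' y" "q' y \<le> q y + l" if y: "y \<in> Y" for y
    proof -
      have "0 \<le> (q y - l) / l" using q y l by force
      hence "real (k y) = of_int \<lceil>(q y - l) / l\<rceil>" by (simp add: k_def)
      hence "(q y - l) / l \<le> real (k y)" "real (k y) \<le> (q y - l) / l + 1"
        by linarith+
      hence "q y - l \<le> real (k y) * l" "real (k y) * l \<le> q y"
        using l by (auto simp: field_simps)
      thus "q y \<le> q' y" "q' y \<le> q y + l" using y by (auto simp: q'_def)
    qed
    have qp: "0 < q y" if "y \<in> Y" for y using q l that by force
    have q'p: "0 < q' y" if "y \<in> Y" for y using qp qq' that by (meson less_le_trans)
    have ip: "integrable \<mu> (\<lambda>x. 1 - soft_potential \<kappa> N Y q x)" if "\<And>y. y \<in> Y \<Longrightarrow> 0 < q y" for q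
      using Y that by (intro radon_integrable_continuous[OF \<mu>(1) _ \<Omega>] continuous_intros
          continuous_on_soft_potential) (auto simp: less_imp_neq[symmetric])
    have "(LINT x|\<mu>. 1 - soft_potential \<kappa> N Y q x) \<le> (LINT x|\<mu>. 1 - soft_potential \<kappa> N Y q' x)"
      using qp q'p qq' N Y by (intro integral_mono ip diff_left_mono soft_potential_antimono) auto
    moreover have "(\<Sum>y\<in>Y. v y * (1 - q y)) \<le> (\<Sum>y\<in>Y. v y * (1 - q' y)) + l * (\<Sum>y\<in>Y. v y)"
    proof -
      have "(\<Sum>y\<in>Y. v y * (1 - q y)) \<le> (\<Sum>y\<in>Y. v y * (1 - q' y + l))"
        using qq' v \<eta> by (intro sum_mono mult_left_mono) force+
      thus ?thesis by (simp add: distrib_left sum.distrib sum_distrib_left mult_ac)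
    qed
    moreover have "2 * (l * (\<Sum>y\<in>Y. v y)) \<le> e"
    proof -
      have "(\<Sum>y\<in>Y. v y) \<le> (\<Sum>y\<in>Y. R)" using v by (intro sum_mono) auto
      hence "l * (\<Sum>y\<in>Y. v y) \<le> l * (J * R)" using l by (intro mult_left_mono) (auto simp: J_def)
      thus ?thesis using J Rp by (simp add: l_def)
    qed
    ultimately have "(LINT x|\<mu>. 1 - soft_potential \<kappa> N Y q x) + (\<Sum>y\<in>Y. v y * (1 - q y))
        + l * (\<Sum>y\<in>Y. v y) + M * ln (card Y) / N \<le> dual_value \<kappa> N Y v \<mu> q' + e + M * ln (card Y) / N"
      unfolding dual_value_def by linarith
    from order_trans[OF hk ennreal_leI[OF this]] q'G
    show "\<exists>q\<in>G. HK2 \<kappa> \<Omega> \<mu> (discrete_measure \<Omega> Y v)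
         \<le> ennreal (dual_value \<kappa> N Y v \<mu> q + e + M * ln (card Y) / N)" by blast
  qed
qed

section \<open>The weak-star topology and its Borel measures\<close>

lemma topspace_weak_star [simp]: "topspace (weak_star X) = radon_measures X"
  unfolding weak_star_def topspace_pullback_topology by auto

lemma mass_ball_subset: "mass_ball X M \<subseteq> radon_measures X"
  by (auto simp: mass_ball_def)

lemma topspace_mass_ball_top [simp]: "topspace (mass_ball_top X M) = mass_ball X M"
  using mass_ball_subset by (auto simp: mass_ball_top_def)

lemma continuous_map_weak_star_integral:
  assumes "continuous_on X f"
  shows "continuous_map (weak_star X) euclideanreal (\<lambda>\<mu>. LINT x|\<mu>. f x)"
proof -
  let ?I = "{f. continuous_on X f}"
  let ?h = "\<lambda>\<mu>. \<lambda>f\<in>?I. LINT x|\<mu>. f x"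
  have "continuous_map (weak_star X) euclideanreal ((\<lambda>g. g f) \<circ> ?h)"
    unfolding weak_star_def using assms
    by (intro continuous_map_pullback continuous_map_product_projection) auto
  thus ?thesis using assms by (simp add: comp_def)
qed

lemma continuous_map_mass_ball_integral:
  assumes "continuous_on X f"
  shows "continuous_map (mass_ball_top X M) euclideanreal (\<lambda>\<mu>. LINT x|\<mu>. f x)"
  unfolding mass_ball_top_def
  by (rule continuous_map_from_subtopology[OF continuous_map_weak_star_integral[OF assms]])

lemma borel_prob_measuresD:
  assumes "\<Lambda> \<in> borel_prob_measures T"
  shows "prob_space \<Lambda>" "space \<Lambda> = topspace T" "sets \<Lambda> = sigma_sets (topspace T) {U. openin T U}"
proof -
  have s: "{U. openin T U} \<subseteq> Pow (topspace T)" using openin_subset by auto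
  show "prob_space \<Lambda>" "sets \<Lambda> = sigma_sets (topspace T) {U. openin T U}"
    using assms s by (auto simp: borel_prob_measures_def borel_of_topology_def)
  have "sets \<Lambda> = sets (borel_of_topology T)" using assms by (simp add: borel_prob_measures_def)
  from sets_eq_imp_space_eq[OF this] show "space \<Lambda> = topspace T"
    using s by (simp add: borel_of_topology_def space_measure_of)
qed

lemma measurable_continuous_map:
  fixes f :: "'b \<Rightarrow> real"
  assumes \<Lambda>: "\<Lambda> \<in> borel_prob_measures T" and f: "continuous_map T euclideanreal f"
  shows "f \<in> borel_measurable \<Lambda>"
proof (rule borel_measurableI)
  fix S :: "real set" assume "open S"
  hence "openin T {x \<in> topspace T. f x \<in> S}"
    using f by (simp add: openin_continuous_map_preimage)
  moreover have "f -` S \<inter> space \<Lambda> = {x \<in> topspace T. f x \<in> S}"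
    using borel_prob_measuresD(2)[OF \<Lambda>] by auto
  ultimately show "f -` S \<inter> space \<Lambda> \<in> sets \<Lambda>"
    using borel_prob_measuresD(3)[OF \<Lambda>] by auto
qed

lemma continuous_map_softmax:
  assumes "finite I" "i \<in> I" "\<And>i. i \<in> I \<Longrightarrow> continuous_map X euclideanreal (\<lambda>x. w x i)"
  shows "continuous_map X euclideanreal (\<lambda>x. softmax N I (w x) i)"
proof -
  have e: "continuous_map X euclideanreal (\<lambda>x. exp (N * w x j))" if "j \<in> I" for j
  proof -
    have "continuous_map euclideanreal euclideanreal (\<lambda>t. exp (N * t))"
      by (auto intro!: continuous_intros)
    from continuous_map_compose[OF assms(3)[OF that] this] show ?thesis by (simp add: comp_def)
  qed
  have "(\<Sum>j\<in>I. exp (N * w x j)) \<noteq> 0" for x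
    using sum_exp_pos[of I "\<lambda>i. N * w x i"] assms by force
  thus ?thesis
    unfolding softmax_def using assms e by (intro continuous_map_real_divide continuous_map_sum) auto
qed

section \<open>Estimates uniform over the mass ball\<close>

lemma lse_abs_le:
  assumes "0 < N" "finite I" "I \<noteq> {}" "\<And>i. i \<in> I \<Longrightarrow> \<bar>w i\<bar> \<le> c"
  shows "\<bar>lse N I w\<bar> \<le> c + ln (card I) / N"
proof -
  obtain i where i: "i \<in> I" using assms by auto
  have "lse N I w \<le> c + ln (card I) / N"
    using assms by (intro lse_le_bound) (auto simp: abs_le_iff)
  moreover have "- c \<le> lse N I w"
    using lse_ge[OF assms(1,2) i, of w] assms(4)[OF i] by linarith
  moreover have "0 \<le> ln (card I) / N" using assms by (simp add: Suc_le_eq card_gt_0_iff)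
  ultimately show ?thesis by linarith
qed

lemma soft_potential_bounds:
  assumes "0 < N" "finite Y" "Y \<noteq> {}" "0 < l" "\<And>y. y \<in> Y \<Longrightarrow> l \<le> q y"
  shows "0 \<le> soft_potential \<kappa> N Y q x" "soft_potential \<kappa> N Y q x \<le> 1 / l + ln (card Y) / N"
proof -
  obtain y where y: "y \<in> Y" using assms by auto
  have "0 \<le> cos_kernel \<kappa> x y / q y" using assms(4) assms(5)[OF y] cos_kernel_bounds[of \<kappa> x y] by simp
  also have "\<dots> \<le> soft_potential \<kappa> N Y q x"
    unfolding soft_potential_def using y assms by (intro lse_ge[of N Y y "\<lambda>y. cos_kernel \<kappa> x y / q y"]) auto
  finally show "0 \<le> soft_potential \<kappa> N Y q x" .
  show "soft_potential \<kappa> N Y q x \<le> 1 / l + ln (card Y) / N"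
    unfolding soft_potential_def using assms
    by (intro lse_le_bound frac_le cos_kernel_bounds) auto
qed

text \<open>The mass of \<open>\<mu>\<close> is only bounded above by \<open>M\<close>, so a
  pointwise lower bound \<open>1 - c\<close> passes to the integral with the factor \<open>M\<close>
  if it is not positive. The third estimate holds without that condition, because the contribution
  of the constant 1 is dropped.\<close>

lemma integral_soft_potential_bounds:
  assumes \<Omega>: "compact \<Omega>" and \<mu>: "\<mu> \<in> mass_ball \<Omega> M"
    and "0 < N" "finite Y" "Y \<noteq> {}" "0 < l" "\<And>y. y \<in> Y \<Longrightarrow> l \<le> q y"
  shows "(LINT x|\<mu>. 1 - soft_potential \<kappa> N Y q x) \<le> M"
    and "1 \<le> 1 / l + ln (card Y) / N \<Longrightarrow>
      M * (1 - (1 / l + ln (card Y) / N)) \<le> (LINT x|\<mu>. 1 - soft_potential \<kappa> N Y q x)"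
    and "- M * (1 / l + ln (card Y) / N) \<le> (LINT x|\<mu>. 1 - soft_potential \<kappa> N Y q x)"
proof -
  have \<mu>': "\<mu> \<in> radon_measures \<Omega>" "measure \<mu> \<Omega> \<le> M" using \<mu> by (auto simp: mass_ball_def)
  interpret finite_measure \<mu> using \<mu>'(1) by (rule radon_measuresD)
  note sp = radon_measuresD(3)[OF \<mu>'(1)]
  have q: "q y \<noteq> 0" if "y \<in> Y" for y using assms(6) assms(7)[OF that] by simp
  have i: "integrable \<mu> (\<lambda>x. 1 - soft_potential \<kappa> N Y q x)"
    using assms q by (intro radon_integrable_continuous[OF \<mu>'(1) _ \<Omega>] continuous_intros continuous_on_soft_potential) auto
  note b = soft_potential_bounds[where q = q and \<kappa> = \<kappa>, OF assms(3-7)]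
  let ?c = "1 / l + ln (card Y) / N"
  have c0: "0 \<le> ?c" by (rule order_trans[OF b])
  have "(LINT x|\<mu>. 1 - soft_potential \<kappa> N Y q x) \<le> (LINT x|\<mu>. 1)"
    using i b by (intro integral_mono) auto
  thus "(LINT x|\<mu>. 1 - soft_potential \<kappa> N Y q x) \<le> M" using \<mu>' sp by simp
  have "(LINT x|\<mu>. 1 - ?c) \<le> (LINT x|\<mu>. 1 - soft_potential \<kappa> N Y q x)"
    using i b(2) by (intro integral_mono) (auto simp: algebra_simps)
  hence *: "measure \<mu> \<Omega> * (1 - ?c) \<le> (LINT x|\<mu>. 1 - soft_potential \<kappa> N Y q x)" using sp by simp
  show "M * (1 - ?c) \<le> (LINT x|\<mu>. 1 - soft_potential \<kappa> N Y q x)" if "1 \<le> ?c"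
  proof -
    have "M * (1 - ?c) \<le> measure \<mu> \<Omega> * (1 - ?c)"
      using that \<mu>' by (intro mult_right_mono_neg) auto
    thus ?thesis using * by linarith
  qed
  have "measure \<mu> \<Omega> * ?c \<le> M * ?c" using \<mu>' c0 by (intro mult_right_mono)
  moreover have "measure \<mu> \<Omega> * (1 - ?c) = measure \<mu> \<Omega> - measure \<mu> \<Omega> * ?c" by (simp add: algebra_simps)
  ultimately show "- M * ?c \<le> (LINT x|\<mu>. 1 - soft_potential \<kappa> N Y q x)"
    using * measure_nonneg[of \<mu> \<Omega>] unfolding minus_mult_left[symmetric] by linarith
qed

lemma mass_ball_nonneg: "\<mu> \<in> mass_ball \<Omega> M \<Longrightarrow> 0 \<le> M"
  unfolding mass_ball_def by (blast intro: order_trans[OF measure_nonneg])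

text \<open>The sum over \<open>G\<close> in the second conclusion is the derivative of the smoothed objective in the
  direction \<open>y\<close>, so that it is the first-order condition at a minimiser off the face \<open>v y = R\<close>. The
  bound on \<open>R\<close> makes the objective too large on that face.\<close>

lemma outer_minimiser:
  fixes \<Omega> :: "'a::euclidean_space set" and M N n \<eta> R :: real
  assumes \<Omega>: "compact \<Omega>" and Y: "finite Y" "Y \<noteq> {}"
    and \<Lambda>: "\<Lambda> \<in> borel_prob_measures (mass_ball_top \<Omega> M)"
    and N: "0 < N" and n: "0 < n"
    and G: "finite G" "\<And>q y. q \<in> G \<Longrightarrow> y \<in> Y \<Longrightarrow> 0 < q y" "(\<lambda>_. 1 / 2) \<in> G"
    and \<eta>: "0 < \<eta>" "\<eta> \<le> R"
    and R: "M * (2 + ln (card Y) / N) + M + \<eta> * card Y + ln (card G) / n < R / 2"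
  obtains v where "\<forall>y\<in>Y. v y \<in> {\<eta>..R}"
    "\<And>y. y \<in> Y \<Longrightarrow> 0 \<le> (LINT \<mu>|\<Lambda>. (\<Sum>q\<in>G. softmax n G (dual_value \<kappa> N Y v \<mu>) q * (1 - q y)))"
    "integrable \<Lambda> (\<lambda>\<mu>. lse n G (dual_value \<kappa> N Y v \<mu>))"
    "(LINT \<mu>|\<Lambda>. lse n G (dual_value \<kappa> N Y v \<mu>)) \<le>
      (LINT \<mu>|\<Lambda>. (\<Sum>q\<in>G. softmax n G (dual_value \<kappa> N Y v \<mu>) q * (LINT x|\<mu>. 1 - soft_potential \<kappa> N Y q x)))
      + ln (card G) / n + \<eta> * card Y"
proof -
  interpret prob_space \<Lambda> using \<Lambda> by (rule borel_prob_measuresD)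
  have sp: "space \<Lambda> = mass_ball \<Omega> M" using borel_prob_measuresD(2)[OF \<Lambda>] by simp
  have Gne: "G \<noteq> {}" using G by auto
  define A where "A q \<mu> = (LINT x|\<mu>. 1 - soft_potential \<kappa> N Y q x)" for q and \<mu> :: "'a measure"
  define w where "w v \<mu> = dual_value \<kappa> N Y v \<mu>" for v \<mu>
  have w: "w v \<mu> q = A q \<mu> + (\<Sum>y\<in>Y. v y * (1 - q y))" for v \<mu> q
    by (simp add: w_def dual_value_def A_def)
  obtain \<mu>0 where "\<mu>0 \<in> mass_ball \<Omega> M" using not_empty sp by auto
  hence M0: "0 \<le> M" by (rule mass_ball_nonneg)
  have "\<exists>c. \<forall>\<mu>\<in>mass_ball \<Omega> M. \<bar>A q \<mu>\<bar> \<le> c" if q: "q \<in> G" for q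
  proof -
    define l where "l = Min (q ` Y)"
    have l: "0 < l" "\<And>y. y \<in> Y \<Longrightarrow> l \<le> q y"
      using Y G(2)[OF q] by (auto simp: l_def)
    let ?c = "1 / l + ln (card Y) / N"
    have "\<bar>A q \<mu>\<bar> \<le> M + M * ?c" if "\<mu> \<in> mass_ball \<Omega> M" for \<mu>
    proof -
      have "0 \<le> ?c" using l N Y by (simp add: Suc_le_eq card_gt_0_iff)
      hence "0 \<le> M * ?c" using M0 by (rule mult_nonneg_nonneg[rotated])
      thus ?thesis
        using integral_soft_potential_bounds(1,3)[where q = q and \<kappa> = \<kappa>, OF \<Omega> that N Y l] M0
        unfolding A_def[symmetric] by linarith
    qed
    thus ?thesis by blast
  qed
  then obtain cA where cA: "\<And>q \<mu>. q \<in> G \<Longrightarrow> \<mu> \<in> mass_ball \<Omega> M \<Longrightarrow> \<bar>A q \<mu>\<bar> \<le> cA q" by metis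
  have cont_A: "continuous_map (mass_ball_top \<Omega> M) euclideanreal (A q)" if "q \<in> G" for q
    unfolding A_def[abs_def] using Y G(2)[OF that]
    by (intro continuous_map_mass_ball_integral continuous_intros continuous_on_soft_potential) 
       (auto simp: less_imp_neq[symmetric])
  have mA [measurable]: "A q \<in> borel_measurable \<Lambda>" if "q \<in> G" for q
    by (rule measurable_continuous_map[OF \<Lambda> cont_A[OF that]])
  have mw: "(\<lambda>\<mu>. w v \<mu> q) \<in> borel_measurable \<Lambda>" if "q \<in> G" for q v
    unfolding w using mA[OF that] by measurable
  define ch where "ch v \<mu> q = softmax n G (w v \<mu>) q" for v \<mu> q
  have mch: "(\<lambda>\<mu>. ch v \<mu> q) \<in> borel_measurable \<Lambda>" if "q \<in> G" for q v
    unfolding ch_def softmax_def using mw G that by (intro borel_measurable_divide borel_measurable_sum 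
      measurable_compose[OF _ borel_measurable_exp] borel_measurable_times) auto
  have ch01: "0 \<le> ch v \<mu> q" "ch v \<mu> q \<le> 1" if "q \<in> G" for v \<mu> q
    using softmax_nonneg softmax_le_1[OF G(1) that] by (auto simp: ch_def)
  have ch1: "(\<Sum>q\<in>G. ch v \<mu> q) = 1" for v \<mu>
    unfolding ch_def using G Gne by (intro sum_softmax) auto
  define wb where "wb v = (\<Sum>q\<in>G. \<bar>cA q\<bar> + \<bar>\<Sum>y\<in>Y. v y * (1 - q y)\<bar>)" for v
  have wb: "\<bar>w v \<mu> q\<bar> \<le> wb v" if "\<mu> \<in> mass_ball \<Omega> M" "q \<in> G" for v \<mu> q
  proof -
    have "\<bar>w v \<mu> q\<bar> \<le> \<bar>cA q\<bar> + \<bar>\<Sum>y\<in>Y. v y * (1 - q y)\<bar>"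
      unfolding w using cA[OF that(2,1)] by linarith
    also have "\<dots> \<le> wb v" unfolding wb_def using that G by (intro member_le_sum) auto
    finally show ?thesis .
  qed
  have il: "integrable \<Lambda> (\<lambda>\<mu>. lse n G (w v \<mu>))" for v
  proof (rule integrable_const_bound)
    show "AE \<mu> in \<Lambda>. norm (lse n G (w v \<mu>)) \<le> wb v + ln (card G) / n"
      using lse_abs_le[OF n G(1) Gne wb] sp by (intro AE_I2) auto
    show "(\<lambda>\<mu>. lse n G (w v \<mu>)) \<in> borel_measurable \<Lambda>"
      unfolding lse_def using mw by (intro borel_measurable_divide borel_measurable_sum measurable_compose[OF _ borel_measurable_ln]
        measurable_compose[OF _ borel_measurable_exp] borel_measurable_times) auto
  qed
  define V where "V v = (LINT \<mu>|\<Lambda>. lse n G (w v \<mu>))" for v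
  define L where "L = (\<Sum>q\<in>G. \<Sum>y\<in>Y. \<bar>1 - q y\<bar>)"
  have Lge: "\<bar>1 - q y\<bar> \<le> L" if "q \<in> G" "y \<in> Y" for q y
  proof -
    have "\<bar>1 - q y\<bar> \<le> (\<Sum>y\<in>Y. \<bar>1 - q y\<bar>)" using that Y by (intro member_le_sum) auto
    also have "\<dots> \<le> L" unfolding L_def using that G by (intro member_le_sum) (auto intro: sum_nonneg)
    finally show ?thesis .
  qed
  have lse_lip: "\<bar>lse n G (w v \<mu>) - lse n G (w v' \<mu>)\<bar> \<le> L * (\<Sum>y\<in>Y. \<bar>v y - v' y\<bar>)" for v v' \<mu>
  proof (rule lse_lipschitz[OF n G(1) Gne])
    fix q assume q: "q \<in> G"
    have "w v \<mu> q - w v' \<mu> q = (\<Sum>y\<in>Y. (v y - v' y) * (1 - q y))"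
      by (simp add: w sum_subtractf left_diff_distrib)
    also have "\<bar>\<dots>\<bar> \<le> (\<Sum>y\<in>Y. \<bar>v y - v' y\<bar> * \<bar>1 - q y\<bar>)"
      using sum_abs[of "\<lambda>y. (v y - v' y) * (1 - q y)" Y] by (simp add: abs_mult)
    also have "\<dots> \<le> (\<Sum>y\<in>Y. \<bar>v y - v' y\<bar> * L)"
      using Lge q by (intro sum_mono mult_left_mono) auto
    finally show "\<bar>w v \<mu> q - w v' \<mu> q\<bar> \<le> L * (\<Sum>y\<in>Y. \<bar>v y - v' y\<bar>)"
      by (simp add: sum_distrib_left mult.commute)
  qed
  have lip: "\<bar>V v - V v'\<bar> \<le> L * (\<Sum>y\<in>Y. \<bar>v y - v' y\<bar>)"
    if "\<forall>y\<in>Y. v y \<in> {\<eta>..R}" "\<forall>y\<in>Y. v' y \<in> {\<eta>..R}" for v v'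
  proof -
    have "\<bar>V v - V v'\<bar> = \<bar>LINT \<mu>|\<Lambda>. lse n G (w v \<mu>) - lse n G (w v' \<mu>)\<bar>"
      unfolding V_def using il by simp
    also have "\<dots> \<le> (LINT \<mu>|\<Lambda>. \<bar>lse n G (w v \<mu>) - lse n G (w v' \<mu>)\<bar>)"
      using integral_norm_bound[of \<Lambda> "\<lambda>\<mu>. lse n G (w v \<mu>) - lse n G (w v' \<mu>)"] by simp
    also have "\<dots> \<le> (LINT \<mu>|\<Lambda>. L * (\<Sum>y\<in>Y. \<bar>v y - v' y\<bar>))"
      using il lse_lip by (intro integral_mono) auto
    also have "\<dots> = L * (\<Sum>y\<in>Y. \<bar>v y - v' y\<bar>)" by (simp add: prob_space)
    finally show ?thesis .
  qed
  obtain v where v: "\<forall>y\<in>Y. v y \<in> {\<eta>..R}" and min: "\<And>v'. \<forall>y\<in>Y. v' y \<in> {\<eta>..R} \<Longrightarrow> V v \<le> V v'"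
  proof (rule box_minimiser[OF Y(1) \<eta>(2) lip])
    fix u assume "\<forall>y\<in>Y. u y \<in> {\<eta>..R}" "\<And>v'. \<forall>y\<in>Y. v' y \<in> {\<eta>..R} \<Longrightarrow> V u \<le> V v'"
    thus thesis by (rule that)
  qed
  \<comment> \<open>On the face \<open>v j = R\<close> the member \<open>1/2\<close> of
    \<open>G\<close> forces the objective up to \<open>R / 2\<close>, apart from a constant, while
    the constant weights \<open>\<eta>\<close> keep it at most
    \<open>M + \<eta> * card Y + ln (card G) / n\<close>.\<close>
  have vlt: "v j < R" if j: "j \<in> Y" for j
  proof (rule ccontr)
    assume "\<not> v j < R"
    hence vj: "v j = R" using v j by force
    let ?h = "\<lambda>_::'a. 1 / 2 :: real"
    have "R \<le> (\<Sum>y\<in>Y. v y)"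
      using vj j v \<eta> Y member_le_sum[of j Y v] by force
    hence "R / 2 - M * (2 + ln (card Y) / N) \<le> w v \<mu> ?h" if "\<mu> \<in> mass_ball \<Omega> M" for \<mu>
      using integral_soft_potential_bounds(3)[where l = "1/2" and q = ?h and \<kappa> = \<kappa>, OF \<Omega> that N Y] 
      unfolding A_def[symmetric] w by (simp flip: sum_divide_distrib)
    hence lo: "R / 2 - M * (2 + ln (card Y) / N) \<le> lse n G (w v \<mu>)" if "\<mu> \<in> mass_ball \<Omega> M" for \<mu>
      using lse_ge[OF n G(1,3), of "w v \<mu>"] that by (meson order_trans)
    have "(LINT \<mu>|\<Lambda>. R / 2 - M * (2 + ln (card Y) / N)) \<le> V v"
      unfolding V_def using il lo sp by (intro integral_mono) auto
    hence 1: "R / 2 - M * (2 + ln (card Y) / N) \<le> V v" by (simp add: prob_space)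
    have "w (\<lambda>_. \<eta>) \<mu> q \<le> M + \<eta> * card Y" if \<mu>: "\<mu> \<in> mass_ball \<Omega> M" and q: "q \<in> G" for \<mu> q
    proof -
      have l: "0 < Min (q ` Y)" "\<And>y. y \<in> Y \<Longrightarrow> Min (q ` Y) \<le> q y"
        using Y G(2)[OF q] by auto
      have "(\<Sum>y\<in>Y. \<eta> * (1 - q y)) \<le> (\<Sum>y\<in>Y. \<eta>)"
        using \<eta> G(2)[OF q] by (intro sum_mono) (simp add: less_imp_le)
      thus ?thesis using integral_soft_potential_bounds(1)[where q = q and \<kappa> = \<kappa>, OF \<Omega> \<mu> N Y l]
        unfolding A_def[symmetric] w by (simp add: mult.commute)
    qed
    hence "lse n G (w (\<lambda>_. \<eta>) \<mu>) \<le> M + \<eta> * card Y + ln (card G) / n" if "\<mu> \<in> mass_ball \<Omega> M" for \<mu>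
      using that by (intro lse_le_bound[OF n G(1) Gne]) auto
    hence "V (\<lambda>_. \<eta>) \<le> (LINT \<mu>|\<Lambda>. M + \<eta> * card Y + ln (card G) / n)"
      unfolding V_def using il sp by (intro integral_mono) auto
    hence 2: "V (\<lambda>_. \<eta>) \<le> M + \<eta> * card Y + ln (card G) / n" by (simp add: prob_space)
    have "V v \<le> V (\<lambda>_. \<eta>)" using \<eta> by (intro min) auto
    with 1 2 R show False by linarith
  qed
  define D where "D j = (LINT \<mu>|\<Lambda>. (\<Sum>q\<in>G. ch v \<mu> q * (1 - q j)))" for j
  have der: "((\<lambda>t. V (v(j := t))) has_real_derivative D j) (at (v j))" if j: "j \<in> Y" for j
    unfolding V_def D_def
  proof (rule DERIV_integral[where d = 1 and L = L])
    show "integrable \<Lambda> (\<lambda>\<mu>. lse n G (w (v(j := t)) \<mu>))" for t by (rule il)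
    show "\<bar>lse n G (w (v(j := t)) \<mu>) - lse n G (w (v(j := v j)) \<mu>)\<bar> \<le> L * \<bar>t - v j\<bar>" for t \<mu>
    proof -
      have "(\<Sum>y\<in>Y. \<bar>(v(j := t)) y - v y\<bar>) = (\<Sum>y\<in>Y. if y = j then \<bar>t - v j\<bar> else 0)"
        by (intro sum.cong) auto
      also have "\<dots> = \<bar>t - v j\<bar>" using Y j by simp
      finally show ?thesis using lse_lip[of "v(j := t)" \<mu> v] by simp
    qed
    fix \<mu>
    have "((\<lambda>t. w (v(j := t)) \<mu> q) has_real_derivative (1 - q j)) (at (v j))" for q
    proof -
      have "((\<lambda>t. \<Sum>y\<in>Y. (v(j := t)) y * (1 - q y)) has_real_derivative (\<Sum>y\<in>Y. if y = j then 1 - q j else 0)) (at (v j))"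
        by (intro DERIV_sum) (auto intro!: derivative_eq_intros)
      hence "((\<lambda>t. A q \<mu> + (\<Sum>y\<in>Y. (v(j := t)) y * (1 - q y))) has_real_derivative 0 + (\<Sum>y\<in>Y. if y = j then 1 - q j else 0)) (at (v j))"
        by (intro DERIV_add DERIV_const)
      thus ?thesis using Y j by (simp add: w)
    qed
    hence "((\<lambda>t. lse n G (w (v(j := t)) \<mu>)) has_real_derivative
        (\<Sum>q\<in>G. softmax n G (w (v(j := v j)) \<mu>) q * (1 - q j))) (at (v j))"
      using n G Gne by (intro DERIV_lse) auto
    thus "((\<lambda>t. lse n G (w (v(j := t)) \<mu>)) has_real_derivative (\<Sum>q\<in>G. ch v \<mu> q * (1 - q j))) (at (v j))"
      by (simp add: ch_def)
  qed simp
  have D0: "0 \<le> D j" if "j \<in> Y" for j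
    using box_minimiser_KKT(1)[OF v min der[OF that] that vlt[OF that]] .
  have i1: "integrable \<Lambda> (\<lambda>\<mu>. ch v \<mu> q * (1 - q y))" if "q \<in> G" for q y
    using ch01[OF that] mch[OF that] 
    by (intro integrable_const_bound[where B = "\<bar>1 - q y\<bar>"] AE_I2) (auto simp: abs_mult intro!: mult_left_le_one_le)
  have i2: "integrable \<Lambda> (\<lambda>\<mu>. ch v \<mu> q * A q \<mu>)" if q: "q \<in> G" for q
  proof (rule integrable_const_bound[where B = "cA q"])
    show "AE \<mu> in \<Lambda>. norm (ch v \<mu> q * A q \<mu>) \<le> cA q"
    proof (rule AE_I2)
      fix \<mu> assume "\<mu> \<in> space \<Lambda>"
      hence "\<bar>A q \<mu>\<bar> \<le> cA q" using cA[OF q] sp by auto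
      thus "norm (ch v \<mu> q * A q \<mu>) \<le> cA q"
        using ch01[OF q, of v \<mu>] mult_mono[of "\<bar>ch v \<mu> q\<bar>" 1 "\<bar>A q \<mu>\<bar>" "cA q"] by (auto simp: abs_mult)
    qed
  qed (use mch[OF q] mA[OF q] in measurable)
  have D1: "D j \<le> 1" if j: "j \<in> Y" for j
  proof -
    have "(\<Sum>q\<in>G. ch v \<mu> q * (1 - q j)) \<le> 1" for \<mu>
    proof -
      have "(\<Sum>q\<in>G. ch v \<mu> q * (1 - q j)) \<le> (\<Sum>q\<in>G. ch v \<mu> q)"
        using ch01 G(2) j by (intro sum_mono mult_left_le) (auto simp: less_imp_le)
      thus ?thesis by (simp add: ch1)
    qed
    hence "D j \<le> (LINT \<mu>|\<Lambda>. 1)" unfolding D_def using i1 by (intro integral_mono) auto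
    thus ?thesis by (simp add: prob_space)
  qed
  \<comment> \<open>Complementary slackness up to \<open>\<eta>\<close>: off the lower face the
    derivative vanishes, and on it \<open>D j \<le> 1\<close> because every \<open>q\<close> in
    \<open>G\<close> is positive on \<open>Y\<close>.\<close>
  have vD: "v j * D j \<le> \<eta>" if j: "j \<in> Y" for j
  proof (cases "\<eta> < v j")
    case True
    hence "D j \<le> 0" using box_minimiser_KKT(2)[OF v min der[OF j] j] by simp
    thus ?thesis using D0[OF j] \<eta> by simp
  next
    case False
    hence "v j = \<eta>" using v j by force
    thus ?thesis using D1[OF j] \<eta> by simp
  qed
  \<comment> \<open>As dual values are affine in \<open>v\<close>, their softmax mean splits into
    the part without \<open>v\<close> and a part that integrates to the sum of
    \<open>v y * D y\<close>. Slackness bounds the latter by \<open>\<eta> * card Y\<close>.\<close>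
  have "V v \<le> (LINT \<mu>|\<Lambda>. (\<Sum>q\<in>G. ch v \<mu> q * A q \<mu>) + (\<Sum>y\<in>Y. v y * (\<Sum>q\<in>G. ch v \<mu> q * (1 - q y))) + ln (card G) / n)"
    unfolding V_def
  proof (rule integral_mono)
    fix \<mu>
    have "lse n G (w v \<mu>) \<le> (\<Sum>q\<in>G. ch v \<mu> q * w v \<mu> q) + ln (card G) / n"
      unfolding ch_def using n G Gne by (intro lse_le_softmax_mean) auto
    also have "(\<Sum>q\<in>G. ch v \<mu> q * w v \<mu> q) = (\<Sum>q\<in>G. ch v \<mu> q * A q \<mu>) + (\<Sum>q\<in>G. \<Sum>y\<in>Y. ch v \<mu> q * (v y * (1 - q y)))"
      by (simp add: w distrib_left sum.distrib sum_distrib_left)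
    also have "(\<Sum>q\<in>G. \<Sum>y\<in>Y. ch v \<mu> q * (v y * (1 - q y))) = (\<Sum>y\<in>Y. \<Sum>q\<in>G. ch v \<mu> q * (v y * (1 - q y)))"
      by (rule sum.swap)
    also have "\<dots> = (\<Sum>y\<in>Y. v y * (\<Sum>q\<in>G. ch v \<mu> q * (1 - q y)))"
      by (simp add: sum_distrib_left mult_ac)
    finally show "lse n G (w v \<mu>) \<le> (\<Sum>q\<in>G. ch v \<mu> q * A q \<mu>) + (\<Sum>y\<in>Y. v y * (\<Sum>q\<in>G. ch v \<mu> q * (1 - q y))) + ln (card G) / n" .
  qed (use il i1 i2 in auto)
  also have "\<dots> = (LINT \<mu>|\<Lambda>. (\<Sum>q\<in>G. ch v \<mu> q * A q \<mu>)) + (\<Sum>y\<in>Y. v y * D y) + ln (card G) / n"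
    using i1 i2 by (simp add: D_def prob_space)
  also have "(\<Sum>y\<in>Y. v y * D y) \<le> (\<Sum>y\<in>Y. \<eta>)" by (intro sum_mono vD)
  finally have "V v \<le> (LINT \<mu>|\<Lambda>. (\<Sum>q\<in>G. ch v \<mu> q * A q \<mu>)) + ln (card G) / n + \<eta> * card Y"
    by (simp add: algebra_simps)
  thus thesis
    using that[OF v] D0 il[of v] unfolding V_def D_def ch_def w_def A_def by blast
qed

section \<open>From softmax averages to an admissible dual pair\<close>

lemma integrable_continuous_map:
  fixes f :: "'b \<Rightarrow> real"
  assumes \<Lambda>: "\<Lambda> \<in> borel_prob_measures T" and f: "continuous_map T euclideanreal f"
    and bd: "\<And>x. x \<in> topspace T \<Longrightarrow> \<bar>f x\<bar> \<le> c"
  shows "integrable \<Lambda> f"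
proof -
  interpret prob_space \<Lambda> using \<Lambda> by (rule borel_prob_measuresD)
  show ?thesis
    using measurable_continuous_map[OF \<Lambda> f] bd borel_prob_measuresD(2)[OF \<Lambda>]
    by (intro integrable_const_bound[where B = c]) auto
qed

lemma continuous_map_dual_value:
  assumes "finite Y" "Y \<noteq> {}" "\<And>y. y \<in> Y \<Longrightarrow> q y \<noteq> 0"
  shows "continuous_map (mass_ball_top \<Omega> M) euclideanreal (\<lambda>\<mu>. LINT x|\<mu>. 1 - soft_potential \<kappa> N Y q x)"
    and "continuous_map (mass_ball_top \<Omega> M) euclideanreal (\<lambda>\<mu>. dual_value \<kappa> N Y v \<mu> q)"
proof -
  show *: "continuous_map (mass_ball_top \<Omega> M) euclideanreal (\<lambda>\<mu>. LINT x|\<mu>. 1 - soft_potential \<kappa> N Y q x)"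
    using assms by (intro continuous_map_mass_ball_integral continuous_intros continuous_on_soft_potential)
  show "continuous_map (mass_ball_top \<Omega> M) euclideanreal (\<lambda>\<mu>. dual_value \<kappa> N Y v \<mu> q)"
    unfolding dual_value_def by (intro continuous_map_add * continuous_map_canonical_const)
qed

text \<open>The Cauchy-Schwarz inequality for the vectors \<open>sqrt (s i * a i)\<close> and
  \<open>sqrt (s i * b i)\<close>, whose inner product is at least \<open>sqrt k\<close>.\<close>

lemma weighted_product_ge:
  fixes s a b :: "'i \<Rightarrow> real"
  assumes "\<And>i. i \<in> I \<Longrightarrow> 0 \<le> s i" "(\<Sum>i\<in>I. s i) = 1"
    and "\<And>i. i \<in> I \<Longrightarrow> 0 \<le> a i" "\<And>i. i \<in> I \<Longrightarrow> 0 \<le> b i"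
    and "\<And>i. i \<in> I \<Longrightarrow> k \<le> a i * b i" and k: "0 \<le> k"
  shows "k \<le> (\<Sum>i\<in>I. s i * a i) * (\<Sum>i\<in>I. s i * b i)"
proof -
  have "sqrt k = (\<Sum>i\<in>I. s i * sqrt k)" using assms(2) by (simp flip: sum_distrib_right)
  also have "\<dots> \<le> (\<Sum>i\<in>I. s i * sqrt (a i * b i))"
    using assms by (intro sum_mono mult_left_mono) auto
  also have "\<dots> = (\<Sum>i\<in>I. sqrt (s i * a i) * sqrt (s i * b i))"
    using assms by (intro sum.cong) (auto simp: real_sqrt_mult)
  finally have "(sqrt k)\<^sup>2 \<le> (\<Sum>i\<in>I. sqrt (s i * a i) * sqrt (s i * b i))\<^sup>2"
    using k by (intro power_mono) auto
  also have "\<dots> \<le> (\<Sum>i\<in>I. (sqrt (s i * a i))\<^sup>2) * (\<Sum>i\<in>I. (sqrt (s i * b i))\<^sup>2)"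
    by (rule Cauchy_Schwarz_ineq_sum)
  also have "\<dots> = (\<Sum>i\<in>I. s i * a i) * (\<Sum>i\<in>I. s i * b i)"
    using assms by (intro arg_cong2[where f = "(*)"] sum.cong) auto
  finally show ?thesis using k by simp
qed

lemma soft_potential_mult_ge:
  assumes "0 < N" "finite Y" "y \<in> Y" "0 < q y"
  shows "cos_kernel \<kappa> x y \<le> soft_potential \<kappa> N Y q x * q y"
proof -
  have "cos_kernel \<kappa> x y / q y \<le> soft_potential \<kappa> N Y q x"
    unfolding soft_potential_def using assms by (intro lse_ge[of N Y y "\<lambda>y. cos_kernel \<kappa> x y / q y"])
  thus ?thesis using assms by (simp add: field_simps)
qed

text \<open>\<open>t\<close> is a partition of unity made from tent functions of radius
  \<open>d\<close> around the points of \<open>Y\<close>, so \<open>t y z\<close> vanishes unless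
  \<open>y\<close> is so close to \<open>z\<close> that the kernel changes by less than
  \<open>e\<close>.\<close>

lemma cos_kernel_net:
  fixes \<Omega> :: "'a::euclidean_space set"
  assumes \<Omega>: "compact \<Omega>" "\<Omega> \<noteq> {}" and \<kappa>: "0 < \<kappa>" and e: "0 < e"
  obtains Y t where "finite Y" "Y \<noteq> {}" "Y \<subseteq> \<Omega>" "\<And>x. x \<in> \<Omega> \<Longrightarrow> \<exists>y\<in>Y. 0 < cos_kernel \<kappa> x y"
    "\<And>y. y \<in> Y \<Longrightarrow> continuous_on \<Omega> (t y)" "\<And>y z. y \<in> Y \<Longrightarrow> z \<in> \<Omega> \<Longrightarrow> 0 \<le> (t y z :: real)"
    "\<And>z. z \<in> \<Omega> \<Longrightarrow> (\<Sum>y\<in>Y. t y z) = 1"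
    "\<And>x z. x \<in> \<Omega> \<Longrightarrow> z \<in> \<Omega> \<Longrightarrow> cos_kernel \<kappa> x z - e \<le> (\<Sum>y\<in>Y. t y z * cos_kernel \<kappa> x y)"
proof -
  have "continuous_on (\<Omega> \<times> \<Omega>) (\<lambda>p. cos_kernel \<kappa> (fst p) (snd p))"
    by (intro continuous_intros)
  hence "uniformly_continuous_on (\<Omega> \<times> \<Omega>) (\<lambda>p. cos_kernel \<kappa> (fst p) (snd p))"
    using \<Omega> by (intro compact_uniformly_continuous compact_Times)
  then obtain d0 where d0: "d0 > 0" "\<And>p p'. p \<in> \<Omega> \<times> \<Omega> \<Longrightarrow> p' \<in> \<Omega> \<times> \<Omega> \<Longrightarrow> dist p' p < d0 \<Longrightarrow>
      dist (cos_kernel \<kappa> (fst p') (snd p')) (cos_kernel \<kappa> (fst p) (snd p)) < e"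
    unfolding uniformly_continuous_on_def using e by meson
  \<comment> \<open>The kernel is positive at distances below \<open>\<kappa> * pi / 2\<close>,
    which yields the covering condition.\<close>
  define d where "d = min d0 (\<kappa> * pi / 2)"
  have d: "d > 0" using d0 \<kappa> by (simp add: d_def)
  have K: "cos_kernel \<kappa> x z - e \<le> cos_kernel \<kappa> x y" if "x \<in> \<Omega>" "y \<in> \<Omega>" "z \<in> \<Omega>" "dist z y < d" for x y z
    using d0(2)[of "(x, y)" "(x, z)"] that by (simp add: d_def dist_Pair_Pair dist_real_def)
  obtain Y where Y: "Y \<subseteq> \<Omega>" "finite Y" "\<Omega> \<subseteq> (\<Union>y\<in>Y. ball y d)"
    by (rule compactE_image[OF \<Omega>(1), of \<Omega> "\<lambda>y. ball y d"]) (use d in auto)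
  have ex: "\<exists>y\<in>Y. dist z y < d" if z: "z \<in> \<Omega>" for z
  proof -
    obtain y where "y \<in> Y" "z \<in> ball y d" using Y(3) z by blast
    thus ?thesis by (auto simp: dist_commute)
  qed
  define s where "s y z = max 0 (d - dist z y)" for y z :: 'a
  have s0: "0 \<le> s y z" for y z by (simp add: s_def)
  have S: "0 < (\<Sum>y\<in>Y. s y z)" if z: "z \<in> \<Omega>" for z
  proof -
    obtain y where y: "y \<in> Y" "dist z y < d" using ex[OF z] by auto
    show ?thesis using Y s0 y by (intro sum_pos2[OF Y(2) y(1)]) (auto simp: s_def)
  qed
  define t where "t y z = s y z / (\<Sum>y\<in>Y. s y z)" for y z
  have t0: "0 \<le> t y z" for y z unfolding t_def using s0 by (intro divide_nonneg_nonneg sum_nonneg)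
  have t1: "(\<Sum>y\<in>Y. t y z) = 1" if "z \<in> \<Omega>" for z
    using S[OF that] by (simp add: t_def flip: sum_divide_distrib)
  show thesis
  proof
    show "Y \<noteq> {}" using Y \<Omega> by auto
    show "\<exists>y\<in>Y. 0 < cos_kernel \<kappa> x y" if x: "x \<in> \<Omega>" for x
    proof -
      obtain y where y: "y \<in> Y" "dist x y < d" using ex[OF x] by auto
      hence "\<bar>norm (x - y) / \<kappa>\<bar> < pi / 2" using \<kappa> by (simp add: dist_norm d_def field_simps)
      hence "0 < cos_kernel \<kappa> x y" unfolding cos_kernel_def by (intro zero_less_power Cos_pos)
      thus ?thesis using y by auto
    qed
    show "continuous_on \<Omega> (t y)" for y
      unfolding t_def s_def[abs_def] using S by (intro continuous_intros) (force simp: s_def)+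
    show "cos_kernel \<kappa> x z - e \<le> (\<Sum>y\<in>Y. t y z * cos_kernel \<kappa> x y)" if "x \<in> \<Omega>" "z \<in> \<Omega>" for x z
    proof -
      have "cos_kernel \<kappa> x z - e = (\<Sum>y\<in>Y. t y z * (cos_kernel \<kappa> x z - e))"
        using t1[OF that(2)] by (simp flip: sum_distrib_right)
      also have "\<dots> \<le> (\<Sum>y\<in>Y. t y z * cos_kernel \<kappa> x y)"
      proof (intro sum_mono)
        fix y assume y: "y \<in> Y"
        show "t y z * (cos_kernel \<kappa> x z - e) \<le> t y z * cos_kernel \<kappa> x y"
        proof (cases "dist z y < d")
          case True
          thus ?thesis using K y Y that t0 by (intro mult_left_mono) auto
        qed (simp add: t_def s_def)
      qed
      finally show ?thesis .
    qed
  qed (use Y t0 t1 in auto)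
qed

text \<open>The dual pair is obtained from softmax-averaged potentials (the constraint \<open>p q \<ge> k\<close> is convex), by
  interpolating \<open>q\<close> from the net \<open>Y\<close> to \<open>\<Omega>\<close>. The resulting error is absorbed by adding \<open>\<epsilon>\<close> to
  both factors and rescaling them by \<open>1 + \<epsilon>\<close>.\<close>

lemma barycentre_duality_le:
  fixes \<Omega> :: "'a::euclidean_space set" and M \<kappa> :: real
  assumes \<Omega>: "compact \<Omega>" "\<Omega> \<noteq> {}" and M: "0 < M" and \<kappa>: "0 < \<kappa>"
    and \<Lambda>: "\<Lambda> \<in> borel_prob_measures (mass_ball_top \<Omega> M)" and e: "0 < e"
  obtains \<nu> \<Psi> \<Phi> where "\<nu> \<in> radon_measures \<Omega>" "(\<Psi>, \<Phi>) \<in> dual_admissible \<kappa> \<Omega> M \<Lambda>"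
    "(\<integral>\<^sup>+ \<mu>. HK2 \<kappa> \<Omega> \<mu> \<nu> \<partial>\<Lambda>) \<le> ennreal ((LINT \<mu>|\<Lambda>. (LINT x|\<mu>. \<Psi> \<mu> x)) + e)"
proof -
  interpret prob_space \<Lambda> using \<Lambda> by (rule borel_prob_measuresD)
  have sp: "space \<Lambda> = mass_ball \<Omega> M" using borel_prob_measuresD(2)[OF \<Lambda>] by simp
  \<comment> \<open>The rescaled potentials lose at most \<open>\<epsilon> * (1 + 3 * M)\<close>:
    the part \<open>\<epsilon>\<close> from \<open>(1 + \<epsilon>) * I\<close> with
    \<open>I \<ge> - 1\<close>, and the part \<open>3 * \<epsilon> * M\<close> from the constant
    \<open>2 * \<epsilon> + \<epsilon>\<^sup>2\<close>.\<close>
  define \<epsilon> where "\<epsilon> = min 1 (e / (2 * (1 + 3 * M)))"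
  have \<epsilon>: "0 < \<epsilon>" "\<epsilon> \<le> 1" using e M by (auto simp: \<epsilon>_def)
  have \<epsilon>e: "\<epsilon> * (1 + 3 * M) \<le> e / 2"
  proof -
    have "\<epsilon> * (1 + 3 * M) \<le> e / (2 * (1 + 3 * M)) * (1 + 3 * M)"
      using M by (intro mult_right_mono) (auto simp: \<epsilon>_def)
    also have "\<dots> = e / 2" using M by (simp add: field_simps)
    finally show ?thesis .
  qed
  obtain Y t where Y: "finite Y" "Y \<noteq> {}" "Y \<subseteq> \<Omega>"
    and cover: "\<And>x. x \<in> \<Omega> \<Longrightarrow> \<exists>y\<in>Y. 0 < cos_kernel \<kappa> x y"
    and tc: "\<And>y. y \<in> Y \<Longrightarrow> continuous_on \<Omega> (t y)"
    and t0: "\<And>y z. y \<in> Y \<Longrightarrow> z \<in> \<Omega> \<Longrightarrow> 0 \<le> (t y z :: real)"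
    and t1: "\<And>z. z \<in> \<Omega> \<Longrightarrow> (\<Sum>y\<in>Y. t y z) = 1"
    and tK: "\<And>x z. x \<in> \<Omega> \<Longrightarrow> z \<in> \<Omega> \<Longrightarrow> cos_kernel \<kappa> x z - \<epsilon>\<^sup>2 \<le> (\<Sum>y\<in>Y. t y z * cos_kernel \<kappa> x y)"
  proof (rule cos_kernel_net[OF \<Omega> \<kappa>, of "\<epsilon>\<^sup>2"])
    show "0 < \<epsilon>\<^sup>2" using \<epsilon> by simp
    fix Y and t :: "'a \<Rightarrow> 'a \<Rightarrow> real"
    assume "finite Y" "Y \<noteq> {}" "Y \<subseteq> \<Omega>" "\<And>x. x \<in> \<Omega> \<Longrightarrow> \<exists>y\<in>Y. 0 < cos_kernel \<kappa> x y"
      "\<And>y. y \<in> Y \<Longrightarrow> continuous_on \<Omega> (t y)" "\<And>y z. y \<in> Y \<Longrightarrow> z \<in> \<Omega> \<Longrightarrow> 0 \<le> t y z"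
      "\<And>z. z \<in> \<Omega> \<Longrightarrow> (\<Sum>y\<in>Y. t y z) = 1"
      "\<And>x z. x \<in> \<Omega> \<Longrightarrow> z \<in> \<Omega> \<Longrightarrow> cos_kernel \<kappa> x z - \<epsilon>\<^sup>2 \<le> (\<Sum>y\<in>Y. t y z * cos_kernel \<kappa> x y)"
    thus thesis by (rule that)
  qed
  define J where "J = real (card Y)"
  have J: "J \<ge> 1" using Y by (simp add: J_def Suc_le_eq card_gt_0_iff)
  \<comment> \<open>Four errors \<open>e1\<close> accumulate: from the net \<open>G\<close>, from
    \<open>N\<close>, from \<open>n\<close> and from the lower bound \<open>\<eta>\<close> of the
    weights. The bound \<open>1 / 3\<close> yields \<open>I \<ge> - 1\<close>.\<close>
  define e1 where "e1 = min (1 / 3) (e / 8)"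
  have e1: "0 < e1" "e1 \<le> 1 / 3" "e1 \<le> e / 8" using e by (auto simp: e1_def)
  define N where "N = M * ln J / e1 + 1"
  have N: "0 < N" using M J e1 by (simp add: N_def add_nonneg_pos)
  have NJ: "M * ln (card Y) / N \<le> e1"
  proof -
    have "M * ln J \<le> e1 * N" using e1 by (simp add: N_def field_simps)
    thus ?thesis using N by (simp add: J_def divide_le_eq mult.commute)
  qed
  define \<eta> where "\<eta> = e1 / J"
  have \<eta>: "0 < \<eta>" "\<eta> * card Y = e1" using e1 J by (auto simp: \<eta>_def J_def)
  define X where "X = M * (2 + ln (card Y) / N) + M + \<eta> * card Y"
  \<comment> \<open>\<open>R\<close> comes before \<open>G\<close>, so
    \<open>ln (card G) / n\<close> is anticipated here by the summand 1 next to
    \<open>X\<close>.\<close>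
  define R where "R = 2 * (X + 1) + 1 + \<eta>"
  have lnN: "0 \<le> ln (card Y) / N" using J N by (simp add: J_def)
  have \<eta>R: "\<eta> \<le> R"
  proof -
    have "0 \<le> M * (2 + ln (card Y) / N)" using M lnN by (intro mult_nonneg_nonneg) auto
    thus ?thesis using M \<eta> e1 by (simp add: R_def X_def)
  qed
  obtain G where G: "finite G" "\<And>q y. q \<in> G \<Longrightarrow> y \<in> Y \<Longrightarrow> 0 < q y" "(\<lambda>_. 1) \<in> G" "(\<lambda>_. 1 / 2) \<in> G"
    and hk: "\<And>\<mu> v. \<mu> \<in> radon_measures \<Omega> \<Longrightarrow> measure \<mu> \<Omega> \<le> M \<Longrightarrow> \<forall>y\<in>Y. v y \<in> {\<eta>..R} \<Longrightarrow>
       \<exists>q\<in>G. HK2 \<kappa> \<Omega> \<mu> (discrete_measure \<Omega> Y v)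
         \<le> ennreal (dual_value \<kappa> N Y v \<mu> q + e1 + M * ln (card Y) / N)"
  proof (rule finite_dual_net[OF \<Omega>(1) \<kappa> Y cover \<eta>(1) \<eta>R N M e1(1)])
    fix G
    assume "finite G" "\<And>q y. q \<in> G \<Longrightarrow> y \<in> Y \<Longrightarrow> 0 < q y" "(\<lambda>_. 1) \<in> G" "(\<lambda>_. 1 / 2) \<in> G"
      "\<And>\<mu> v. \<mu> \<in> radon_measures \<Omega> \<Longrightarrow> measure \<mu> \<Omega> \<le> M \<Longrightarrow> \<forall>y\<in>Y. v y \<in> {\<eta>..R} \<Longrightarrow>
       \<exists>q\<in>G. HK2 \<kappa> \<Omega> \<mu> (discrete_measure \<Omega> Y v)
         \<le> ennreal (dual_value \<kappa> N Y v \<mu> q + e1 + M * ln (card Y) / N)"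
    thus thesis by (rule that)
  qed
  have Gne: "G \<noteq> {}" using G by auto
  define n where "n = ln (card G) / e1 + 1"
  have lnG: "0 \<le> ln (card G)" using G Gne by (simp add: Suc_le_eq card_gt_0_iff)
  have n: "0 < n" using lnG e1 by (simp add: n_def add_nonneg_pos)
  have nG: "ln (card G) / n \<le> e1"
  proof -
    have "ln (card G) \<le> e1 * n" using e1 by (simp add: n_def field_simps)
    thus ?thesis using n by (simp add: divide_le_eq mult.commute)
  qed
  have Rge: "M * (2 + ln (card Y) / N) + M + \<eta> * card Y + ln (card G) / n < R / 2"
  proof -
    have "ln (card G) / n \<le> 1" using nG e1 by linarith
    moreover have "R / 2 = X + 3 / 2 + \<eta> / 2" by (simp add: R_def)
    ultimately show ?thesis using \<eta>(1) unfolding X_def[symmetric] by linarith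
  qed
  obtain v where v: "\<forall>y\<in>Y. v y \<in> {\<eta>..R}"
    and kkt: "\<And>y. y \<in> Y \<Longrightarrow> 0 \<le> (LINT \<mu>|\<Lambda>. (\<Sum>q\<in>G. softmax n G (dual_value \<kappa> N Y v \<mu>) q * (1 - q y)))"
    and il: "integrable \<Lambda> (\<lambda>\<mu>. lse n G (dual_value \<kappa> N Y v \<mu>))"
    and val: "(LINT \<mu>|\<Lambda>. lse n G (dual_value \<kappa> N Y v \<mu>)) \<le>
      (LINT \<mu>|\<Lambda>. (\<Sum>q\<in>G. softmax n G (dual_value \<kappa> N Y v \<mu>) q * (LINT x|\<mu>. 1 - soft_potential \<kappa> N Y q x)))
      + ln (card G) / n + \<eta> * card Y"
  proof (rule outer_minimiser[where G = G and Y = Y, OF \<Omega>(1) Y(1,2) \<Lambda> N n G(1) _ G(4) \<eta>(1) \<eta>R Rge])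
    show "0 < q y" if "q \<in> G" "y \<in> Y" for q y by (rule G(2)[OF that])
    fix v
    assume "\<forall>y\<in>Y. v y \<in> {\<eta>..R}"
    "\<And>y. y \<in> Y \<Longrightarrow> 0 \<le> (LINT \<mu>|\<Lambda>. (\<Sum>q\<in>G. softmax n G (dual_value \<kappa> N Y v \<mu>) q * (1 - q y)))"
    "integrable \<Lambda> (\<lambda>\<mu>. lse n G (dual_value \<kappa> N Y v \<mu>))"
    "(LINT \<mu>|\<Lambda>. lse n G (dual_value \<kappa> N Y v \<mu>)) \<le>
      (LINT \<mu>|\<Lambda>. (\<Sum>q\<in>G. softmax n G (dual_value \<kappa> N Y v \<mu>) q * (LINT x|\<mu>. 1 - soft_potential \<kappa> N Y q x)))
      + ln (card G) / n + \<eta> * card Y"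
    thus thesis by (rule that)
  qed
  define ch where "ch \<mu> = softmax n G (dual_value \<kappa> N Y v \<mu>)" for \<mu>
  define A where "A q \<mu> = (LINT x|\<mu>. 1 - soft_potential \<kappa> N Y q x)" for q and \<mu> :: "'a measure"
  define I where "I = (LINT \<mu>|\<Lambda>. (\<Sum>q\<in>G. ch \<mu> q * A q \<mu>))"
  let ?T = "mass_ball_top \<Omega> M"
  have qne: "q y \<noteq> 0" if "q \<in> G" "y \<in> Y" for q y using G(2)[OF that] by simp
  have cch: "continuous_map ?T euclideanreal (\<lambda>\<mu>. ch \<mu> q)" if "q \<in> G" for q
    unfolding ch_def using that G(1) Y qne by (intro continuous_map_softmax continuous_map_dual_value) auto
  have cA: "continuous_map ?T euclideanreal (A q)" if "q \<in> G" for q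
    unfolding A_def[abs_def] using that G(1) Y qne by (intro continuous_map_dual_value) auto
  have ch01: "0 \<le> ch \<mu> q" "ch \<mu> q \<le> 1" if "q \<in> G" for \<mu> q
    using softmax_nonneg softmax_le_1[OF G(1) that] by (auto simp: ch_def)
  have ch1: "(\<Sum>q\<in>G. ch \<mu> q) = 1" for \<mu>
    unfolding ch_def using G Gne by (intro sum_softmax) auto
  have ich: "integrable \<Lambda> (\<lambda>\<mu>. ch \<mu> q)" if "q \<in> G" for q
    using ch01[OF that] by (intro integrable_continuous_map[OF \<Lambda> cch[OF that], of 1]) auto
  have rad: "\<mu> \<in> radon_measures \<Omega>" "measure \<mu> \<Omega> \<le> M" if "\<mu> \<in> mass_ball \<Omega> M" for \<mu>
    using that by (auto simp: mass_ball_def)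
  let ?D = "discrete_measure \<Omega> Y v"
  \<comment> \<open>The constant 1 in \<open>G\<close> annihilates the sum over \<open>Y\<close>.
    The resulting lower bound makes the integrand \<open>lse + 2 * e1\<close> nonnegative, so that
    its \<open>ennreal\<close> integral below is an ordinary one.\<close>
  have lse_lo: "- e1 \<le> lse n G (dual_value \<kappa> N Y v \<mu>)" if \<mu>: "\<mu> \<in> mass_ball \<Omega> M" for \<mu>
  proof -
    let ?one = "\<lambda>_::'a. 1 :: real"
    have "M * (1 - (1 / 1 + ln (card Y) / N)) \<le> (LINT x|\<mu>. 1 - soft_potential \<kappa> N Y ?one x)"
      using lnN by (intro integral_soft_potential_bounds(2)[OF \<Omega>(1) \<mu> N Y(1,2)]) auto
    also have "\<dots> = dual_value \<kappa> N Y v \<mu> ?one" by (simp add: dual_value_def)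
    also have "\<dots> \<le> lse n G (dual_value \<kappa> N Y v \<mu>)" by (rule lse_ge[OF n G(1,3)])
    finally show ?thesis using NJ by simp
  qed
  have "HK2 \<kappa> \<Omega> \<mu> ?D \<le> ennreal (lse n G (dual_value \<kappa> N Y v \<mu>) + 2 * e1)" if \<mu>: "\<mu> \<in> mass_ball \<Omega> M" for \<mu>
  proof -
    obtain q where q: "q \<in> G" and h: "HK2 \<kappa> \<Omega> \<mu> ?D \<le> ennreal (dual_value \<kappa> N Y v \<mu> q + e1 + M * ln (card Y) / N)"
      using hk[OF rad[OF \<mu>] v] by auto
    have "dual_value \<kappa> N Y v \<mu> q + e1 + M * ln (card Y) / N \<le> lse n G (dual_value \<kappa> N Y v \<mu>) + 2 * e1"
      using lse_ge[OF n G(1) q, of "dual_value \<kappa> N Y v \<mu>"] NJ by linarith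
    from order_trans[OF h ennreal_leI[OF this]] show ?thesis .
  qed
  hence "(\<integral>\<^sup>+ \<mu>. HK2 \<kappa> \<Omega> \<mu> ?D \<partial>\<Lambda>) \<le> (\<integral>\<^sup>+ \<mu>. ennreal (lse n G (dual_value \<kappa> N Y v \<mu>) + 2 * e1) \<partial>\<Lambda>)"
    using sp by (intro nn_integral_mono) auto
  also have "\<dots> = ennreal (LINT \<mu>|\<Lambda>. lse n G (dual_value \<kappa> N Y v \<mu>) + 2 * e1)"
    using il lse_lo sp e1 by (intro nn_integral_eq_integral) (fastforce intro!: AE_I2)+
  also have "(LINT \<mu>|\<Lambda>. lse n G (dual_value \<kappa> N Y v \<mu>) + 2 * e1) = (LINT \<mu>|\<Lambda>. lse n G (dual_value \<kappa> N Y v \<mu>)) + 2 * e1"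
    using il by (simp add: prob_space)
  also have "\<dots> \<le> I + 4 * e1"
    using val nG \<eta>(2) unfolding I_def ch_def A_def by linarith
  finally have primal: "(\<integral>\<^sup>+ \<mu>. HK2 \<kappa> \<Omega> \<mu> ?D \<partial>\<Lambda>) \<le> ennreal (I + 4 * e1)" by (simp add: ennreal_leI)
  have "(LINT \<mu>|\<Lambda>. - e1) \<le> (LINT \<mu>|\<Lambda>. lse n G (dual_value \<kappa> N Y v \<mu>))"
    using il lse_lo sp by (intro integral_mono) auto
  hence Ilo: "- 1 \<le> I"
    using val nG \<eta>(2) e1 unfolding I_def ch_def A_def by (simp add: prob_space)
  define P where "P \<mu> x = (\<Sum>q\<in>G. ch \<mu> q * soft_potential \<kappa> N Y q x)" for \<mu> x
  define Q where "Q \<mu> y = (\<Sum>q\<in>G. ch \<mu> q * q y)" for \<mu> y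
  \<comment> \<open>Adding \<open>\<epsilon>\<close> to both factors gains at least
    \<open>\<epsilon>\<^sup>2\<close> in their product, which is the loss in \<open>tK\<close>. The
    shift raises the \<open>\<Lambda>\<close>-mean of the second factor to at most
    \<open>1 + \<epsilon>\<close>; dividing by that restores the constraint on
    \<open>\<Phi>\<close>, and the first factor is multiplied by it to keep the product.\<close>
  define \<Psi> where "\<Psi> \<mu> x = 1 - (P \<mu> x + \<epsilon>) * (1 + \<epsilon>)" for \<mu> x
  define \<Phi> where "\<Phi> \<mu> z = 1 - ((\<Sum>y\<in>Y. t y z * Q \<mu> y) + \<epsilon>) / (1 + \<epsilon>)" for \<mu> z
  have p0: "0 \<le> soft_potential \<kappa> N Y q x" if "q \<in> G" for q x
  proof -
    have l: "0 < Min (q ` Y)" "\<And>y. y \<in> Y \<Longrightarrow> Min (q ` Y) \<le> q y"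
      using Y G(2)[OF that] by auto
    show ?thesis by (rule soft_potential_bounds(1)[where q = q, OF N Y(1,2) l])
  qed
  have P0: "0 \<le> P \<mu> x" for \<mu> x unfolding P_def using ch01 p0 by (intro sum_nonneg mult_nonneg_nonneg)
  have Q0: "0 \<le> Q \<mu> y" if "y \<in> Y" for \<mu> y
    unfolding Q_def using ch01 G(2) that by (intro sum_nonneg mult_nonneg_nonneg) (auto simp: less_imp_le)
  have PQ: "cos_kernel \<kappa> x y \<le> P \<mu> x * Q \<mu> y" if "y \<in> Y" for \<mu> x y
    unfolding P_def Q_def using ch01 ch1 p0 G(2) that Y N
    by (intro weighted_product_ge cos_kernel_bounds soft_potential_mult_ge) (auto simp: less_imp_le)
  have prod: "cos_kernel \<kappa> x z \<le> (1 - \<Psi> \<mu> x) * (1 - \<Phi> \<mu> z)" if x: "x \<in> \<Omega>" and z: "z \<in> \<Omega>" for \<mu> x z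
  proof -
    let ?q = "\<Sum>y\<in>Y. t y z * Q \<mu> y"
    have q0: "0 \<le> ?q" using t0 Q0 z by (intro sum_nonneg mult_nonneg_nonneg) auto
    have "cos_kernel \<kappa> x z - \<epsilon>\<^sup>2 \<le> (\<Sum>y\<in>Y. t y z * cos_kernel \<kappa> x y)" by (rule tK[OF x z])
    also have "\<dots> \<le> (\<Sum>y\<in>Y. t y z * (P \<mu> x * Q \<mu> y))"
      using t0 z PQ by (intro sum_mono mult_left_mono) auto
    also have "\<dots> = P \<mu> x * ?q" by (simp add: sum_distrib_left mult_ac)
    finally have "cos_kernel \<kappa> x z \<le> P \<mu> x * ?q + \<epsilon> * \<epsilon>" by (simp add: power2_eq_square)
    also have "\<dots> \<le> (P \<mu> x + \<epsilon>) * (?q + \<epsilon>)"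
      using P0[of \<mu> x] q0 \<epsilon> by (simp add: algebra_simps)
    also have "\<dots> = (1 - \<Psi> \<mu> x) * (1 - \<Phi> \<mu> z)" using \<epsilon> by (simp add: \<Psi>_def \<Phi>_def)
    finally show ?thesis .
  qed
  have csp: "continuous_on \<Omega> (soft_potential \<kappa> N Y q)" if "q \<in> G" for q
    using qne that Y by (intro continuous_on_soft_potential) auto
  let ?X = "prod_topology ?T (top_of_set \<Omega>)"
  have fstc: "continuous_map ?X euclideanreal (\<lambda>p. f (fst p))" if "continuous_map ?T euclideanreal f" for f
    using continuous_map_compose[OF continuous_map_fst that] by (simp add: comp_def)
  have sndc: "continuous_map ?X euclideanreal (\<lambda>p. f (snd p))" if "continuous_on \<Omega> f" for f
  proof -
    have "continuous_map (top_of_set \<Omega>) euclideanreal f" using that by simp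
    from continuous_map_compose[OF continuous_map_snd this] show ?thesis by (simp add: comp_def)
  qed
  have adm: "(\<Psi>, \<Phi>) \<in> dual_admissible \<kappa> \<Omega> M \<Lambda>"
    unfolding dual_admissible_def
  proof (clarify, intro conjI ballI)
    show "continuous_map ?X euclideanreal (\<lambda>(\<mu>, x). \<Psi> \<mu> x)"
      unfolding \<Psi>_def P_def case_prod_beta using G(1) cch csp fstc sndc
      by (intro continuous_map_diff continuous_map_real_mult continuous_map_add continuous_map_sum continuous_map_canonical_const) auto
    show "continuous_map ?X euclideanreal (\<lambda>(\<mu>, z). \<Phi> \<mu> z)"
      unfolding \<Phi>_def Q_def case_prod_beta divide_inverse using G(1) cch tc Y fstc sndc
      by (intro continuous_map_diff continuous_map_real_mult continuous_map_add continuous_map_sum continuous_map_canonical_const) auto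
    show "(\<Psi> \<mu>, \<Phi> \<mu>) \<in> Q_set \<kappa> \<Omega>" if "\<mu> \<in> mass_ball \<Omega> M" for \<mu>
    proof -
      have "continuous_on \<Omega> (\<Psi> \<mu>)"
        unfolding \<Psi>_def[abs_def] P_def using csp by (intro continuous_intros) auto
      moreover have "continuous_on \<Omega> (\<Phi> \<mu>)"
        unfolding \<Phi>_def[abs_def] using tc \<epsilon> by (intro continuous_intros) auto
      moreover have "\<Psi> \<mu> x \<le> 1" for x using P0[of \<mu> x] \<epsilon> by (simp add: \<Psi>_def)
      moreover have "\<Phi> \<mu> z \<le> 1" if "z \<in> \<Omega>" for z
      proof -
        have "0 \<le> (\<Sum>y\<in>Y. t y z * Q \<mu> y)" using t0 Q0 that by (intro sum_nonneg mult_nonneg_nonneg) auto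
        thus ?thesis using \<epsilon> by (simp add: \<Phi>_def)
      qed
      ultimately show ?thesis using prod by (simp add: Q_set_def cos_kernel_def)
    qed
    show "0 \<le> (LINT \<mu>|\<Lambda>. \<Phi> \<mu> z)" if z: "z \<in> \<Omega>" for z
    proof -
      have iQ: "integrable \<Lambda> (\<lambda>\<mu>. Q \<mu> y)" for y unfolding Q_def using ich by auto
      have "(LINT \<mu>|\<Lambda>. Q \<mu> y) \<le> 1" if y: "y \<in> Y" for y
      proof -
        have "(\<Sum>q\<in>G. ch \<mu> q * (1 - q y)) = 1 - Q \<mu> y" for \<mu>
          by (simp add: right_diff_distrib sum_subtractf ch1 Q_def)
        hence "0 \<le> (LINT \<mu>|\<Lambda>. 1 - Q \<mu> y)" using kkt[OF y] unfolding ch_def[symmetric] by simp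
        thus ?thesis using iQ by (simp add: prob_space)
      qed
      hence "(\<Sum>y\<in>Y. t y z * (LINT \<mu>|\<Lambda>. Q \<mu> y)) \<le> (\<Sum>y\<in>Y. t y z * 1)"
        using t0 z by (intro sum_mono mult_left_mono) auto
      hence "(\<Sum>y\<in>Y. t y z * (LINT \<mu>|\<Lambda>. Q \<mu> y)) \<le> 1" using t1[OF z] by simp
      moreover have "(LINT \<mu>|\<Lambda>. \<Phi> \<mu> z) = 1 - ((\<Sum>y\<in>Y. t y z * (LINT \<mu>|\<Lambda>. Q \<mu> y)) + \<epsilon>) / (1 + \<epsilon>)"
        unfolding \<Phi>_def using iQ by (simp add: prob_space)
      ultimately show ?thesis using \<epsilon> by simp
    qed
  qed
  have A_bd: "\<exists>c. \<forall>\<mu>\<in>mass_ball \<Omega> M. \<bar>ch \<mu> q * A q \<mu>\<bar> \<le> c" if q: "q \<in> G" for q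
  proof -
    have l: "0 < Min (q ` Y)" "\<And>y. y \<in> Y \<Longrightarrow> Min (q ` Y) \<le> q y"
      using Y G(2)[OF q] by auto
    let ?c = "M + M * (1 / Min (q ` Y) + ln (card Y) / N)"
    have "\<bar>ch \<mu> q * A q \<mu>\<bar> \<le> ?c" if "\<mu> \<in> mass_ball \<Omega> M" for \<mu>
    proof -
      have "0 \<le> M * (1 / Min (q ` Y) + ln (card Y) / N)" using l lnN M by simp
      hence "\<bar>A q \<mu>\<bar> \<le> ?c"
        using integral_soft_potential_bounds(1,3)[where q = q and \<kappa> = \<kappa>, OF \<Omega>(1) that N Y(1,2) l] M
        unfolding A_def[symmetric] by linarith
      thus ?thesis using ch01[OF q, of \<mu>] mult_mono[of "\<bar>ch \<mu> q\<bar>" 1 "\<bar>A q \<mu>\<bar>" ?c] by (auto simp: abs_mult)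
    qed
    thus ?thesis by blast
  qed
  have iA: "integrable \<Lambda> (\<lambda>\<mu>. ch \<mu> q * A q \<mu>)" if "q \<in> G" for q
    using A_bd[OF that] that cch cA 
    by (auto intro!: integrable_continuous_map[OF \<Lambda>] continuous_map_real_mult)
  have m: "(LINT x|\<mu>. 1) = measure \<mu> \<Omega>" if "\<mu> \<in> mass_ball \<Omega> M" for \<mu>
    using radon_measuresD(3)[OF rad(1)[OF that]] by simp
  have "continuous_map ?T euclideanreal (\<lambda>\<mu>. LINT x|\<mu>. 1)"
    by (intro continuous_map_mass_ball_integral continuous_intros)
  hence cm: "continuous_map ?T euclideanreal (\<lambda>\<mu>. measure \<mu> \<Omega>)"
    by (rule continuous_map_eq) (use m in auto)
  have im: "integrable \<Lambda> (\<lambda>\<mu>. measure \<mu> \<Omega>)"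
    using rad by (intro integrable_continuous_map[OF \<Lambda> cm, of M]) auto
  have \<Psi>int: "(LINT x|\<mu>. \<Psi> \<mu> x) = (1 + \<epsilon>) * (\<Sum>q\<in>G. ch \<mu> q * A q \<mu>) - (2 * \<epsilon> + \<epsilon>\<^sup>2) * measure \<mu> \<Omega>"
    if \<mu>: "\<mu> \<in> mass_ball \<Omega> M" for \<mu>
  proof -
    interpret mu: finite_measure \<mu> using radon_measuresD(2)[OF rad(1)[OF \<mu>]] .
    have i: "integrable \<mu> (\<lambda>x. 1 - soft_potential \<kappa> N Y q x)" if "q \<in> G" for q
      using csp[OF that] by (intro radon_integrable_continuous[OF rad(1)[OF \<mu>] _ \<Omega>(1)] continuous_intros)
    \<comment> \<open>The softmax weights sum to 1, so \<open>1 - P \<mu> x\<close> is the average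
      of the values \<open>1 - soft_potential \<kappa> N Y q x\<close>.\<close>
    have "\<Psi> \<mu> x = (1 + \<epsilon>) * (\<Sum>q\<in>G. ch \<mu> q * (1 - soft_potential \<kappa> N Y q x)) - (2 * \<epsilon> + \<epsilon>\<^sup>2) * 1" for x
      by (simp add: \<Psi>_def right_diff_distrib sum_subtractf ch1 P_def[symmetric]) (simp add: algebra_simps power2_eq_square)
    hence "(LINT x|\<mu>. \<Psi> \<mu> x) = (LINT x|\<mu>. (1 + \<epsilon>) * (\<Sum>q\<in>G. ch \<mu> q * (1 - soft_potential \<kappa> N Y q x)) - (2 * \<epsilon> + \<epsilon>\<^sup>2) * 1)"
      by simp
    also have "\<dots> = (1 + \<epsilon>) * (LINT x|\<mu>. (\<Sum>q\<in>G. ch \<mu> q * (1 - soft_potential \<kappa> N Y q x))) - (2 * \<epsilon> + \<epsilon>\<^sup>2) * measure \<mu> \<Omega>"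
      using i m[OF \<mu>] by (subst Bochner_Integration.integral_diff) (auto intro!: Bochner_Integration.integrable_sum)
    also have "(LINT x|\<mu>. (\<Sum>q\<in>G. ch \<mu> q * (1 - soft_potential \<kappa> N Y q x))) = (\<Sum>q\<in>G. ch \<mu> q * A q \<mu>)"
      unfolding A_def using i by (subst Bochner_Integration.integral_sum) auto
    finally show ?thesis .
  qed
  have "(LINT \<mu>|\<Lambda>. (LINT x|\<mu>. \<Psi> \<mu> x)) = (LINT \<mu>|\<Lambda>. (1 + \<epsilon>) * (\<Sum>q\<in>G. ch \<mu> q * A q \<mu>) - (2 * \<epsilon> + \<epsilon>\<^sup>2) * measure \<mu> \<Omega>)"
    using \<Psi>int sp by (intro Bochner_Integration.integral_cong) auto
  also have "\<dots> = (1 + \<epsilon>) * I - (2 * \<epsilon> + \<epsilon>\<^sup>2) * (LINT \<mu>|\<Lambda>. measure \<mu> \<Omega>)"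
    unfolding I_def using iA im by (subst Bochner_Integration.integral_diff) (auto intro!: Bochner_Integration.integrable_sum)
  finally have \<Psi>val: "(LINT \<mu>|\<Lambda>. (LINT x|\<mu>. \<Psi> \<mu> x)) = (1 + \<epsilon>) * I - (2 * \<epsilon> + \<epsilon>\<^sup>2) * (LINT \<mu>|\<Lambda>. measure \<mu> \<Omega>)" .
  have "(LINT \<mu>|\<Lambda>. measure \<mu> \<Omega>) \<le> (LINT \<mu>|\<Lambda>. M)"
    using im rad sp by (intro integral_mono) auto
  hence mM: "(LINT \<mu>|\<Lambda>. measure \<mu> \<Omega>) \<le> M" by (simp add: prob_space)
  have "(2 * \<epsilon> + \<epsilon>\<^sup>2) * (LINT \<mu>|\<Lambda>. measure \<mu> \<Omega>) \<le> (2 * \<epsilon> + \<epsilon>\<^sup>2) * M"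
    using mM \<epsilon> by (intro mult_left_mono) auto
  also have "\<dots> \<le> (3 * \<epsilon>) * M"
    using \<epsilon> M by (intro mult_right_mono) (auto simp: power2_eq_square)
  finally have 1: "(2 * \<epsilon> + \<epsilon>\<^sup>2) * (LINT \<mu>|\<Lambda>. measure \<mu> \<Omega>) \<le> 3 * \<epsilon> * M" .
  have 2: "\<epsilon> * (- 1) \<le> \<epsilon> * I" using Ilo \<epsilon> by (intro mult_left_mono) auto
  have "I + 4 * e1 \<le> (LINT \<mu>|\<Lambda>. (LINT x|\<mu>. \<Psi> \<mu> x)) + e"
    using 1 2 \<epsilon>e e1(3) unfolding \<Psi>val by (simp add: algebra_simps)
  note order_trans[OF primal ennreal_leI[OF this]]
  moreover have "?D \<in> radon_measures \<Omega>"
    using v \<eta>(1) Y by (intro discrete_measure_radon) force+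
  ultimately show thesis by (intro that[OF _ adm])
qed

section \<open>Sequential compactness of the mass ball\<close>

text \<open>For \<open>c\<close> with values 0 and 1, the point of the Cantor set with ternary
  digits \<open>2 * c m\<close>, \<open>2 * c (m + 1)\<close>, and so on; \<open>m\<close> counts
  the leading digits that are removed.\<close>

definition ternary :: "(nat \<Rightarrow> real) \<Rightarrow> nat \<Rightarrow> real" where
  "ternary c m = (\<Sum>n. 2 * c (n + m) / 3 ^ Suc n)"

lemma
  assumes c: "\<And>n. c n \<in> {0, 1}"
  shows ternary_bounds: "0 \<le> ternary c m" "ternary c m \<le> 1"
    and ternary_Suc: "3 * ternary c m = 2 * c m + ternary c (Suc m)"
proof -
  have c01: "0 \<le> c n" "c n \<le> 1" for n using c[of n] by auto
  have geo: "(\<lambda>n. 2 / 3 ^ Suc n) sums (1::real)"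
    using sums_mult[OF geometric_sums[of "1/3::real"], of "2/3"] by (simp add: power_divide)
  have s: "summable (\<lambda>n. 2 * c (n + m) / 3 ^ Suc n :: real)" for m
    using c01 by (intro summable_comparison_test'[OF sums_summable[OF geo]]) (simp add: divide_right_mono)
  show "0 \<le> ternary c m" unfolding ternary_def using s c01 by (intro suminf_nonneg) auto
  have "ternary c m \<le> (\<Sum>n. 2 / 3 ^ Suc n)"
    unfolding ternary_def using s c01 by (intro suminf_le sums_summable[OF geo]) (auto intro!: divide_right_mono)
  thus "ternary c m \<le> 1" using sums_unique[OF geo] by simp
  have "ternary c m = (\<Sum>n. 2 * c (Suc n + m) / 3 ^ Suc (Suc n)) + 2 * c m / 3"
    unfolding ternary_def using suminf_split_head[OF s[of m]] by simp
  also have "(\<Sum>n. 2 * c (Suc n + m) / 3 ^ Suc (Suc n)) = (\<Sum>n. (1 / 3) * (2 * c (n + Suc m) / 3 ^ Suc n))"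
    by (intro suminf_cong) simp
  also have "\<dots> = (1 / 3) * ternary c (Suc m)"
    unfolding ternary_def by (rule suminf_mult[OF s])
  finally show "3 * ternary c m = 2 * c m + ternary c (Suc m)" by simp
qed

text \<open>All digits are 0 or 2, so the integer split off after multiplication by
  \<open>3 ^ m\<close> is even, hence a multiple of the period of
  \<open>ternary_digit\<close>.\<close>

lemma ternary_shift:
  assumes "\<And>n. c n \<in> {0, 1}"
  shows "\<exists>k::nat. 3 ^ m * ternary c 0 = 2 * real k + ternary c m"
proof (induction m)
  case (Suc m)
  then obtain k where k: "3 ^ m * ternary c 0 = 2 * real k + ternary c m" by auto
  have "3 ^ Suc m * ternary c 0 = 3 * (2 * real k + ternary c m)"
    using k by simp
  also have "\<dots> = 2 * (3 * real k + c m) + ternary c (Suc m)"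
    using ternary_Suc[where c = c, OF assms, of m] by simp
  also have "3 * real k + c m = real (3 * k + (if c m = 0 then 0 else 1))"
    using assms[of m] by auto
  finally show ?case by blast
qed (auto intro: exI[of _ 0])

text \<open>This function has period \<open>2\<close>, is \<open>0\<close> on \<open>[0, 1/3]\<close> and \<open>1\<close> on \<open>[2/3, 1]\<close>, as in Schoenberg's
  space-filling curve.\<close>

definition ternary_digit :: "real \<Rightarrow> real" where
  "ternary_digit t = max 0 (min 1 (1 / 2 - cos (pi * t)))"

lemma ternary_digit_bounds: "0 \<le> ternary_digit t" "ternary_digit t \<le> 1"
  by (auto simp: ternary_digit_def)

text \<open>The leading digit places the tail \<open>ternary c m\<close> in \<open>[0, 1/3]\<close>
  or in \<open>[2/3, 1]\<close>, and \<open>ternary_digit\<close> is constant on each of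
  them.\<close>

lemma ternary_digit_shift:
  assumes "\<And>n. c n \<in> {0, 1}"
  shows "ternary_digit (3 ^ m * ternary c 0) = c m"
proof -
  obtain k where k: "3 ^ m * ternary c 0 = 2 * real k + ternary c m"
    using ternary_shift[where c = c, OF assms] by blast
  have per: "cos (y + real k * (2 * pi)) = cos y" for y k
    by (induction k arbitrary: y) (simp_all add: distrib_right flip: add.assoc)
  have "cos (pi * (2 * real k + ternary c m)) = cos (pi * ternary c m + real k * (2 * pi))"
    by (simp add: algebra_simps)
  also have "\<dots> = cos (pi * ternary c m)"
    by (rule per)
  finally have e: "ternary_digit (3 ^ m * ternary c 0) = ternary_digit (ternary c m)"
    by (simp add: ternary_digit_def k)
  have b: "0 \<le> ternary c n" "ternary c n \<le> 1" for n using ternary_bounds[where c = c, OF assms] by auto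
  have t: "3 * ternary c m = 2 * c m + ternary c (Suc m)" by (rule ternary_Suc[where c = c, OF assms])
  have le: "pi * ternary c m \<le> pi" using b[of m] by (simp add: mult_left_le)
  from assms[of m] show ?thesis
  proof
    assume 0: "c m = 0"
    hence "ternary c m \<le> 1 / 3" using t b[of "Suc m"] by simp
    hence "pi * ternary c m \<le> pi * (1 / 3)" by (intro mult_left_mono) auto
    hence "cos (pi / 3) \<le> cos (pi * ternary c m)"
      using b[of m] by (intro cos_monotone_0_pi_le) auto
    thus ?thesis unfolding e using 0 by (simp add: ternary_digit_def cos_60)
  next
    assume "c m \<in> {1}"
    hence 1: "c m = 1" by simp
    hence "2 / 3 \<le> ternary c m" using t b[of "Suc m"] by simp
    hence "pi * (2 / 3) \<le> pi * ternary c m" by (intro mult_left_mono) auto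
    hence "cos (pi * ternary c m) \<le> cos (2 * pi / 3)"
      using le by (intro cos_monotone_0_pi_le) auto
    thus ?thesis unfolding e using 1 by (simp add: ternary_digit_def cos_120)
  qed
qed

lemma binary_expansion:
  fixes x :: real
  assumes "0 \<le> x" "x \<le> 1"
  obtains a where "\<And>n. a n \<in> {0, 1}" "(\<lambda>n. (1 / 2) ^ Suc n * a n) sums x"
proof -
  \<comment> \<open>\<open>r n\<close> is the remainder after \<open>n\<close> digits, scaled by
    \<open>2 ^ n\<close>. It stays in the closed unit interval; \<open>x = 1\<close> gets all digits
    1.\<close>
  define r where "r = rec_nat x (\<lambda>_ s. if s \<ge> 1 / 2 then 2 * s - 1 else 2 * s)"
  define a where "a n = (if r n \<ge> 1 / 2 then 1 else 0 :: real)" for n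
  have r0: "r 0 = x" and rS: "r (Suc n) = 2 * r n - a n" for n by (auto simp: r_def a_def)
  have r: "0 \<le> r n \<and> r n \<le> 1" for n
    by (induction n) (use assms r0 rS in \<open>auto simp: a_def\<close>)
  have part: "(\<Sum>k<n. (1 / 2) ^ Suc k * a k) = x - (1 / 2) ^ n * r n" for n
    by (induction n) (auto simp: r0 rS field_simps)
  have "(\<lambda>n. (1 / 2) ^ n * r n) \<longlonglongrightarrow> 0"
  proof (rule Lim_null_comparison)
    show "(\<lambda>n. (1 / 2 :: real) ^ n) \<longlonglongrightarrow> 0" by (rule LIMSEQ_realpow_zero) auto
    show "\<forall>\<^sub>F n in sequentially. norm ((1 / 2) ^ n * r n) \<le> (1 / 2) ^ n"
      using r by (intro always_eventually) (auto simp: abs_mult mult_left_le)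
  qed
  hence "(\<lambda>n. x - (1 / 2) ^ n * r n) \<longlonglongrightarrow> x - 0" by (intro tendsto_intros)
  hence "(\<lambda>n. (1 / 2) ^ Suc n * a n) sums x" unfolding sums_def part by simp
  moreover have "a n \<in> {0, 1}" for n by (simp add: a_def)
  ultimately show thesis using that by blast
qed

text \<open>On the Cantor set, coordinate \<open>j\<close> takes its binary digits from the ternary
  digits of \<open>t\<close> at the places congruent to \<open>j\<close> modulo the dimension.
  Elsewhere \<open>ternary_digit\<close> interpolates, and uniform convergence makes the coordinates
  continuous.\<close>

lemma space_filling_cube:
  obtains h :: "real \<Rightarrow> 'a::euclidean_space" where "continuous_on UNIV h" "cbox 0 One \<subseteq> h ` {0..1}"
proof -
  define d where "d = DIM('a)"
  have d: "d > 0" by (simp add: d_def)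
  obtain idx where idx: "bij_betw idx (Basis::'a set) {..<d}"
    using ex_bij_betw_finite_nat[of "Basis::'a set"] by (auto simp: d_def atLeast0LessThan)
  define g where "g j t = (\<Sum>k. (1 / 2) ^ Suc k * ternary_digit (3 ^ (k * d + j) * t))" for j t
  have geo: "summable (\<lambda>k. (1 / 2 :: real) ^ Suc k)"
    by (intro summable_Suc_iff[THEN iffD2] summable_geometric) auto
  have gc: "continuous_on UNIV (g j)" for j
    unfolding g_def[abs_def]
  proof (rule uniform_limit_theorem[OF _ Weierstrass_m_test[OF _ geo]])
    show "norm ((1 / 2) ^ Suc n * ternary_digit (3 ^ (n * d + j) * x)) \<le> (1 / 2) ^ Suc n" for n x
      using ternary_digit_bounds[of "3 ^ (n * d + j) * x"] by (simp add: abs_mult mult_left_le)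
    show "\<forall>\<^sub>F n in sequentially. continuous_on UNIV (\<lambda>x. \<Sum>i<n. (1 / 2) ^ Suc i * ternary_digit (3 ^ (i * d + j) * x))"
      unfolding ternary_digit_def by (intro always_eventually allI continuous_intros)
  qed simp
  define h where "h t = (\<Sum>i\<in>Basis. g (idx i) t *\<^sub>R i)" for t :: real
  show thesis
  proof
    show "continuous_on UNIV h" unfolding h_def[abs_def] using gc by (intro continuous_intros)
    show "cbox 0 One \<subseteq> h ` {0..1}"
    proof
      fix x :: 'a assume "x \<in> cbox 0 One"
      hence "0 \<le> x \<bullet> i" "x \<bullet> i \<le> 1" if "i \<in> Basis" for i using that by (auto simp: mem_box)
      hence "\<forall>i\<in>Basis. \<exists>a. (\<forall>n. a n \<in> {0, 1::real}) \<and> (\<lambda>n. (1 / 2) ^ Suc n * a n) sums (x \<bullet> i)"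
        using binary_expansion by metis
      then obtain a where a: "\<And>i n. i \<in> Basis \<Longrightarrow> a i n \<in> {0, 1::real}"
        "\<And>i. i \<in> Basis \<Longrightarrow> (\<lambda>n. (1 / 2) ^ Suc n * a i n) sums (x \<bullet> i)" by metis
      \<comment> \<open>The binary digits of all coordinates, interleaved into one sequence.\<close>
      define c where "c m = a (the_inv_into Basis idx (m mod d)) (m div d)" for m
      have inv: "the_inv_into Basis idx (m mod d) \<in> Basis" for m
        using bij_betw_the_inv_into[OF idx] d by (auto simp: bij_betw_def)
      have c01: "c m \<in> {0, 1}" for m unfolding c_def by (rule a(1)[OF inv])
      have ci: "c (k * d + idx i) = a i k" if "i \<in> Basis" for i k
      proof -
        have "idx i < d" using idx that by (auto simp: bij_betw_def)
        hence "(k * d + idx i) mod d = idx i" "(k * d + idx i) div d = k" using d by auto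
        thus ?thesis using that idx by (simp add: c_def the_inv_into_f_f bij_betw_def)
      qed
      define t where "t = ternary c 0"
      have "g (idx i) t = x \<bullet> i" if "i \<in> Basis" for i
        unfolding g_def t_def ternary_digit_shift[where c = c, OF c01] ci[OF that]
        using sums_unique[OF a(2)[OF that]] by simp
      hence "h t = x" unfolding h_def using euclidean_representation[of x] by simp
      moreover have "t \<in> {0..1}" using ternary_bounds[where c = c, OF c01] by (simp add: t_def)
      ultimately show "x \<in> h ` {0..1}" by blast
    qed
  qed
qed

text \<open>A cube containing \<open>\<Omega>\<close> is retracted onto it by the nearest-point map,
  which is continuous by convexity. Choosing the least parameter as \<open>s x\<close> gives
  measurability: \<open>{x \<in> \<Omega>. s x \<le> a}\<close> is the continuous image of a compact
  set.\<close>

lemma compact_convex_parametrisation: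
  fixes \<Omega> :: "'a::euclidean_space set"
  assumes \<Omega>: "compact \<Omega>" "convex \<Omega>" "\<Omega> \<noteq> {}"
  obtains g :: "real \<Rightarrow> 'a" and s where "continuous_on UNIV g" "\<And>t. g t \<in> \<Omega>"
    "s \<in> borel_measurable (restrict_space borel \<Omega>)" "\<And>x. x \<in> \<Omega> \<Longrightarrow> s x \<in> {0..1} \<and> g (s x) = x"
proof -
  obtain h :: "real \<Rightarrow> 'a" where h: "continuous_on UNIV h" "cbox 0 One \<subseteq> h ` {0..1}"
    by (rule space_filling_cube)
  have cl: "closed \<Omega>" by (rule compact_imp_closed[OF \<Omega>(1)])
  obtain r where r: "r > 0" "\<And>x. x \<in> \<Omega> \<Longrightarrow> norm x \<le> r"
    using compact_imp_bounded[OF \<Omega>(1)] by (auto simp: bounded_pos)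
  define g where "g t = closest_point \<Omega> ((2 * r) *\<^sub>R h t - r *\<^sub>R One)" for t
  have "continuous_on UNIV (closest_point \<Omega>)" by (rule continuous_on_closest_point[OF \<Omega>(2) cl \<Omega>(3)])
  hence gc: "continuous_on UNIV g"
    unfolding g_def[abs_def] by (rule continuous_on_compose2) (auto intro!: continuous_intros h(1))
  have g\<Omega>: "g t \<in> \<Omega>" for t unfolding g_def by (rule closest_point_in_set[OF cl \<Omega>(3)])
  have surj: "\<exists>t\<in>{0..1}. g t = x" if x: "x \<in> \<Omega>" for x
  proof -
    let ?z = "(1 / (2 * r)) *\<^sub>R (x + r *\<^sub>R One)"
    have "?z \<in> cbox 0 One"
    proof (subst mem_box, intro ballI)
      fix i :: 'a assume i: "i \<in> Basis"
      have "\<bar>x \<bullet> i\<bar> \<le> r" using Basis_le_norm[OF i, of x] r(2)[OF x] by simp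
      thus "0 \<bullet> i \<le> ?z \<bullet> i \<and> ?z \<bullet> i \<le> One \<bullet> i"
        using r(1) i by (simp add: inner_add_left abs_le_iff field_simps)
    qed
    then obtain t where t: "t \<in> {0..1}" "h t = ?z" using h(2) by force
    have "(2 * r) *\<^sub>R h t - r *\<^sub>R One = x" using r(1) by (simp add: t(2))
    hence "g t = x" using closest_point_self[OF x] by (simp add: g_def)
    thus ?thesis using t by blast
  qed
  define T where "T x = {t \<in> {0..1}. g t = x}" for x
  define s where "s x = Inf (T x)" for x
  have Tc: "closed (T x)" for x
  proof -
    have "T x = {0..1} \<inter> g -` {x}" by (auto simp: T_def)
    moreover have "closed (g -` {x})" using gc by (intro closed_vimage) auto
    ultimately show ?thesis by auto
  qed
  have Tb: "bdd_below (T x)" for x by (rule bdd_belowI[of _ 0]) (auto simp: T_def)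
  have sT: "s x \<in> T x" if "x \<in> \<Omega>" for x
    unfolding s_def using surj[OF that] by (intro closed_contains_Inf Tc Tb) (auto simp: T_def)
  show thesis
  proof (rule that[OF gc g\<Omega>])
    show "s x \<in> {0..1} \<and> g (s x) = x" if "x \<in> \<Omega>" for x
      using sT[OF that] by (simp add: T_def)
    show "s \<in> borel_measurable (restrict_space borel \<Omega>)"
      unfolding borel_measurable_iff_le
    proof
      fix a :: real
      have "{x \<in> \<Omega>. s x \<le> a} = g ` ({0..1} \<inter> {..a})"
      proof (intro equalityI subsetI)
        fix x assume "x \<in> {x \<in> \<Omega>. s x \<le> a}"
        thus "x \<in> g ` ({0..1} \<inter> {..a})" using sT[of x] by (auto simp: T_def intro!: image_eqI[of _ _ "s x"])
      next
        fix x assume "x \<in> g ` ({0..1} \<inter> {..a})"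
        then obtain t where t: "t \<in> {0..1}" "t \<le> a" "x = g t" by auto
        have "s x \<le> t" unfolding s_def using t by (intro cInf_lower Tb) (auto simp: T_def)
        thus "x \<in> {x \<in> \<Omega>. s x \<le> a}" using t g\<Omega> by auto
      qed
      moreover have "compact (g ` ({0..1} \<inter> {..a}))"
        by (intro compact_continuous_image continuous_on_subset[OF gc] compact_Int_closed) auto
      ultimately have "closed {x \<in> \<Omega>. s x \<le> a}" by (simp add: compact_imp_closed)
      hence "{x \<in> \<Omega>. s x \<le> a} \<in> sets borel" by simp
      thus "{x \<in> space (restrict_space borel \<Omega>). s x \<le> a} \<in> sets (restrict_space borel \<Omega>)"
        using borel_closed[OF cl] by (subst sets_restrict_space_iff) (auto simp: space_restrict_space)
    qed
  qed
qed

text \<open>Measures on \<open>\<Omega>\<close> are lifted to the real line, where Helly's selection theorem applies.\<close>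

lemma mass_ball_sequentially_compact:
  fixes \<Omega> :: "'a::euclidean_space set" and \<mu> :: "nat \<Rightarrow> 'a measure"
  assumes \<Omega>: "compact \<Omega>" "convex \<Omega>" "\<Omega> \<noteq> {}" and \<mu>: "\<And>n. \<mu> n \<in> mass_ball \<Omega> M"
  obtains r l where "strict_mono (r :: nat \<Rightarrow> nat)" "l \<in> mass_ball \<Omega> M"
    "\<And>f. continuous_on \<Omega> f \<Longrightarrow> (\<lambda>n. LINT x|\<mu> (r n). f x) \<longlonglongrightarrow> (LINT x|l. (f x :: real))"
proof -
  let ?B = "restrict_space borel \<Omega>"
  obtain g :: "real \<Rightarrow> 'a" and s where gc: "continuous_on UNIV g" and g\<Omega>: "\<And>t. g t \<in> \<Omega>"
    and sm: "s \<in> borel_measurable ?B" and s: "\<And>x. x \<in> \<Omega> \<Longrightarrow> s x \<in> {0..1} \<and> g (s x) = x"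
  proof (rule compact_convex_parametrisation[OF \<Omega>])
    fix g :: "real \<Rightarrow> 'a" and s
    assume "continuous_on UNIV g" "\<And>t. g t \<in> \<Omega>" "s \<in> borel_measurable ?B" "\<And>x. x \<in> \<Omega> \<Longrightarrow> s x \<in> {0..1} \<and> g (s x) = x"
    thus thesis by (rule that)
  qed
  have rad: "\<mu> n \<in> radon_measures \<Omega>" for n using \<mu>[of n] by (simp add: mass_ball_def)
  note spm = radon_measuresD(3)[OF rad]
  have sm' [measurable]: "s \<in> borel_measurable (\<mu> n)" for n
    using sm radon_measuresD(1)[OF rad] by (simp cong: measurable_cong_sets)
  define m where "m n = measure (\<mu> n) \<Omega>" for n
  have m: "m n \<in> {0..M}" for n using \<mu>[of n] by (simp add: m_def mass_ball_def)
  \<comment> \<open>Helly's theorem is about probability measures, so the total masses are passed to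
    the limit separately.\<close>
  obtain m0 r1 where r1: "strict_mono (r1 :: nat \<Rightarrow> nat)" "(m \<circ> r1) \<longlonglongrightarrow> m0" "m0 \<in> {0..M}"
    using compact_Icc[of 0 M, unfolded compact_def] m by blast
  \<comment> \<open>A zero measure cannot be normalised. Any distribution on the unit interval may
    replace it, since it is multiplied by \<open>m n = 0\<close> in the end.\<close>
  define \<nu> where "\<nu> n = (if m n = 0 then return borel 0
    else distr (density (\<mu> n) (\<lambda>_. ennreal (1 / m n))) borel s)" for n
  have em: "emeasure (\<mu> n) \<Omega> = ennreal (m n)" for n
  proof -
    interpret finite_measure "\<mu> n" using rad by (rule radon_measuresD)
    show ?thesis by (simp add: m_def emeasure_eq_measure)
  qed
  \<comment> \<open>Tightness is phrased with intervals \<open>{a<..b}\<close>; the left end -1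
    leaves the point 0 inside, which the lifts may charge.\<close>
  have \<nu>: "real_distribution (\<nu> n)" "measure (\<nu> n) {-1<..1} = 1" for n
  proof -
    have "real_distribution (\<nu> n) \<and> measure (\<nu> n) {-1<..1} = 1"
    proof (cases "m n = 0")
      case True
      interpret prob_space "return borel (0::real)" by (rule prob_space_return) simp
      show ?thesis using True
        by (auto simp: \<nu>_def real_distribution_def real_distribution_axioms_def measure_return prob_space_axioms)
    next
      case False
      hence mp: "m n > 0" using m[of n] by simp
      let ?D = "density (\<mu> n) (\<lambda>_. ennreal (1 / m n))"
      have D: "emeasure ?D \<Omega> = 1"
      proof -
        have "\<Omega> \<in> sets (\<mu> n)" using sets.top[of "\<mu> n"] spm[of n] by simp
        hence "emeasure ?D \<Omega> = ennreal (1 / m n) * emeasure (\<mu> n) \<Omega>"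
          by (simp add: emeasure_density nn_integral_cmult_indicator)
        thus ?thesis using mp unfolding em by (simp flip: ennreal_mult)
      qed
      interpret D: prob_space ?D by (rule prob_spaceI) (simp add: spm D)
      have "real_distribution (distr ?D borel s)" by (rule D.real_distribution_distr) simp
      moreover have "measure (distr ?D borel s) {-1<..1} = 1"
      proof -
        have "s -` {-1<..1} \<inter> space ?D = space ?D" using s spm by force
        thus ?thesis using D.prob_space by (simp add: measure_distr)
      qed
      ultimately show ?thesis using False by (simp add: \<nu>_def)
    qed
    thus "real_distribution (\<nu> n)" "measure (\<nu> n) {-1<..1} = 1" by auto
  qed
  \<comment> \<open>\<open>g (s x) = x\<close> undoes the lift; if the mass is 0, both sides
    vanish.\<close>
  have int\<nu>: "(LINT x|\<mu> n. f x) = m n * (LINT t|\<nu> n. f (g t))" if f: "continuous_on \<Omega> f" for f :: "'a \<Rightarrow> real" and n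
  proof (cases "m n = 0")
    case True
    interpret finite_measure "\<mu> n" using rad by (rule radon_measuresD)
    have "emeasure (\<mu> n) (space (\<mu> n)) = 0" using em[of n] True spm[of n] by simp
    hence "\<mu> n = null_measure (\<mu> n)"
      by (intro measure_eqI) (auto intro!: emeasure_eq_0[where N = "space (\<mu> n)"] dest: sets.sets_into_space)
    hence "(LINT x|\<mu> n. f x) = (LINT x|null_measure (\<mu> n). f x)" by simp
    thus ?thesis using True by simp
  next
    case False
    hence mp: "m n > 0" using m[of n] by simp
    have fg: "(\<lambda>t. f (g t)) \<in> borel_measurable borel"
      using g\<Omega> by (intro borel_measurable_continuous_onI continuous_on_compose2[OF f gc]) auto
    have fgs: "(\<lambda>x. f (g (s x))) \<in> borel_measurable (\<mu> n)" using fg by measurable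
    have "(LINT t|\<nu> n. f (g t)) = (LINT x|density (\<mu> n) (\<lambda>_. ennreal (1 / m n)). f (g (s x)))"
      using False fg by (simp add: \<nu>_def integral_distr)
    also have "\<dots> = (LINT x|\<mu> n. (1 / m n) *\<^sub>R f (g (s x)))"
      using mp fgs by (intro integral_density) auto
    also have "\<dots> = (LINT x|\<mu> n. f (g (s x))) / m n" by simp
    also have "(LINT x|\<mu> n. f (g (s x))) = (LINT x|\<mu> n. f x)"
      using s spm by (intro Bochner_Integration.integral_cong) auto
    finally show ?thesis using mp by simp
  qed
  have "tight \<nu>"
    unfolding tight_def
  proof (intro conjI allI impI)
    show "real_distribution (\<nu> n)" for n by (rule \<nu>)
    show "\<exists>a b. a < b \<and> (\<forall>n. 1 - e < measure (\<nu> n) {a<..b})" if "0 < e" for e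
      using \<nu>(2) that by (intro exI[of _ "-1"] exI[of _ 1]) simp
  qed
  then obtain r2 \<rho> where r2: "strict_mono (r2 :: nat \<Rightarrow> nat)" and \<rho>: "real_distribution \<rho>"
    and w: "weak_conv_m (\<nu> \<circ> r1 \<circ> r2) \<rho>"
    using tight_imp_convergent_subsubsequence r1(1) by blast
  define r where "r = r1 \<circ> r2"
  interpret \<rho>: real_distribution \<rho> by (rule \<rho>)
  have gm: "g \<in> \<rho> \<rightarrow>\<^sub>M ?B"
    using borel_measurable_continuous_onI[OF gc] g\<Omega> by (intro measurable_restrict_space2) auto
  define l where "l = density (distr \<rho> ?B g) (\<lambda>_. ennreal m0)"
  have m0: "0 \<le> m0" "m0 \<le> M" using r1(3) by auto
  have lint: "(LINT x|l. f x) = m0 * (LINT t|\<rho>. f (g t))" if f: "continuous_on \<Omega> f" for f :: "'a \<Rightarrow> real"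
  proof -
    have fm: "f \<in> borel_measurable ?B" by (rule borel_measurable_continuous_on_restrict[OF f])
    have "(LINT x|l. f x) = (LINT x|distr \<rho> ?B g. m0 *\<^sub>R f x)"
      unfolding l_def using m0 fm by (intro integral_density) auto
    also have "\<dots> = m0 * (LINT x|distr \<rho> ?B g. f x)" by simp
    also have "(LINT x|distr \<rho> ?B g. f x) = (LINT t|\<rho>. f (g t))"
      using gm fm by (intro integral_distr)
    finally show ?thesis .
  qed
  have el: "emeasure l \<Omega> = ennreal m0"
  proof -
    interpret P: prob_space "distr \<rho> ?B g" by (rule \<rho>.prob_space_distr[OF gm])
    have "\<Omega> \<in> sets ?B" using sets.top[of ?B] by (simp add: space_restrict_space)
    moreover have "emeasure (distr \<rho> ?B g) \<Omega> = 1" using P.emeasure_space_1 by (simp add: space_restrict_space)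
    ultimately show ?thesis unfolding l_def by (subst emeasure_density) (auto simp: nn_integral_cmult_indicator)
  qed
  have "finite_measure l"
    using el by (intro finite_measureI) (simp add: l_def space_restrict_space)
  hence "l \<in> mass_ball \<Omega> M"
    using el m0 by (simp add: mass_ball_def radon_measures_def l_def measure_def)
  moreover have "strict_mono r" unfolding r_def using r1(1) r2 by (rule strict_mono_o)
  moreover have "(\<lambda>n. LINT x|\<mu> (r n). f x) \<longlonglongrightarrow> (LINT x|l. f x)" if f: "continuous_on \<Omega> f" for f :: "'a \<Rightarrow> real"
  proof -
    obtain c where c: "\<And>x. x \<in> \<Omega> \<Longrightarrow> norm (f x) \<le> c"
      using compact_imp_bounded[OF compact_continuous_image[OF f \<Omega>(1)]] by (auto simp: bounded_iff)
    have "continuous_on UNIV (\<lambda>t. f (g t))" using g\<Omega> by (intro continuous_on_compose2[OF f gc]) auto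
    hence "isCont (\<lambda>t. f (g t)) t" for t by (simp add: continuous_on_eq_continuous_at)
    hence "(\<lambda>n. LINT t|(\<nu> \<circ> r1 \<circ> r2) n. f (g t)) \<longlonglongrightarrow> (LINT t|\<rho>. f (g t))"
      using \<nu>(1) c g\<Omega> by (intro weak_conv_imp_integral_bdd_continuous_conv[OF _ \<rho> w, where B = c]) auto
    moreover have "(\<lambda>n. m (r n)) \<longlonglongrightarrow> m0"
      using LIMSEQ_subseq_LIMSEQ[OF r1(2) r2] by (simp add: r_def comp_def)
    ultimately have "(\<lambda>n. m (r n) * (LINT t|\<nu> (r n). f (g t))) \<longlonglongrightarrow> m0 * (LINT t|\<rho>. f (g t))"
      by (intro tendsto_mult) (simp_all add: r_def comp_def)
    thus ?thesis by (simp add: int\<nu>[OF f] lint[OF f])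
  qed
  ultimately show thesis using that by blast
qed

section \<open>Boundedness of continuous functions on the mass ball times
  \<open>\<Omega>\<close>\<close>

lemma limitin_mass_ball_top:
  assumes "\<And>n. \<mu> n \<in> mass_ball X M" "l \<in> mass_ball X M"
    and conv: "\<And>f. continuous_on X f \<Longrightarrow> (\<lambda>n. LINT x|\<mu> n. f x) \<longlonglongrightarrow> (LINT x|l. (f x :: real))"
  shows "limitin (mass_ball_top X M) \<mu> l sequentially"
  unfolding mass_ball_top_def limitin_subtopology
proof (intro conjI always_eventually allI assms)
  let ?I = "{f. continuous_on X f}"
  let ?h = "\<lambda>\<mu>. \<lambda>f\<in>?I. LINT x|\<mu>. (f x :: real)"
  let ?P = "product_topology (\<lambda>_. euclideanreal) ?I"
  have "limitin ?P (\<lambda>n. ?h (\<mu> n)) (?h l) sequentially"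
    unfolding limitin_componentwise using conv by auto
  hence lim: "eventually (\<lambda>n. ?h (\<mu> n) \<in> U) sequentially" if "openin ?P U" "?h l \<in> U" for U
    using that by (auto simp: limitin_def)
  have rad: "\<mu> n \<in> radon_measures X" "l \<in> radon_measures X" for n
    using assms by (auto simp: mass_ball_def)
  show "limitin (weak_star X) \<mu> l sequentially"
    unfolding limitin_def
  proof (intro conjI allI impI)
    fix U assume U: "openin (weak_star X) U \<and> l \<in> U"
    then obtain V where V: "openin ?P V" "U = ?h -` V \<inter> radon_measures X"
      unfolding weak_star_def openin_pullback_topology by auto
    have "eventually (\<lambda>n. ?h (\<mu> n) \<in> V) sequentially" using U V by (intro lim) auto
    thus "eventually (\<lambda>n. \<mu> n \<in> U) sequentially" by eventually_elim (use V rad in auto)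
  qed (use rad in simp)
qed

text \<open>A sequence along which \<open>F\<close> exceeds every bound would have a subsequence
  converging in both arguments; along it \<open>F\<close> converges and hence is bounded.\<close>

lemma continuous_map_mass_ball_bounded:
  fixes \<Omega> :: "'a::euclidean_space set"
  assumes \<Omega>: "compact \<Omega>" "convex \<Omega>" "\<Omega> \<noteq> {}"
    and F: "continuous_map (prod_topology (mass_ball_top \<Omega> M) (top_of_set \<Omega>)) euclideanreal (\<lambda>(\<mu>, x). F \<mu> x)"
  obtains c where "\<And>\<mu> x. \<mu> \<in> mass_ball \<Omega> M \<Longrightarrow> x \<in> \<Omega> \<Longrightarrow> \<bar>F \<mu> x\<bar> \<le> c"
proof (rule ccontr)
  assume "\<not> thesis"
  hence "\<forall>n::nat. \<exists>\<mu> x. \<mu> \<in> mass_ball \<Omega> M \<and> x \<in> \<Omega> \<and> \<bar>F \<mu> x\<bar> > real n"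
    using that by (meson not_le)
  then obtain \<mu> x where \<mu>: "\<And>n::nat. \<mu> n \<in> mass_ball \<Omega> M" and x: "\<And>n. x n \<in> \<Omega>"
    and big: "\<And>n. \<bar>F (\<mu> n) (x n)\<bar> > real n" by metis
  obtain x0 r1 where r1: "strict_mono (r1 :: nat \<Rightarrow> nat)" "(x \<circ> r1) \<longlonglongrightarrow> x0" "x0 \<in> \<Omega>"
    using \<Omega>(1)[unfolded compact_def] x by blast
  obtain r2 l where r2: "strict_mono (r2 :: nat \<Rightarrow> nat)" and l: "l \<in> mass_ball \<Omega> M"
    and conv: "\<And>f. continuous_on \<Omega> f \<Longrightarrow> (\<lambda>n. LINT x|\<mu> (r1 (r2 n)). f x) \<longlonglongrightarrow> (LINT x|l. (f x :: real))"
  proof (rule mass_ball_sequentially_compact[OF \<Omega>, of "\<lambda>n. \<mu> (r1 n)" M])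
    show "\<mu> (r1 n) \<in> mass_ball \<Omega> M" for n by (rule \<mu>)
    fix r2 l
    assume "strict_mono (r2 :: nat \<Rightarrow> nat)" "l \<in> mass_ball \<Omega> M"
      "\<And>f. continuous_on \<Omega> f \<Longrightarrow> (\<lambda>n. LINT x|\<mu> (r1 (r2 n)). f x) \<longlonglongrightarrow> (LINT x|l. (f x :: real))"
    thus thesis by (rule that)
  qed
  define r where "r n = r1 (r2 n)" for n
  have r: "strict_mono r" using r1(1) r2 by (simp add: r_def strict_mono_def)
  have "limitin (mass_ball_top \<Omega> M) (\<lambda>n. \<mu> (r n)) l sequentially"
    using \<mu> l conv by (intro limitin_mass_ball_top) (auto simp: r_def)
  moreover have "(\<lambda>n. x (r n)) \<longlonglongrightarrow> x0"
    using LIMSEQ_subseq_LIMSEQ[OF r1(2) r2] by (simp add: r_def comp_def)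
  hence "limitin (top_of_set \<Omega>) (\<lambda>n. x (r n)) x0 sequentially"
    using x r1(3) by (simp add: limitin_subtopology)
  ultimately have "limitin (prod_topology (mass_ball_top \<Omega> M) (top_of_set \<Omega>)) (\<lambda>n. (\<mu> (r n), x (r n))) (l, x0) sequentially"
    by (simp add: limitin_pairwise comp_def)
  from continuous_map_limit[OF F this] have "(\<lambda>n. F (\<mu> (r n)) (x (r n))) \<longlonglongrightarrow> F l x0"
    by (simp add: comp_def)
  hence "Bseq (\<lambda>n. F (\<mu> (r n)) (x (r n)))" by (intro convergent_imp_Bseq) (auto simp: convergent_def)
  then obtain K where K: "\<And>n. \<bar>F (\<mu> (r n)) (x (r n))\<bar> \<le> K" by (auto simp: Bseq_def)
  obtain n :: nat where n: "K < real n" using reals_Archimedean2 by blast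
  have "real n \<le> real (r n)" using strict_mono_imp_increasing[OF r] by simp
  also have "\<dots> < \<bar>F (\<mu> (r n)) (x (r n))\<bar>" by (rule big)
  also have "\<dots> \<le> K" by (rule K)
  finally show False using n by simp
qed

section \<open>Weak duality and the theorem\<close>

text \<open>\<open>F\<close> is the pointwise limit of functions that depend on the second variable only through a
  simple function.\<close>

lemma measurable_pair_continuous_map:
  fixes \<Omega> :: "'a::euclidean_space set"
  assumes \<Omega>: "compact \<Omega>" "convex \<Omega>" "\<Omega> \<noteq> {}"
    and \<Lambda>: "\<Lambda> \<in> borel_prob_measures T" and \<nu>: "\<nu> \<in> radon_measures \<Omega>"
    and F: "continuous_map (prod_topology T (top_of_set \<Omega>)) euclideanreal (\<lambda>(\<mu>, x). F \<mu> x)"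
  shows "(\<lambda>(\<mu>, x). F \<mu> x) \<in> borel_measurable (\<Lambda> \<Otimes>\<^sub>M \<nu>)"
proof -
  have spL: "space \<Lambda> = topspace T" by (rule borel_prob_measuresD[OF \<Lambda>])
  have spN: "space \<nu> = \<Omega>" by (rule radon_measuresD[OF \<nu>])
  have cl: "closed \<Omega>" by (rule compact_imp_closed[OF \<Omega>(1)])
  have "(\<lambda>y. y) \<in> borel_measurable \<nu>"
    by (rule radon_measurable_continuous[OF \<nu>]) (intro continuous_intros)
  then obtain s where s: "\<And>i. simple_function \<nu> (s i)" "\<And>y. y \<in> \<Omega> \<Longrightarrow> (\<lambda>i. s i y) \<longlonglongrightarrow> y"
    using borel_measurable_implies_sequence_metric[of "\<lambda>y. y" \<nu> 0] spN by metis
  \<comment> \<open>The values of the simple functions may leave \<open>\<Omega>\<close>, where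
    nothing is known about \<open>F\<close>; the nearest-point map brings them back continuously and
    fixes the points of \<open>\<Omega>\<close>.\<close>
  define c where "c = closest_point \<Omega>"
  have c\<Omega>: "c y \<in> \<Omega>" for y unfolding c_def by (rule closest_point_in_set[OF cl \<Omega>(3)])
  have "continuous_on UNIV c" unfolding c_def by (rule continuous_on_closest_point[OF \<Omega>(2) cl \<Omega>(3)])
  hence cc: "isCont c y" for y by (simp add: continuous_on_eq_continuous_at)
  have slice1: "(\<lambda>\<mu>. F \<mu> y) \<in> borel_measurable \<Lambda>" if y: "y \<in> \<Omega>" for y
  proof (rule measurable_continuous_map[OF \<Lambda>])
    have "continuous_map T (prod_topology T (top_of_set \<Omega>)) (\<lambda>\<mu>. (\<mu>, y))"
      using y by (simp add: continuous_map_pairwise comp_def)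
    from continuous_map_compose[OF this F] show "continuous_map T euclideanreal (\<lambda>\<mu>. F \<mu> y)"
      by (simp add: comp_def)
  qed
  have slice2: "continuous_on \<Omega> (F \<mu>)" if \<mu>: "\<mu> \<in> topspace T" for \<mu>
  proof -
    have "continuous_map (top_of_set \<Omega>) (prod_topology T (top_of_set \<Omega>)) (\<lambda>y. (\<mu>, y))"
      using \<mu> by (simp add: continuous_map_pairwise comp_def)
    from continuous_map_compose[OF this F] show ?thesis
      by (simp add: comp_def)
  qed
  have "(\<lambda>p. F (fst p) (c (s i (snd p)))) \<in> borel_measurable (\<Lambda> \<Otimes>\<^sub>M \<nu>)" for i
  proof (rule measurable_compose_countable'[where f = "\<lambda>v p. F (fst p) (c v)" and g = "\<lambda>p. s i (snd p)"])
    show "countable (s i ` space \<nu>)" using simple_functionD(1)[OF s(1)] by (rule countable_finite)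
    show "(\<lambda>p. F (fst p) (c v)) \<in> borel_measurable (\<Lambda> \<Otimes>\<^sub>M \<nu>)" for v
      by (rule measurable_compose[OF measurable_fst slice1[OF c\<Omega>]])
    have "s i \<in> \<nu> \<rightarrow>\<^sub>M count_space (s i ` space \<nu>)"
      using measurable_sets[OF measurable_simple_function[OF s(1)]] by (auto simp: measurable_def)
    thus "(\<lambda>p. s i (snd p)) \<in> (\<Lambda> \<Otimes>\<^sub>M \<nu>) \<rightarrow>\<^sub>M count_space (s i ` space \<nu>)"
      by (rule measurable_compose[OF measurable_snd])
  qed
  moreover have "(\<lambda>i. F (fst p) (c (s i (snd p)))) \<longlonglongrightarrow> F (fst p) (snd p)"
    if "p \<in> space (\<Lambda> \<Otimes>\<^sub>M \<nu>)" for p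
  proof -
    have p: "fst p \<in> topspace T" "snd p \<in> \<Omega>" using that by (simp_all add: space_pair_measure spL spN mem_Times_iff)
    have "(\<lambda>i. c (s i (snd p))) \<longlonglongrightarrow> c (snd p)"
      using cc s(2)[OF p(2)] by (rule isCont_tendsto_compose)
    hence "(\<lambda>i. c (s i (snd p))) \<longlonglongrightarrow> snd p"
      using closest_point_self[OF p(2)] by (simp add: c_def)
    thus ?thesis
      by (rule continuous_on_tendsto_compose[OF slice2[OF p(1)]]) (use p(2) c\<Omega> in auto)
  qed
  ultimately have "(\<lambda>p. F (fst p) (snd p)) \<in> borel_measurable (\<Lambda> \<Otimes>\<^sub>M \<nu>)"
    by (rule borel_measurable_LIMSEQ_real[rotated])
  thus ?thesis by (simp add: case_prod_beta')
qed

lemma barycentre_duality_ge: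
  fixes \<Omega> :: "'a::euclidean_space set" and M \<kappa> :: real
  assumes \<Omega>: "compact \<Omega>" "convex \<Omega>" "\<Omega> \<noteq> {}" and \<kappa>: "0 < \<kappa>"
    and \<Lambda>: "\<Lambda> \<in> borel_prob_measures (mass_ball_top \<Omega> M)"
    and adm: "(\<Psi>, \<Phi>) \<in> dual_admissible \<kappa> \<Omega> M \<Lambda>" and \<nu>: "\<nu> \<in> radon_measures \<Omega>"
  shows "ennreal (LINT \<mu>|\<Lambda>. (LINT x|\<mu>. \<Psi> \<mu> x)) \<le> (\<integral>\<^sup>+ \<mu>. HK2 \<kappa> \<Omega> \<mu> \<nu> \<partial>\<Lambda>)"
proof (cases "integrable \<Lambda> (\<lambda>\<mu>. LINT x|\<mu>. \<Psi> \<mu> x)")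
  case False \<comment> \<open>the outer integral is then \<open>0\<close> by convention\<close>
  thus ?thesis by (simp add: not_integrable_integral_eq)
next
  case True
  interpret L: prob_space \<Lambda> using \<Lambda> by (rule borel_prob_measuresD)
  interpret N: finite_measure \<nu> using \<nu> by (rule radon_measuresD)
  interpret LN: pair_sigma_finite \<Lambda> \<nu> ..
  interpret fLN: finite_measure "\<Lambda> \<Otimes>\<^sub>M \<nu>"
    by (intro finite_measure_pair_measure L.finite_measure_axioms N.finite_measure_axioms)
  have spL: "space \<Lambda> = mass_ball \<Omega> M" using borel_prob_measuresD(2)[OF \<Lambda>] by simp
  have spN: "space \<nu> = \<Omega>" by (rule radon_measuresD[OF \<nu>])
  have c\<Phi>: "continuous_map (prod_topology (mass_ball_top \<Omega> M) (top_of_set \<Omega>)) euclideanreal (\<lambda>(\<mu>, x). \<Phi> \<mu> x)"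
    and Q: "\<And>\<mu>. \<mu> \<in> mass_ball \<Omega> M \<Longrightarrow> (\<Psi> \<mu>, \<Phi> \<mu>) \<in> Q_set \<kappa> \<Omega>"
    and \<Phi>0: "\<And>y. y \<in> \<Omega> \<Longrightarrow> 0 \<le> (LINT \<mu>|\<Lambda>. \<Phi> \<mu> y)"
    using adm by (auto simp: dual_admissible_def)
  obtain c where c: "\<And>\<mu> x. \<mu> \<in> mass_ball \<Omega> M \<Longrightarrow> x \<in> \<Omega> \<Longrightarrow> \<bar>\<Phi> \<mu> x\<bar> \<le> c"
  proof (rule continuous_map_mass_ball_bounded[OF \<Omega> c\<Phi>])
    fix c assume "\<And>\<mu> x. \<mu> \<in> mass_ball \<Omega> M \<Longrightarrow> x \<in> \<Omega> \<Longrightarrow> \<bar>\<Phi> \<mu> x\<bar> \<le> c"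
    thus thesis by (rule that)
  qed
  have i: "integrable (\<Lambda> \<Otimes>\<^sub>M \<nu>) (\<lambda>(\<mu>, y). \<Phi> \<mu> y)"
    using c spL spN by (intro fLN.integrable_const_bound[where B = c] measurable_pair_continuous_map[OF \<Omega> \<Lambda> \<nu> c\<Phi>])
      (auto simp: space_pair_measure intro!: AE_I2)
  have iF: "integrable \<Lambda> (\<lambda>\<mu>. LINT y|\<nu>. \<Phi> \<mu> y)"
    using LN.integrable_fst[OF i] .
  \<comment> \<open>The constraint on \<open>\<Phi>\<close> concerns the integral over
    \<open>\<Lambda>\<close> at fixed \<open>y\<close>, whereas \<open>HK2_ge\<close> works at fixed
    \<open>\<mu>\<close>; hence the change in the order of integration.\<close>
  have "0 \<le> (LINT y|\<nu>. (LINT \<mu>|\<Lambda>. \<Phi> \<mu> y))"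
  proof (rule integral_nonneg_AE, rule AE_I2)
    show "0 \<le> (LINT \<mu>|\<Lambda>. \<Phi> \<mu> y)" if "y \<in> space \<nu>" for y using \<Phi>0 that spN by simp
  qed
  also have "\<dots> = (LINT \<mu>|\<Lambda>. (LINT y|\<nu>. \<Phi> \<mu> y))"
    by (rule LN.Fubini_integral[OF i])
  finally have "(LINT \<mu>|\<Lambda>. (LINT x|\<mu>. \<Psi> \<mu> x)) \<le> (LINT \<mu>|\<Lambda>. (LINT x|\<mu>. \<Psi> \<mu> x) + (LINT y|\<nu>. \<Phi> \<mu> y))"
    using True iF by simp
  hence "ennreal (LINT \<mu>|\<Lambda>. (LINT x|\<mu>. \<Psi> \<mu> x)) \<le> ennreal (LINT \<mu>|\<Lambda>. (LINT x|\<mu>. \<Psi> \<mu> x) + (LINT y|\<nu>. \<Phi> \<mu> y))"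
    by (rule ennreal_leI)
  also have "\<dots> \<le> (\<integral>\<^sup>+ \<mu>. ennreal ((LINT x|\<mu>. \<Psi> \<mu> x) + (LINT y|\<nu>. \<Phi> \<mu> y)) \<partial>\<Lambda>)"
    using True iF by (intro ennreal_integral_le_nn_integral) auto
  also have "\<dots> \<le> (\<integral>\<^sup>+ \<mu>. HK2 \<kappa> \<Omega> \<mu> \<nu> \<partial>\<Lambda>)"
    using Q spL by (intro nn_integral_mono HK2_ge[OF \<Omega>(1) \<kappa> _ \<nu>]) (auto simp: mass_ball_def)
  finally show ?thesis .
qed

text \<open>It makes the supremum nonnegative, which settles the case where \<open>ennreal\<close>
  cuts off a negative bound.\<close>

lemma zero_dual_admissible: "((\<lambda>_ _. 0), (\<lambda>_ _. 0)) \<in> dual_admissible \<kappa> \<Omega> M \<Lambda>"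
  by (auto simp: dual_admissible_def Q_set_def Cos_sq_le_1 case_prod_beta')

theorem proposition3p7:
  fixes \<Omega> :: "'a::euclidean_space set" and M \<kappa> :: real and \<Lambda> :: "'a measure measure"
  assumes "compact \<Omega>" and "convex \<Omega>" and "interior \<Omega> \<noteq> {}"
    and "0 < M" and "0 < \<kappa>"
    and "\<Lambda> \<in> borel_prob_measures (mass_ball_top \<Omega> M)"
  shows "enn2ereal (INF \<nu> \<in> radon_measures \<Omega>. \<integral>\<^sup>+ \<mu>. HK2 \<kappa> \<Omega> \<mu> \<nu> \<partial>\<Lambda>)
    = (SUP (\<Psi>, \<Phi>) \<in> dual_admissible \<kappa> \<Omega> M \<Lambda>. ereal (LINT \<mu>|\<Lambda>. (LINT x|\<mu>. \<Psi> \<mu> x)))"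
proof (rule antisym)
  have ne: "\<Omega> \<noteq> {}" using assms(3) by auto
  let ?v = "\<lambda>p. case p of (\<Psi>, \<Phi>) \<Rightarrow> ereal (LINT \<mu>|\<Lambda>. (LINT x|\<mu>. \<Psi> \<mu> x))"
  let ?D = "dual_admissible \<kappa> \<Omega> M \<Lambda>"
  let ?I = "INF \<nu> \<in> radon_measures \<Omega>. \<integral>\<^sup>+ \<mu>. HK2 \<kappa> \<Omega> \<mu> \<nu> \<partial>\<Lambda>"
  show "(SUP p \<in> ?D. ?v p) \<le> enn2ereal ?I"
  proof (rule SUP_least)
    fix p assume "p \<in> ?D"
    then obtain \<Psi> \<Phi> where p: "p = (\<Psi>, \<Phi>)" "(\<Psi>, \<Phi>) \<in> ?D" by (cases p) auto
    let ?X = "LINT \<mu>|\<Lambda>. (LINT x|\<mu>. \<Psi> \<mu> x)"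
    have "ennreal ?X \<le> ?I"
      by (intro INF_greatest barycentre_duality_ge[OF assms(1,2) ne assms(5,6) p(2)])
    hence "enn2ereal (ennreal ?X) \<le> enn2ereal ?I" by (simp add: less_eq_ennreal.rep_eq)
    moreover have "ereal ?X \<le> enn2ereal (ennreal ?X)"
      by (cases "0 \<le> ?X") (simp_all add: ennreal_neg zero_ennreal.rep_eq)
    ultimately show "?v p \<le> enn2ereal ?I" by (simp add: p)
  qed
  show "enn2ereal ?I \<le> (SUP p \<in> ?D. ?v p)"
  proof (rule ereal_le_epsilon2)
    fix e :: real assume e: "0 < e"
    obtain \<nu> \<Psi> \<Phi> where \<nu>: "\<nu> \<in> radon_measures \<Omega>" and adm: "(\<Psi>, \<Phi>) \<in> ?D"
      and le: "(\<integral>\<^sup>+ \<mu>. HK2 \<kappa> \<Omega> \<mu> \<nu> \<partial>\<Lambda>) \<le> ennreal ((LINT \<mu>|\<Lambda>. (LINT x|\<mu>. \<Psi> \<mu> x)) + e)"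
      using barycentre_duality_le[OF assms(1) ne assms(4,5,6) e] by blast
    let ?X = "LINT \<mu>|\<Lambda>. (LINT x|\<mu>. \<Psi> \<mu> x)"
    have S0: "0 \<le> (SUP p \<in> ?D. ?v p)"
      by (rule SUP_upper2[OF zero_dual_admissible]) simp
    have X: "ereal ?X \<le> (SUP p \<in> ?D. ?v p)"
      by (rule SUP_upper2[OF adm]) simp
    have "?I \<le> ennreal (?X + e)" by (rule INF_lower2[where f = "\<lambda>\<nu>. \<integral>\<^sup>+ \<mu>. HK2 \<kappa> \<Omega> \<mu> \<nu> \<partial>\<Lambda>", OF \<nu> le])
    hence "enn2ereal ?I \<le> enn2ereal (ennreal (?X + e))" by (simp add: less_eq_ennreal.rep_eq)
    also have "\<dots> = max 0 (ereal ?X + ereal e)"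
      by (cases "0 \<le> ?X + e") (simp_all add: ennreal_neg zero_ennreal.rep_eq max_def)
    also have "\<dots> \<le> (SUP p \<in> ?D. ?v p) + ereal e"
      using S0 X e by (intro max.boundedI add_nonneg_nonneg add_right_mono) auto
    finally show "enn2ereal ?I \<le> (SUP p \<in> ?D. ?v p) + ereal e" .
  qed
qed

end
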